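(* Let $d \geq 2$, let $A$ and $D$ be constant real $d\times d$ matrices such that all eigenvalues of $A$ have positive real parts, and let $F:\mathbb{R}^d\to\mathbb{R}^d$ be a continuous function with $F(x)=o(\|x\|)$ as $\|x\|\to\infty$. Let $W=(W_t)_{t\ge 0}$ be a $d$-dimensional standard Brownian motion, and consider the stochastic differential equation $$\mathrm{d}X_t=[F(X_t)-AX_t]\,\mathrm{d}t+D\,\mathrm{d}W_t .$$ Let $\lambda_1$ be the largest eigenvalue of the matrix $$\Sigma:=\int_0^\infty e^{-sA}\,(D D^T)\,e^{-sA^T}\,\mathrm{d}s .$$ Then the solution always satisfies $$\limsup_{t\to\infty}\frac{\|X_t\|}{\sqrt{\log t}}=\sqrt{2\lambda_1}\quad\text{almost surely},$$ and the discarded measure-zero set can be chosen independent of the initial value $X_0=x$; that is, there is a single event $N$ of probability zero such that for every $\omega\notin N$ and every $x\in\mathbb{R}^d$, the equality $\limsup_{t\to\infty}\frac{\|X_t\|}{\sqrt{\log t}}=\sqrt{2\lambda_1}$ holds along the path at $\omega$ of the solution started from $X_0=x$.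
   Context: $\|\cdot\|$ denotes the standard Euclidean norm on $\mathbb{R}^d$, and $M^T$ denotes the transpose of a matrix $M$. Since the noise is additive, a solution with initial value $X_0=x$ is understood pathwise: for the given $\omega$, it is a continuous function $t\mapsto X_t$ on $[0,\infty)$ satisfying $X_t=x+\int_0^t [F(X_s)-AX_s]\,\mathrm{d}s+D W_t$ for all $t\ge 0$ (with $W$ having continuous paths and $W_0=0$). As $F$ is only assumed continuous, "the solution started from $x$" refers to any such solution. *)

theory Defs
  imports "HOL-Probability.Probability" "HOL-Library.Landau_Symbols"
begin

definition eigenvalues :: "'a::field ^ 'n ^ 'n \<Rightarrow> 'a set" where
  "eigenvalues A = {c. \<exists>v. v \<noteq> 0 \<and> A *v v = c *s v}"

(* The times and one instances of vec are componentwise, so the powers are taken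
   explicitly with respect to the matrix product. *)
definition matrix_exp :: "real ^ 'n ^ 'n \<Rightarrow> real ^ 'n ^ 'n" where
  "matrix_exp A = (\<Sum>k. (1 / fact k) *\<^sub>R (((**) A) ^^ k) (mat 1))"

definition stationary_covariance :: "real ^ 'n ^ 'n \<Rightarrow> real ^ 'n ^ 'n \<Rightarrow> real ^ 'n ^ 'n" where
  "stationary_covariance A D =
     integral {0..} (\<lambda>s. matrix_exp ((- s) *\<^sub>R A) ** (D ** transpose D)
                           ** matrix_exp ((- s) *\<^sub>R transpose A))"

(* The time parameter has type real; only the values at times t >= 0 matter.
   The increment over [s, t] has distribution N(0, (t - s) I); the second argument of
   normal_density is the standard deviation. *)
definition standard_brownian_motion :: "'w measure \<Rightarrow> (real \<Rightarrow> 'w \<Rightarrow> real ^ 'n) \<Rightarrow> bool" where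
  "standard_brownian_motion M W \<longleftrightarrow>
     prob_space M \<and>
     (\<forall>t\<ge>0. W t \<in> borel_measurable M) \<and>
     (\<forall>\<omega>\<in>space M. W 0 \<omega> = 0) \<and>
     (\<forall>\<omega>\<in>space M. continuous_on {0..} (\<lambda>t. W t \<omega>)) \<and>
     (\<forall>s t. 0 \<le> s \<longrightarrow> s < t \<longrightarrow>
        distributed M lborel (\<lambda>\<omega>. W t \<omega> - W s \<omega>)
          (\<lambda>x. ennreal (\<Prod>i\<in>UNIV. normal_density 0 (sqrt (t - s)) (x $ i)))) \<and>
     (\<forall>(n::nat) \<tau>. 0 \<le> \<tau> 0 \<longrightarrow> (\<forall>i<n. \<tau> i \<le> \<tau> (Suc i)) \<longrightarrow>
        prob_space.indep_vars M (\<lambda>_. borel) (\<lambda>i \<omega>. W (\<tau> (Suc i)) \<omega> - W (\<tau> i) \<omega>) {..<n})"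

(* Pathwise solution of dX = [F(X) - A X] dt + D dw started from x, for one noise path w. *)
definition pathwise_solution ::
  "(real ^ 'n \<Rightarrow> real ^ 'n) \<Rightarrow> real ^ 'n ^ 'n \<Rightarrow> real ^ 'n ^ 'n \<Rightarrow>
   (real \<Rightarrow> real ^ 'n) \<Rightarrow> real ^ 'n \<Rightarrow> (real \<Rightarrow> real ^ 'n) \<Rightarrow> bool" where
  "pathwise_solution F A D w x X \<longleftrightarrow>
     continuous_on {0..} X \<and>
     (\<forall>t\<ge>0. X t = x + integral {0..t} (\<lambda>s. F (X s) - A *v X s) + D *v w t)"

end

theory Submission
  imports Defs "HOL-Computational_Algebra.Fundamental_Theorem_Algebra" "HOL-Real_Asymp.Real_Asymp"
begin

text \<open>
  All growth statements are written as \<open>|f(t)| \<le> \<gamma> ell(t) + B\<close> for all \<open>t \<ge> 0\<close>, with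
  \<open>ell(t) = sqrt(log(t + 3)) \<ge> 1\<close>: the additive constant absorbs everything bounded, and
  monotonicity of \<open>ell\<close> makes such bounds stable under convolution with an exponentially
  decaying kernel.

  Write \<open>E(t) = exp(-tA)\<close>. The spectral hypothesis gives \<open>|E(t)v| \<le> K exp(-at) |v|\<close> with
  \<open>a > 0\<close> (\<open>flow_decay\<close>). On a grid of mesh \<open>\<delta>\<close>, variation of constants compares a solution
  \<open>X\<close> at time \<open>k\<delta>\<close> with the explicit Gaussian vector
  \<open>Z_k = (\<Sum>j<k. E((k-1-j)\<delta>) D (W_{(j+1)\<delta>} - W_{j\<delta>}))\<close>, which depends neither on \<open>X\<close> nor on its
  initial value. The error consists of three parts: the contribution of \<open>F\<close>, which is at most
  \<open>\<epsilon> sup|X| + C\<close> for every \<open>\<epsilon> > 0\<close>; the forgotten initial value; and the oscillation of the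
  Brownian path over one cell, which is at most \<open>\<eta> ell(t) + B\<close> for any prescribed \<open>\<eta>\<close> as
  soon as \<open>\<delta>\<close> is small (\<open>brownian_modulus\<close>, by dyadic chaining). Contraction by \<open>E\<close> keeps the
  accumulated errors bounded by a constant multiple of the error over unit time, uniformly in
  \<open>\<delta>\<close>, so on one event of full probability every solution satisfies
  \<open>|X_{k\<delta>} - Z_k| \<le> \<kappa> ell(k\<delta>) + B\<close> (\<open>solution_near_noise_sum\<close>). It remains to study \<open>Z\<close>.

  For a unit vector \<open>\<theta>\<close> the variable \<open>\<theta> \<bullet> Z_k\<close> is centred normal, and its variance is a Riemann
  sum of \<open>s \<mapsto> |D^T E(s)^T \<theta>|^2\<close>, whose integral over the half-line is \<open>\<theta> \<bullet> \<Sigma>\<theta> \<le> \<lambda>1\<close>. The Gaussian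
  tail \<open>exp(-r^2/2v)\<close> at \<open>r = \<gamma> ell(k\<delta>)\<close> is summable in \<open>k\<close> as soon as \<open>\<gamma>^2 > 2v\<close>. The
  Borel-Cantelli lemma, applied to a finite net of directions, then gives the upper bound
  (\<open>Z_growth_upper\<close>).

  For the lower bound take \<open>\<theta>\<close> to be an eigenvector for \<open>\<lambda>1\<close> and cut time into blocks of \<open>L\<close>
  cells. The contributions of different blocks to \<open>\<theta> \<bullet> Z\<close> are independent with variance close
  to \<open>\<lambda>1\<close>, and for \<open>\<gamma>^2 < 2v\<close> their exceedance probabilities dominate a harmonic series; so
  infinitely many blocks exceed \<open>\<gamma> ell(t)\<close> (\<open>block_recurrent\<close>). What the earlier blocks
  contribute is damped by \<open>E(L\<delta>)\<close> and is negligible for large \<open>L\<close>.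
\<close>

section \<open>The matrix exponential\<close>

lemma bounded_bilinear_matrix_vector_mult:
  "bounded_bilinear ((*v) :: real^'n^'m \<Rightarrow> real^'n \<Rightarrow> real^'m)"
  by (subst bilinear_conv_bounded_bilinear[symmetric])
     (auto simp: bilinear_def matrix_vector_mult_add_rdistrib scaleR_matrix_vector_assoc
        intro!: linearI matrix_vector_right_distrib)

lemma bounded_bilinear_matrix_matrix_mult:
  "bounded_bilinear ((**) :: real^'n^'m \<Rightarrow> real^'p^'n \<Rightarrow> real^'p^'m)"
proof (subst bilinear_conv_bounded_bilinear[symmetric], unfold bilinear_def, safe)
  fix A :: "real^'n^'m" show "linear ((**) A :: real^'p^'n \<Rightarrow> real^'p^'m)"
    by (rule linearI) (simp_all add: matrix_add_ldistrib matrix_scalar_ac flip: scalar_matrix_assoc)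
next
  fix B :: "real^'p^'n" show "linear (\<lambda>A::real^'n^'m. A ** B)"
    by (rule linearI) (simp_all add: matrix_matrix_mult_def vec_eq_iff distrib_right sum.distrib sum_distrib_left mult.assoc)
qed

text \<open>Powers for the matrix product. (The operator \<open>^\<close> on matrices would be entrywise.)\<close>

abbreviation matpow :: "real^'n^'n \<Rightarrow> nat \<Rightarrow> real^'n^'n" where
  "matpow A k \<equiv> (((**) A) ^^ k) (mat 1)"

lemma matpow_scaleR: "matpow (c *\<^sub>R A) k = c ^ k *\<^sub>R matpow A k"
  by (induction k) (simp_all add: matrix_scalar_ac flip: scalar_matrix_assoc)

lemma matpow_commute: "A ** matpow A k = matpow A k ** A"
  by (induction k) (simp_all add: matrix_mul_assoc)

lemma transpose_matpow: "matpow (transpose A) k = transpose (matpow A k)"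
proof (induction k)
  case (Suc k)
  have "transpose (matpow A (Suc k)) = transpose (matpow A k ** A)"
    by (simp add: matpow_commute)
  with Suc show ?case by (simp add: matrix_transpose_mul)
qed simp


lemma norm_matpow_mult_le:
  fixes A :: "real^'n^'n"
  shows "norm (matpow A k *v x) \<le> onorm ((*v) A) ^ k * norm x"
proof (induction k)
  case (Suc k)
  have "norm (matpow A (Suc k) *v x) = norm (A *v (matpow A k *v x))"
    by (simp add: matrix_vector_mul_assoc)
  also have "\<dots> \<le> onorm ((*v) A) * norm (matpow A k *v x)"
    by (rule onorm) (rule matrix_vector_mul_bounded_linear)
  also have "\<dots> \<le> onorm ((*v) A) * (onorm ((*v) A) ^ k * norm x)"
    by (intro mult_left_mono Suc onorm_pos_le matrix_vector_mul_bounded_linear)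
  finally show ?case by (simp add: mult_ac)
qed simp

lemma abs_matpow_nth_le: "\<bar>matpow A k $ i $ j\<bar> \<le> onorm ((*v) A) ^ k"
proof -
  have "\<bar>matpow A k $ i $ j\<bar> = \<bar>(matpow A k *v axis j 1) $ i\<bar>"
    by (simp add: matrix_vector_mul_component inner_axis)
  also have "\<dots> \<le> norm (matpow A k *v axis j 1)" by (rule component_le_norm_cart)
  also have "\<dots> \<le> onorm ((*v) A) ^ k * norm (axis j (1::real) :: real^_)" by (rule norm_matpow_mult_le)
  finally show ?thesis by simp
qed

lemma summable_matpow_nth:
  fixes A :: "real^'n^'n" shows "summable (\<lambda>k. (matpow A k $ i $ j / fact k) * t ^ k)"
proof (rule summable_comparison_test)
  show "summable (\<lambda>k. inverse (fact k) * (onorm ((*v) A) * \<bar>t\<bar>) ^ k)" by (rule summable_exp)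
  have "norm (matpow A k $ i $ j / fact k * t ^ k) \<le> inverse (fact k) * (onorm ((*v) A) * \<bar>t\<bar>) ^ k" for k
    using abs_matpow_nth_le[where A = A and k = k]
    by (auto simp: abs_mult power_abs power_mult_distrib divide_simps intro!: mult_right_mono)
  then show "\<exists>N. \<forall>n\<ge>N. norm (matpow A n $ i $ j / fact n * t ^ n) \<le> inverse (fact n) * (onorm ((*v) A) * \<bar>t\<bar>) ^ n"
    by blast
qed

lemma matrix_exp_sums: "(\<lambda>k. (1 / fact k) *\<^sub>R matpow A k) sums (\<chi> i j. \<Sum>k. matpow A k $ i $ j / fact k)"
  unfolding sums_def
proof (intro vec_tendstoI)
  fix i j
  have "(\<lambda>k. matpow A k $ i $ j / fact k) sums (\<Sum>k. matpow A k $ i $ j / fact k)"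
    using summable_matpow_nth[of A i j 1] by (simp add: summable_sums)
  then show "(\<lambda>n. (\<Sum>k<n. (1 / fact k) *\<^sub>R matpow A k) $ i $ j) \<longlonglongrightarrow> (\<chi> i j. \<Sum>k. matpow A k $ i $ j / fact k) $ i $ j"
    by (simp add: sums_def sum_component)
qed

lemma matrix_exp_nth: "matrix_exp A $ i $ j = (\<Sum>k. matpow A k $ i $ j / fact k)"
  unfolding matrix_exp_def by (simp add: sums_unique[OF matrix_exp_sums, symmetric])

lemma matrix_exp_scaleR_nth:
  "matrix_exp (t *\<^sub>R A) $ i $ j = (\<Sum>k. (matpow A k $ i $ j / fact k) * t ^ k)"
  by (simp add: matrix_exp_nth matpow_scaleR mult_ac)

lemma matrix_exp_zero: "matrix_exp (0::real^'n^'n) = mat 1"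
proof -
  have "matrix_exp (0::real^'n^'n) $ i $ j = mat 1 $ i $ j" for i j
    using matrix_exp_scaleR_nth[of 0 "0::real^'n^'n" i j]
      powser_zero[of "\<lambda>k. matpow (0::real^'n^'n) k $ i $ j / fact k"] by simp
  then show ?thesis by (simp add: vec_eq_iff)
qed

lemma matrix_exp_transpose: "matrix_exp (transpose A) = transpose (matrix_exp A)"
  by (simp add: vec_eq_iff matrix_exp_nth transpose_matpow, simp add: transpose_def matrix_exp_nth)

lemma matrix_exp_commute: "A ** matrix_exp A = matrix_exp A ** A"
proof -
  have s: "(\<lambda>k. (1 / fact k) *\<^sub>R matpow A k) sums matrix_exp A"
    unfolding matrix_exp_def using matrix_exp_sums[of A] by (simp add: sums_iff)
  have 1: "(\<lambda>k. A ** ((1 / fact k) *\<^sub>R matpow A k)) sums (A ** matrix_exp A)"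
    by (rule bounded_linear.sums[OF _ s])
       (rule bounded_bilinear.bounded_linear_right[OF bounded_bilinear_matrix_matrix_mult])
  have 2: "(\<lambda>k. ((1 / fact k) *\<^sub>R matpow A k) ** A) sums (matrix_exp A ** A)"
    by (rule bounded_linear.sums[OF _ s, where f = "\<lambda>x. x ** A"])
       (rule bounded_bilinear.bounded_linear_left[OF bounded_bilinear_matrix_matrix_mult])
  have "A ** ((1 / fact k) *\<^sub>R matpow A k) = ((1 / fact k) *\<^sub>R matpow A k) ** A" for k
    by (simp add: matrix_scalar_ac matpow_commute flip: scalar_matrix_assoc)
  with 1 2 show ?thesis by (simp add: sums_iff)
qed

text \<open>Each entry of \<open>exp(tA)\<close> is a real power series in \<open>t\<close>, differentiated term by term.\<close>

lemma has_vector_derivative_matrix_exp: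
  fixes A :: "real^'n^'n"
  shows "((\<lambda>t. matrix_exp (t *\<^sub>R A)) has_vector_derivative A ** matrix_exp (t *\<^sub>R A)) (at t)"
proof -
  have d: "((\<lambda>t. matrix_exp (t *\<^sub>R A) $ i $ j) has_real_derivative (A ** matrix_exp (t *\<^sub>R A)) $ i $ j) (at t)" for i j
  proof -
    have 1: "((\<lambda>t. \<Sum>k. (matpow A k $ i $ j / fact k) * t ^ k) has_real_derivative
           (\<Sum>k. diffs (\<lambda>k. matpow A k $ i $ j / fact k) k * t ^ k)) (at t)"
      by (rule termdiffs_strong_converges_everywhere) (rule summable_matpow_nth)
    have 2: "diffs (\<lambda>k. matpow A k $ i $ j / fact k) k * t ^ k
        = (\<Sum>l\<in>UNIV. A $ i $ l * (matpow A k $ l $ j / fact k * t ^ k))" for k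
    proof -
      have "diffs (\<lambda>k. matpow A k $ i $ j / fact k) k = (A ** matpow A k) $ i $ j / fact k"
        by (simp add: diffs_def del: of_nat_Suc)
      then show ?thesis
        by (simp add: matrix_matrix_mult_def sum_distrib_left sum_divide_distrib mult_ac)
    qed
    have 3: "(\<Sum>k. \<Sum>l\<in>UNIV. A $ i $ l * (matpow A k $ l $ j / fact k * t ^ k))
        = (\<Sum>l\<in>UNIV. A $ i $ l * matrix_exp (t *\<^sub>R A) $ l $ j)"
      by (subst suminf_sum)
         (simp_all only: matrix_exp_scaleR_nth suminf_mult summable_matpow_nth summable_mult)
    have 4: "(\<lambda>t. matrix_exp (t *\<^sub>R A) $ i $ j) = (\<lambda>t. \<Sum>k. (matpow A k $ i $ j / fact k) * t ^ k)"
      by (rule ext) (rule matrix_exp_scaleR_nth)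
    have 5: "(A ** matrix_exp (t *\<^sub>R A)) $ i $ j = (\<Sum>l\<in>UNIV. A $ i $ l * matrix_exp (t *\<^sub>R A) $ l $ j)"
      by (simp add: matrix_matrix_mult_def)
    show ?thesis unfolding 4 5 3[symmetric] 2[symmetric] by (rule 1)
  qed
  show ?thesis unfolding has_vector_derivative_def
  proof (subst has_derivative_componentwise_within, safe)
    fix b :: "real^'n^'n" assume "b \<in> Basis"
    then obtain i j where b: "b = axis i (axis j 1)" by (auto simp: Basis_vec_def)
    show "((\<lambda>x. matrix_exp (x *\<^sub>R A) \<bullet> b) has_derivative (\<lambda>x. x *\<^sub>R (A ** matrix_exp (t *\<^sub>R A)) \<bullet> b)) (at t)"
      using d[of i j] by (simp add: b inner_axis has_field_derivative_def mult_commute_abs)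
  qed
qed

text \<open>The propagator \<open>E(t) = exp(-tA)\<close> of the linear equation \<open>v' = -Av\<close>.\<close>

definition flow :: "real^'n^'n \<Rightarrow> real \<Rightarrow> real^'n^'n" where
  "flow A t = matrix_exp ((- t) *\<^sub>R A)"

lemma flow_0 [simp]: "flow A 0 = mat 1"
  by (simp add: flow_def matrix_exp_zero)

lemma flow_commute: "A ** flow A t = flow A t ** A"
proof (cases "t = 0")
  case False
  have "(- t) *\<^sub>R (A ** flow A t) = (- t) *\<^sub>R (flow A t ** A)"
    using matrix_exp_commute[of "(- t) *\<^sub>R A"] unfolding flow_def
    by (simp add: matrix_scalar_ac flip: scalar_matrix_assoc del: scaleR_minus_left)
  with False show ?thesis by simp
qed simp

lemma has_vector_derivative_flow:
  "(flow A has_vector_derivative - (A ** flow A t)) (at t within S)"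
proof -
  have "((\<lambda>t. matrix_exp ((- t) *\<^sub>R A)) has_vector_derivative (-1) *\<^sub>R (A ** matrix_exp ((- t) *\<^sub>R A))) (at t)"
    by (rule vector_diff_chain_at[OF _ has_vector_derivative_matrix_exp, unfolded o_def])
       (auto intro!: derivative_eq_intros)
  then show ?thesis unfolding flow_def[abs_def]
    by (auto intro: has_vector_derivative_at_within)
qed

lemma continuous_on_flow [continuous_intros]:
  assumes "continuous_on S f" shows "continuous_on S (\<lambda>x. flow A (f x))"
proof -
  have "continuous_on UNIV (flow A)"
    by (auto simp: continuous_on_eq_continuous_within
        intro!: has_vector_derivative_continuous has_vector_derivative_flow)
  from continuous_on_compose2[OF this assms] show ?thesis by simp
qed

lemma flow_add: "flow A (s + t) = flow A s ** flow A t"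
proof -
  \<comment> \<open>The product \<open>E(x+c) E(-x)\<close> has derivative zero in \<open>x\<close>.\<close>
  have const: "flow A (x + c) ** flow A (- x) = flow A c" for x c :: real
  proof -
    have "((\<lambda>x. flow A (x + c) ** flow A (- x)) has_vector_derivative 0) (at x within UNIV)" for x
    proof -
      have 1: "((\<lambda>x. flow A (x + c)) has_vector_derivative 1 *\<^sub>R (- (A ** flow A (x + c)))) (at x)"
        by (rule vector_diff_chain_at[OF _ has_vector_derivative_flow, unfolded o_def])
           (auto intro!: derivative_eq_intros)
      have 2: "((\<lambda>x. flow A (- x)) has_vector_derivative (-1) *\<^sub>R (- (A ** flow A (- x)))) (at x)"
        by (rule vector_diff_chain_at[OF _ has_vector_derivative_flow, unfolded o_def])
           (auto intro!: derivative_eq_intros)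
      have "(-(A ** flow A y)) = (-1) *\<^sub>R (A ** flow A y)" for y by simp
      then have "flow A (x + c) ** ((-1) *\<^sub>R (- (A ** flow A (- x)))) + (1 *\<^sub>R (- (A ** flow A (x + c)))) ** flow A (- x) = 0"
        by (simp add: matrix_mul_assoc flow_commute[of A "x + c"]
            bounded_bilinear.minus_left[OF bounded_bilinear_matrix_matrix_mult])
      with bounded_bilinear.has_vector_derivative[OF bounded_bilinear_matrix_matrix_mult 1 2]
      show ?thesis by simp
    qed
    from has_vector_derivative_zero_constant[OF convex_UNIV this]
    obtain C where "\<And>x. flow A (x + c) ** flow A (- x) = C" by auto
    from this[of x] this[of 0] show ?thesis by simp
  qed
  have inv: "flow A (- t) ** flow A t = mat 1" using const[of "- t" 0] by simp
  have "flow A s ** flow A t = flow A (s + t) ** (flow A (- t) ** flow A t)"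
    using const[of t s] by (simp add: matrix_mul_assoc add.commute)
  with inv show ?thesis by simp
qed

lemma transpose_flow: "transpose (flow A t) = flow (transpose A) t"
proof -
  have "transpose ((- t) *\<^sub>R A) = (- t) *\<^sub>R transpose A" by (simp add: transpose_def vec_eq_iff)
  then show ?thesis unfolding flow_def matrix_exp_transpose[symmetric] by simp
qed

section \<open>Exponential decay from the spectrum\<close>

lemma norm_vector_scalar_mult: "norm (c *s v) = norm c * norm (v :: 'a::real_normed_field ^ 'n)"
  by (simp add: norm_vec_def norm_mult L2_set_right_distrib)

lemma bounded_bilinear_vector_scalar_mult:
  "bounded_bilinear ((*s) :: complex \<Rightarrow> complex^'n \<Rightarrow> complex^'n)"
  by (subst bilinear_conv_bounded_bilinear[symmetric])
     (auto simp: bilinear_def vec_eq_iff algebra_simps scaleR_conv_of_real[where 'a=complex] intro!: linearI)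

lemma linear_complex_matrix_vector_mult:
  "linear ((*v) (B :: complex^'n^'n))"
  by (auto simp: vec_eq_iff matrix_vector_mult_def sum.distrib algebra_simps scaleR_conv_of_real[where 'a=complex] sum_distrib_left
      intro!: linearI)

text \<open>The iterates \<open>B^k w\<close>.\<close>

abbreviation vecpow :: "complex^'n^'n \<Rightarrow> nat \<Rightarrow> complex^'n \<Rightarrow> complex^'n" where
  "vecpow B k w \<equiv> (((*v) B) ^^ k) w"

text \<open>The vector \<open>q(B) w\<close> for a polynomial \<open>q\<close>.\<close>

definition poly_act :: "complex^'n^'n \<Rightarrow> complex poly \<Rightarrow> complex^'n \<Rightarrow> complex^'n" where
  "poly_act B q w = (\<Sum>k\<le>degree q. coeff q k *s vecpow B k w)"

lemma poly_act_eq: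
  assumes "degree q \<le> N"
  shows "poly_act B q w = (\<Sum>k\<le>N. coeff q k *s vecpow B k w)"
  unfolding poly_act_def using assms
  by (intro sum.mono_neutral_left) (auto simp: coeff_eq_0 not_le)

lemma vecpow_diff: "vecpow B k (v - w) = vecpow B k v - vecpow B k w"
  by (induction k) (simp_all add: matrix_vector_mult_diff_distrib)

lemma vecpow_scale: "vecpow B k (c *s w) = c *s vecpow B k w"
  by (induction k) (simp_all add: vector_scalar_commute)

lemma poly_act_linear_factor:
  "poly_act B ([:-c, 1:] * q) w = poly_act B q (B *v w - c *s w)"
proof -
  let ?N = "Suc (degree q)"
  have "degree ([:-c, 1:] * q) \<le> ?N"
    using degree_mult_le[of "[:-c,1:]" q] by simp
  then have "poly_act B ([:-c, 1:] * q) w = (\<Sum>k\<le>?N. coeff ([:-c, 1:] * q) k *s vecpow B k w)"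
    by (rule poly_act_eq)
  also have "\<dots> = (\<Sum>k\<le>?N. coeff (pCons 0 q) k *s vecpow B k w) - (\<Sum>k\<le>?N. coeff q k *s vecpow B k (c *s w))"
    by (simp add: sum_subtractf[symmetric] vecpow_scale vec_eq_iff algebra_simps del: sum.atMost_Suc)
  also have "(\<Sum>k\<le>?N. coeff q k *s vecpow B k (c *s w)) = poly_act B q (c *s w)"
    by (rule poly_act_eq[symmetric]) simp
  also have "(\<Sum>k\<le>?N. coeff (pCons 0 q) k *s vecpow B k w) = (\<Sum>k\<le>degree q. coeff q k *s vecpow B (Suc k) w)"
    by (subst sum.atMost_Suc_shift) simp
  also have "\<dots> = poly_act B q (B *v w)"
    unfolding poly_act_def by (simp add: funpow_swap1)
  finally show ?thesis
    by (simp add: poly_act_def vecpow_diff vec.scale_right_diff_distrib sum_subtractf)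
qed

text \<open>A solution of \<open>u' = -Bu\<close> that is annihilated by a nonzero polynomial in \<open>B\<close> decays
  exponentially. Split off a root \<open>c\<close> of the polynomial: \<open>w = (B - c)u\<close> solves the same equation and
  is annihilated by a polynomial of smaller degree. If \<open>c\<close> is not an eigenvalue then \<open>B - c\<close> is
  injective and \<open>|u|\<close> is bounded by a multiple of \<open>|w|\<close>; otherwise \<open>Re c > 0\<close> and \<open>u\<close> is recovered by
  integrating \<open>(exp(ct) u)' = -exp(ct) w\<close>.\<close>

lemma exponential_decay_if_annihilated:
  fixes B :: "complex^'n^'n"
  assumes ev: "\<forall>c\<in>eigenvalues B. Re c > 0"
  shows "q \<noteq> 0 \<Longrightarrow> (\<And>t. (u has_vector_derivative - (B *v u t)) (at t)) \<Longrightarrow> (\<And>t. poly_act B q (u t) = 0)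
    \<Longrightarrow> \<exists>K a. a > 0 \<and> K \<ge> 0 \<and> (\<forall>t\<ge>0. norm (u t) \<le> K * exp (- a * t))"
proof (induction "degree q" arbitrary: q u rule: less_induct)
  case less
  note du = less.prems(2)
  show ?case
  proof (cases "degree q = 0")
    case True
    then obtain c where "q = [:c:]" by (rule degree_eq_zeroE)
    with less.prems have "u t = 0" for t
      using less.prems(3)[of t] by (auto simp: poly_act_def vec_eq_iff)
    then show ?thesis by (intro exI[of _ 0] exI[of _ 1]) auto
  next
    case False
    then have "\<not> constant (poly q)" by (simp add: constant_degree)
    from fundamental_theorem_of_algebra[OF this] obtain c where "poly q c = 0" by auto
    then obtain r where q: "q = [:-c, 1:] * r" by (auto simp: poly_eq_0_iff_dvd elim: dvdE)
    with less.prems have r0: "r \<noteq> 0" by auto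
    then have dr: "degree r < degree q" unfolding q by (subst degree_mult_eq) auto
    define h where "h v = B *v v - c *s v" for v
    have lh: "linear h"
      using linear_complex_matrix_vector_mult[of B]
        bounded_linear.linear[OF bounded_bilinear.bounded_linear_right[OF bounded_bilinear_vector_scalar_mult, of c]]
      unfolding h_def[abs_def] by (rule linear_compose_sub)
    then have blh: "bounded_linear h" by (simp add: linear_conv_bounded_linear)
    define w where "w t = h (u t)" for t
    have "(w has_vector_derivative - (B *v w t)) (at t)" for t
    proof -
      have "(w has_vector_derivative h (- (B *v u t))) (at t)"
        unfolding w_def[abs_def] by (rule bounded_linear.has_vector_derivative[OF blh du])
      moreover have "h (- (B *v u t)) = - (B *v w t)"
        by (simp add: w_def h_def matrix_vector_mult_diff_distrib vector_scalar_commute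
            linear_neg[OF linear_complex_matrix_vector_mult])
      ultimately show ?thesis by simp
    qed
    moreover have "poly_act B r (w t) = 0" for t
      using less.prems(3)[of t] unfolding q poly_act_linear_factor w_def h_def .
    ultimately obtain K a where Ka: "a > 0" "K \<ge> 0" "\<And>t. t \<ge> 0 \<Longrightarrow> norm (w t) \<le> K * exp (- a * t)"
      using less.hyps[OF dr r0, of w] by blast
    show ?thesis
    proof (cases "c \<in> eigenvalues B")
      case False
      have "inj h"
      proof (subst linear_injective_0[OF lh], safe)
        fix v assume "h v = 0" then show "v = 0"
          using False by (auto simp: eigenvalues_def h_def)
      qed
      from linear_inj_bounded_below_pos[OF lh this] obtain b where
        b: "b > 0" "\<And>x. b * norm x \<le> norm (h x)" by blast
      have "norm (u t) \<le> K / b * exp (- a * t)" if "t \<ge> 0" for t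
        using b(2)[of "u t"] Ka(3)[OF that] b(1) by (simp add: w_def field_simps)
      then show ?thesis using Ka b by (intro exI[of _ "K/b"] exI[of _ a]) auto
    next
      case True
      with ev have rc: "Re c > 0" by auto
      \<comment> \<open>A decay rate not exceeding that of \<open>w\<close>, and below \<open>Re c\<close>.\<close>
      define b where "b = min a (Re c / 2)"
      have b: "b > 0" "b \<le> a" "b < Re c" using Ka rc by (auto simp: b_def)
      define e where "e = Re c - b"
      have e: "e > 0" using b by (simp add: e_def)
      define g where "g t = exp (c * of_real t) *s u t" for t :: real
      have dg: "(g has_vector_derivative - (exp (c * of_real t) *s w t)) (at t)" for t
      proof -
        have de: "((\<lambda>t. exp (c * of_real t)) has_vector_derivative (c * exp (c * of_real t))) (at t)"
          by (rule has_vector_derivative_real_field)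
             (auto intro!: derivative_eq_intros)
        from bounded_bilinear.has_vector_derivative[OF bounded_bilinear_vector_scalar_mult de du]
        show ?thesis unfolding g_def[abs_def]
          by (rule has_vector_derivative_eq_rhs) (simp add: w_def h_def vec_eq_iff algebra_simps)
      qed
      have ng: "norm (exp (c * of_real t) *s w t) \<le> K * exp (e * t)" if "t \<ge> 0" for t
      proof -
        have "norm (exp (c * of_real t) *s w t) = exp (Re c * t) * norm (w t)"
          by (simp add: norm_vector_scalar_mult)
        also have "\<dots> \<le> exp (Re c * t) * (K * exp (- b * t))"
        proof (intro mult_left_mono order.trans[OF Ka(3)[OF that]])
          show "exp (- a * t) \<le> exp (- b * t)" using b that by (auto intro: mult_right_mono)
        qed (use Ka in auto)
        also have "\<dots> = K * exp (e * t)" by (simp add: e_def algebra_simps flip: exp_add)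
        finally show ?thesis .
      qed
      define \<phi> where "\<phi> t = K / e * exp (e * t)" for t :: real
      have bound: "norm (g t - g 0) \<le> \<phi> t - \<phi> 0" if "t > 0" for t
      proof (rule differentiable_bound_general[OF that, where f' = "\<lambda>t. - (exp (c * of_real t) *s w t)" and \<phi>' = "\<lambda>t. K * exp (e * t)"])
        show "continuous_on {0..t} g"
          by (meson dg has_vector_derivative_continuous continuous_at_imp_continuous_on)
        show "continuous_on {0..t} \<phi>" unfolding \<phi>_def[abs_def] by (intro continuous_intros)
        show "(\<phi> has_vector_derivative K * exp (e * x)) (at x)" for x
          unfolding \<phi>_def[abs_def] using e
          by (auto intro!: derivative_eq_intros simp: has_real_derivative_iff_has_vector_derivative[symmetric])
      qed (use dg ng in auto)
      have "norm (u t) \<le> (norm (u 0) + K / e) * exp (- b * t)" if "t \<ge> 0" for t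
      proof -
        have "norm (g t - g 0) \<le> \<phi> t - \<phi> 0" using bound[of t] that by (cases "t = 0") auto
        moreover have "norm (g t) \<le> norm (g t - g 0) + norm (g 0)" by (metis norm_triangle_sub add.commute)
        moreover have "norm (g 0) = norm (u 0)" by (simp add: g_def)
        moreover have "\<phi> 0 \<ge> 0" using Ka e by (simp add: \<phi>_def)
        ultimately have "norm (g t) \<le> norm (u 0) + K / e * exp (e * t)"
          by (simp add: \<phi>_def)
        also have "\<dots> \<le> (norm (u 0) + K / e) * exp (e * t)"
          using e that mult_left_mono[of 1 "exp (e * t)" "norm (u 0)"] by (simp add: algebra_simps)
        finally have "exp (Re c * t) * norm (u t) \<le> (norm (u 0) + K / e) * exp (e * t)"
          by (simp add: g_def norm_vector_scalar_mult)
        moreover have "exp (e * t) = exp (Re c * t) * exp (- b * t)"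
          by (simp add: e_def algebra_simps flip: exp_add)
        ultimately show ?thesis by simp
      qed
      then show ?thesis using b Ka e by (intro exI[of _ "norm (u 0) + K / e"] exI[of _ b]) auto
    qed
  qed
qed

text \<open>The matrix powers of \<open>A\<close> live in a finite-dimensional space, so finitely many of them are
  linearly dependent.\<close>

lemma exists_annihilating_poly:
  fixes A :: "real^'n^'n"
  obtains p :: "real poly" and N where "p \<noteq> 0" "degree p \<le> N" "(\<Sum>k\<le>N. coeff p k *\<^sub>R matpow A k) = 0"
proof -
  let ?N = "DIM(real^'n^'n)"
  obtain c where c: "\<exists>k\<le>?N. c k \<noteq> (0::real)" "(\<Sum>k\<le>?N. c k *\<^sub>R matpow A k) = 0"
  proof (cases "inj_on (matpow A) {..?N}")
    case True
    have "card (matpow A ` {..?N}) = Suc ?N" by (subst card_image[OF True]) simp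
    then have "dependent (matpow A ` {..?N})"
      by (intro dependent_biggerset) (simp only: lessI)
    then obtain u where u: "\<exists>v\<in>matpow A ` {..?N}. u v \<noteq> 0" "(\<Sum>v\<in>matpow A ` {..?N}. u v *\<^sub>R v) = 0"
      by (auto simp: dependent_finite)
    show ?thesis
    proof (rule that[of "\<lambda>k. u (matpow A k)"])
      show "\<exists>k\<le>?N. u (matpow A k) \<noteq> 0" using u(1) by blast
      show "(\<Sum>k\<le>?N. u (matpow A k) *\<^sub>R matpow A k) = 0"
        using u(2) unfolding sum.reindex[OF True] o_def .
    qed
  next
    case False
    then obtain i j where ij: "i \<le> ?N" "j \<le> ?N" "i \<noteq> j" "matpow A i = matpow A j"
      by (auto simp: inj_on_def)
    let ?c = "\<lambda>k. if k = i then 1 else if k = j then -1 else (0::real)"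
    have "(\<Sum>k\<le>?N. ?c k *\<^sub>R matpow A k) = (\<Sum>k\<in>{i, j}. ?c k *\<^sub>R matpow A k)"
      using ij by (intro sum.mono_neutral_right) auto
    with ij show ?thesis by (intro that[of ?c]) auto
  qed
  define p where "p = (\<Sum>k\<le>?N. monom (c k) k)"
  have cf: "coeff p k = (if k \<le> ?N then c k else 0)" for k
    by (auto simp: p_def coeff_sum)
  show ?thesis
  proof (rule that[of p ?N])
    show "p \<noteq> 0" using c(1) cf by (metis coeff_0)
    show "degree p \<le> ?N" by (rule degree_le) (simp add: cf)
    show "(\<Sum>k\<le>?N. coeff p k *\<^sub>R matpow A k) = 0" using c(2) by (simp add: cf)
  qed
qed

lemma flow_decay:
  fixes A :: "real^'n^'n"
  assumes ev: "\<forall>c\<in>eigenvalues (map_matrix complex_of_real A). Re c > 0"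
  obtains K a where "K \<ge> 1" "a > 0" "\<And>t v. t \<ge> 0 \<Longrightarrow> norm (flow A t *v v) \<le> K * exp (- a * t) * norm v"
proof -
  let ?B = "map_matrix complex_of_real A"
  define cv :: "real^'n \<Rightarrow> complex^'n" where "cv x = (\<chi> i. of_real (x $ i))" for x
  have lcv: "linear cv" by (auto simp: cv_def vec_eq_iff scaleR_conv_of_real[where 'a=complex] intro!: linearI)
  have ncv: "norm (cv x) = norm x" for x by (simp add: norm_vec_def cv_def)
  have Bcv: "?B *v cv x = cv (A *v x)" for x
    by (simp add: cv_def vec_eq_iff matrix_vector_mult_def map_matrix_def)
  have pcv: "vecpow ?B k (cv x) = cv (matpow A k *v x)" for k x
    by (induction k) (simp_all add: Bcv matrix_vector_mul_assoc)
  obtain p N where p: "p \<noteq> 0" "degree p \<le> N" "(\<Sum>k\<le>N. coeff p k *\<^sub>R matpow A k) = 0"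
    by (rule exists_annihilating_poly)
  define q where "q = map_poly complex_of_real p"
  have q0: "q \<noteq> 0" using p(1) by (simp add: q_def map_poly_eq_0_iff)
  have act: "poly_act ?B q (cv x) = 0" for x
  proof -
    have "poly_act ?B q (cv x) = (\<Sum>k\<le>N. coeff q k *s vecpow ?B k (cv x))"
      by (rule poly_act_eq) (use p(2) in \<open>simp add: q_def degree_map_poly\<close>)
    also have "\<dots> = (\<Sum>k\<le>N. cv ((coeff p k *\<^sub>R matpow A k) *v x))"
      unfolding pcv by (intro sum.cong) (simp_all add: q_def coeff_map_poly cv_def vec_eq_iff flip: scaleR_matrix_vector_assoc)
    also have "\<dots> = cv ((\<Sum>k\<le>N. coeff p k *\<^sub>R matpow A k) *v x)"
      by (simp add: linear_sum[OF lcv, symmetric] bounded_bilinear.sum_left[OF bounded_bilinear_matrix_vector_mult])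
    also have "\<dots> = 0" by (simp add: p(3) linear_0[OF lcv])
    finally show ?thesis .
  qed
  have "\<exists>K a. a > 0 \<and> K \<ge> 0 \<and> (\<forall>t\<ge>0. norm (flow A t *v b) \<le> K * exp (- a * t))" for b
  proof -
    have "((\<lambda>t. flow A t *v b) has_vector_derivative - (A ** flow A t) *v b) (at t)" for t
      by (rule bounded_linear.has_vector_derivative[OF bounded_bilinear.bounded_linear_left[OF bounded_bilinear_matrix_vector_mult] has_vector_derivative_flow])
    from bounded_linear.has_vector_derivative[OF lcv[unfolded linear_conv_bounded_linear] this]
    have "((\<lambda>t. cv (flow A t *v b)) has_vector_derivative - (?B *v cv (flow A t *v b))) (at t)" for t
      by (rule has_vector_derivative_eq_rhs)
         (simp add: Bcv linear_neg[OF lcv, symmetric] matrix_vector_mul_assoc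
           bounded_bilinear.minus_left[OF bounded_bilinear_matrix_vector_mult])
    from exponential_decay_if_annihilated[OF ev q0 this act] show ?thesis by (simp add: ncv)
  qed
  then obtain k r where kr: "\<And>b. r b > 0" "\<And>b. k b \<ge> 0"
      "\<And>b t. t \<ge> 0 \<Longrightarrow> norm (flow A t *v b) \<le> k b * exp (- r b * t)"
    by metis
  define a where "a = Min (r ` (Basis :: (real^'n) set))"
  define K where "K = 1 + (\<Sum>b\<in>Basis. k b)"
  have a: "a > 0" unfolding a_def using kr(1) by (subst Min_gr_iff) auto
  show ?thesis
  proof (rule that[of K a])
    show "K \<ge> 1" by (simp add: K_def sum_nonneg kr)
    show "a > 0" by (rule a)
    fix t :: real and v :: "real^'n" assume t: "t \<ge> 0"
    have "flow A t *v v = flow A t *v (\<Sum>b\<in>Basis. (v \<bullet> b) *\<^sub>R b)" by (simp add: euclidean_representation)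
    also have "\<dots> = (\<Sum>b\<in>Basis. (v \<bullet> b) *\<^sub>R (flow A t *v b))"
      by (simp add: bounded_bilinear.sum_right[OF bounded_bilinear_matrix_vector_mult]
          bounded_bilinear.scaleR_right[OF bounded_bilinear_matrix_vector_mult])
    also have "norm \<dots> \<le> (\<Sum>b\<in>Basis. norm v * (k b * exp (- a * t)))"
    proof (rule sum_norm_le)
      fix b :: "real^'n" assume b: "b \<in> Basis"
      have "norm (flow A t *v b) \<le> k b * exp (- r b * t)" by (rule kr(3)[OF t])
      also have "\<dots> \<le> k b * exp (- a * t)"
      proof -
        have "a \<le> r b" unfolding a_def using b by (intro Min_le) auto
        then show ?thesis using t kr(2) by (auto intro!: mult_left_mono mult_right_mono)
      qed
      finally have "norm (flow A t *v b) \<le> k b * exp (- a * t)" .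
      moreover have "\<bar>v \<bullet> b\<bar> \<le> norm v" using b by (rule Basis_le_norm)
      ultimately show "norm ((v \<bullet> b) *\<^sub>R (flow A t *v b)) \<le> norm v * (k b * exp (- a * t))"
        by (auto intro!: mult_mono)
    qed
    also have "\<dots> = (\<Sum>b\<in>Basis. k b) * exp (- a * t) * norm v"
      by (simp add: sum_distrib_left sum_distrib_right mult_ac)
    also have "\<dots> \<le> K * exp (- a * t) * norm v"
      by (intro mult_right_mono) (auto simp: K_def)
    finally show "norm (flow A t *v v) \<le> K * exp (- a * t) * norm v" .
  qed
qed

section \<open>The largest eigenvalue of a symmetric matrix\<close>

lemma inner_transpose_mult: "x \<bullet> (M *v y) = (transpose M *v x) \<bullet> (y :: real^'n)"
  by (simp add: dot_lmul_matrix[symmetric] transpose_matrix_vector)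

lemma norm_matrix_le:
  fixes M :: "real^'n^'m" and c :: real
  assumes "\<And>v. norm (M *v v) \<le> c * norm v"
  shows "norm M \<le> real DIM(real^'n^'m) * c"
proof -
  have "norm M \<le> (\<Sum>b\<in>Basis. \<bar>M \<bullet> b\<bar>)" by (rule norm_le_l1)
  also have "\<dots> \<le> (\<Sum>b\<in>(Basis :: (real^'n^'m) set). (c :: real))"
  proof (rule sum_mono)
    fix b :: "real^'n^'m" assume "b \<in> Basis"
    then obtain i j where b: "b = axis i (axis j 1)" by (auto simp: Basis_vec_def)
    have "\<bar>M \<bullet> b\<bar> = \<bar>(M *v axis j 1) $ i\<bar>"
      by (simp add: b inner_axis matrix_vector_mul_component)
    also have "\<dots> \<le> norm (M *v axis j 1)" by (rule component_le_norm_cart)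
    also have "\<dots> \<le> c" using assms[of "axis j 1"] by simp
    finally show "\<bar>M \<bullet> b\<bar> \<le> c" .
  qed
  finally show ?thesis by simp
qed

text \<open>The maximum of the quadratic form of a symmetric matrix on the unit sphere is its largest
  eigenvalue. A maximiser \<open>\<theta>\<close> is an eigenvector because the nonnegative form \<open>\<mu>|x|^2 - x \<bullet> Sx\<close>
  vanishes at \<open>\<theta>\<close>, so its first variation vanishes there. The set of eigenvalues is finite, so that
  \<open>Max\<close> is meaningful, because eigenvectors for distinct eigenvalues are orthogonal.\<close>

lemma symmetric_rayleigh:
  fixes S :: "real^'n^'n"
  assumes sym: "transpose S = S"
  obtains \<theta> where "norm \<theta> = 1" "\<theta> \<bullet> (S *v \<theta>) = Max (eigenvalues S)"
    "\<And>x. x \<bullet> (S *v x) \<le> Max (eigenvalues S) * (norm x)\<^sup>2"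
proof -
  define q where "q x = x \<bullet> (S *v x)" for x
  have swap: "x \<bullet> (S *v y) = y \<bullet> (S *v x)" for x y
    using inner_transpose_mult[of x S y] by (simp add: sym inner_commute)
  have "continuous_on (sphere 0 1) q"
    unfolding q_def by (intro continuous_intros linear_continuous_on matrix_vector_mul_bounded_linear)
  moreover have "sphere (0::real^'n) 1 \<noteq> {}"
    using sphere_eq_empty[of "0::real^'n" 1] by auto
  ultimately obtain \<theta> where th: "\<theta> \<in> sphere 0 1" "\<And>x. x \<in> sphere 0 1 \<Longrightarrow> q x \<le> q \<theta>"
    using continuous_attains_sup[of "sphere 0 1" q] by auto
  define \<mu> where "\<mu> = q \<theta>"
  have n1: "norm \<theta> = 1" using th by simp
  have qs: "q (c *\<^sub>R x) = c\<^sup>2 * q x" for c x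
    by (simp add: q_def power2_eq_square matrix_vector_mult_scaleR)
  have le: "q x \<le> \<mu> * (norm x)\<^sup>2" for x
  proof (cases "x = 0")
    case False
    then have "q (inverse (norm x) *\<^sub>R x) \<le> \<mu>" unfolding \<mu>_def by (intro th) simp
    with False show ?thesis by (simp add: qs field_simps)
  qed (simp add: q_def)
  \<comment> \<open>Compare \<open>\<theta>\<close> with \<open>\<theta> - t r\<close> for the residual \<open>r = \<mu>\<theta> - S\<theta>\<close>; the choice
    \<open>t = |r|^2 / (b + 1)\<close> forces \<open>r = 0\<close>.\<close>
  have eig: "S *v \<theta> = \<mu> *\<^sub>R \<theta>"
  proof -
    define r where "r = \<mu> *\<^sub>R \<theta> - S *v \<theta>"
    define b where "b = \<mu> * (norm r)\<^sup>2 - q r"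
    have b0: "b \<ge> 0" using le[of r] by (simp add: b_def)
    have "0 \<le> t\<^sup>2 * b - 2 * t * (norm r)\<^sup>2" for t
    proof -
      have "q (\<theta> - t *\<^sub>R r) = q \<theta> - 2 * t * (r \<bullet> (S *v \<theta>)) + t\<^sup>2 * q r"
        by (simp add: q_def matrix_vector_mult_diff_distrib matrix_vector_mult_scaleR inner_diff_left inner_diff_right
            swap[of \<theta> r] power2_eq_square algebra_simps)
      moreover have "(norm (\<theta> - t *\<^sub>R r))\<^sup>2 = 1 - 2 * t * (r \<bullet> \<theta>) + t\<^sup>2 * (norm r)\<^sup>2"
        using n1 unfolding power2_norm_eq_inner norm_eq_1
        by (simp add: inner_diff_left inner_diff_right inner_commute power2_eq_square)
      moreover have N: "(norm r)\<^sup>2 = \<mu> * (r \<bullet> \<theta>) - r \<bullet> (S *v \<theta>)"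
        unfolding power2_norm_eq_inner by (subst (2) r_def) (simp add: inner_diff_right)
      ultimately have "0 \<le> \<mu> * (1 - 2 * t * (r \<bullet> \<theta>) + t\<^sup>2 * (norm r)\<^sup>2)
          - (\<mu> - 2 * t * (r \<bullet> (S *v \<theta>)) + t\<^sup>2 * q r)"
        using le[of "\<theta> - t *\<^sub>R r"] unfolding \<mu>_def by simp
      also have "\<dots> = t\<^sup>2 * b - 2 * t * (\<mu> * (r \<bullet> \<theta>) - r \<bullet> (S *v \<theta>))"
        by (simp add: b_def algebra_simps)
      finally show ?thesis unfolding N[symmetric] .
    qed
    from this[of "(norm r)\<^sup>2 / (b + 1)"] have "2 * ((norm r)\<^sup>2)\<^sup>2 / (b + 1) \<le> ((norm r)\<^sup>2)\<^sup>2 * b / (b + 1)\<^sup>2"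
      by (simp add: power2_eq_square mult_ac)
    also have "\<dots> \<le> ((norm r)\<^sup>2)\<^sup>2 / (b + 1)"
      using b0 by (simp add: divide_simps power2_eq_square mult_left_mono)
    finally have "((norm r)\<^sup>2)\<^sup>2 / (b + 1) \<le> 0" using b0 by simp
    with b0 have "r = 0" by (simp add: divide_le_0_iff)
    then show ?thesis by (simp add: r_def)
  qed
  have in_ev: "\<mu> \<in> eigenvalues S"
    using n1 eig by (auto simp: eigenvalues_def scalar_mult_eq_scaleR intro!: exI[of _ \<theta>])
  have max_ev: "c \<le> \<mu>" if "c \<in> eigenvalues S" for c
  proof -
    from that obtain v where v: "v \<noteq> 0" "S *v v = c *\<^sub>R v" by (auto simp: eigenvalues_def scalar_mult_eq_scaleR)
    then have "q v = c * (norm v)\<^sup>2" by (simp add: q_def power2_norm_eq_inner)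
    with le[of v] v show ?thesis by simp
  qed
  have fin: "finite (eigenvalues S)"
  proof -
    have "\<forall>c\<in>eigenvalues S. \<exists>v. v \<noteq> 0 \<and> S *v v = c *\<^sub>R v"
      by (simp add: eigenvalues_def scalar_mult_eq_scaleR)
    then obtain f where f: "\<And>c. c \<in> eigenvalues S \<Longrightarrow> f c \<noteq> 0 \<and> S *v f c = c *\<^sub>R f c"
      by metis
    have orth: "f c \<bullet> f d = 0" if "c \<in> eigenvalues S" "d \<in> eigenvalues S" "c \<noteq> d" for c d
      using swap[of "f c" "f d"] f[OF that(1)] f[OF that(2)] that(3) by (simp add: inner_commute)
    have inj: "inj_on f (eigenvalues S)"
      using orth f by (intro inj_onI) (metis inner_eq_zero_iff)
    have "independent (f ` eigenvalues S)"
      by (rule pairwise_orthogonal_independent)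
         (use orth f inj in \<open>auto simp: pairwise_def orthogonal_def\<close>)
    then have "finite (f ` eigenvalues S)" by (rule independent_imp_finite)
    with inj show ?thesis by (simp add: finite_image_iff)
  qed
  have "Max (eigenvalues S) = \<mu>" by (rule Max_eqI[OF fin max_ev in_ev])
  with n1 le show ?thesis by (intro that[of \<theta>]) (auto simp: q_def \<mu>_def)
qed

section \<open>The stationary covariance and its Riemann sums\<close>

text \<open>A drift matrix whose propagator contracts exponentially.\<close>

locale exponentially_stable =
  fixes A :: "real^'n^'n" and K a :: real
  assumes K: "K \<ge> 1" and a: "a > 0"
    and decay: "\<And>t v. 0 \<le> t \<Longrightarrow> norm (flow A t *v v) \<le> K * exp (- a * t) * norm v"
begin

lemma decay_transpose:
  assumes "0 \<le> t"
  shows "norm (flow (transpose A) t *v v) \<le> K * exp (- a * t) * norm v"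
proof -
  let ?w = "flow (transpose A) t *v v"
  have tr: "transpose (flow A t) = flow (transpose A) t" by (simp add: transpose_flow)
  have "(norm ?w)\<^sup>2 = v \<bullet> (flow A t *v ?w)"
    by (simp add: inner_transpose_mult tr power2_norm_eq_inner)
  also have "\<dots> \<le> norm v * norm (flow A t *v ?w)" by (rule norm_cauchy_schwarz)
  also have "\<dots> \<le> norm v * (K * exp (- a * t) * norm ?w)"
    by (intro mult_left_mono decay assms) auto
  finally have "norm ?w * norm ?w \<le> (K * exp (- a * t) * norm v) * norm ?w"
    by (simp add: power2_eq_square mult_ac)
  then show ?thesis using K by (cases "norm ?w = 0") (auto simp: mult_le_cancel_right)
qed

text \<open>The vector \<open>D^T E(s)^T \<theta>\<close>: the coefficient with which a noise increment of age \<open>s\<close> enters the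
  component of the solution in direction \<open>\<theta>\<close>.\<close>

definition response :: "real^'n^'n \<Rightarrow> real^'n \<Rightarrow> real \<Rightarrow> real^'n" where
  "response D \<theta> s = transpose D *v (transpose (flow A s) *v \<theta>)"

lemma response_eq: "response D \<theta> s = transpose D *v (flow (transpose A) s *v \<theta>)"
  by (simp add: response_def transpose_flow)

lemma norm_response_le:
  assumes "0 \<le> s"
  shows "norm (response D \<theta> s) \<le> onorm ((*v) (transpose D)) * K * norm \<theta> * exp (- a * s)"
proof -
  have "norm (response D \<theta> s) \<le> onorm ((*v) (transpose D)) * norm (flow (transpose A) s *v \<theta>)"
    unfolding response_eq by (intro onorm matrix_vector_mul_bounded_linear)
  also have "\<dots> \<le> onorm ((*v) (transpose D)) * (K * exp (- a * s) * norm \<theta>)"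
    by (intro mult_left_mono decay_transpose assms onorm_pos_le matrix_vector_mul_bounded_linear)
  finally show ?thesis by (simp add: mult_ac)
qed

lemma continuous_on_response: "continuous_on S (response D \<theta>)"
  unfolding response_eq[abs_def]
  by (intro linear_continuous_on_compose[OF _ matrix_vector_mul_linear]
      bounded_bilinear.continuous_on[OF bounded_bilinear_matrix_vector_mult] continuous_intros)

lemma norm_response_square_diff_le:
  "\<exists>C\<ge>0. \<forall>\<theta> x y. 0 \<le> x \<longrightarrow> x \<le> y \<longrightarrow>
     \<bar>(norm (response D \<theta> y))\<^sup>2 - (norm (response D \<theta> x))\<^sup>2\<bar> \<le> C * (y - x) * exp (- 2 * a * x) * (norm \<theta>)\<^sup>2"
proof -
  define b where "b = onorm ((*v) (transpose D)) * K"
  define c where "c = onorm ((*v) (transpose D)) * (onorm ((*v) (transpose A)) * K)"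
  have on: "onorm ((*v) M) \<ge> 0" for M :: "real^'n^'n" by (intro onorm_pos_le matrix_vector_mul_bounded_linear)
  have pos: "b \<ge> 0" "c \<ge> 0" using K by (auto simp: b_def c_def on)
  have "\<bar>(norm (response D \<theta> y))\<^sup>2 - (norm (response D \<theta> x))\<^sup>2\<bar> \<le> 2 * b * c * (y - x) * exp (- 2 * a * x) * (norm \<theta>)\<^sup>2"
    if xy: "0 \<le> x" "x \<le> y" for \<theta> x y
  proof -
    define g' where "g' s = transpose D *v (- (transpose A ** flow (transpose A) s) *v \<theta>)" for s
    have dg: "(response D \<theta> has_vector_derivative g' s) (at s within T)" for s T
      unfolding response_eq[abs_def] g'_def
      by (intro bounded_linear.has_vector_derivative[OF matrix_vector_mul_bounded_linear]
          bounded_linear.has_vector_derivative[OF bounded_bilinear.bounded_linear_left[OF bounded_bilinear_matrix_vector_mult]]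
          has_vector_derivative_flow)
    have ng': "norm (g' s) \<le> c * norm \<theta> * exp (- a * x)" if "x \<le> s" for s
    proof -
      have "norm (g' s) = norm (transpose D *v (transpose A *v (flow (transpose A) s *v \<theta>)))"
        by (simp add: g'_def matrix_vector_mul_assoc bounded_bilinear.minus_left[OF bounded_bilinear_matrix_vector_mult]
            bounded_bilinear.minus_right[OF bounded_bilinear_matrix_vector_mult])
      also have "\<dots> \<le> onorm ((*v) (transpose D)) * norm (transpose A *v (flow (transpose A) s *v \<theta>))"
        by (intro onorm matrix_vector_mul_bounded_linear)
      also have "\<dots> \<le> onorm ((*v) (transpose D)) * (onorm ((*v) (transpose A)) * norm (flow (transpose A) s *v \<theta>))"
        by (intro mult_left_mono onorm matrix_vector_mul_bounded_linear on)
      also have "\<dots> \<le> onorm ((*v) (transpose D)) * (onorm ((*v) (transpose A)) * (K * exp (- a * s) * norm \<theta>))"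
        using that xy by (intro mult_left_mono decay_transpose on) auto
      also have "\<dots> = c * norm \<theta> * exp (- a * s)" by (simp add: c_def mult_ac)
      also have "\<dots> \<le> c * norm \<theta> * exp (- a * x)"
        using that a pos by (intro mult_left_mono) auto
      finally show ?thesis .
    qed
    have nd: "norm (response D \<theta> y - response D \<theta> x) \<le> c * norm \<theta> * exp (- a * x) * norm (y - x)"
    proof (rule differentiable_bound[OF _ dg[unfolded has_vector_derivative_def], of "{x..y}"])
      show "onorm (\<lambda>h. h *\<^sub>R g' s) \<le> c * norm \<theta> * exp (- a * x)" if "s \<in> {x..y}" for s
        using ng'[of s] that by (intro onorm_le) (simp add: mult.commute mult_left_mono)
    qed (use xy in auto)
    have nr: "norm (response D \<theta> s) \<le> b * norm \<theta> * exp (- a * x)" if "x \<le> s" for s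
    proof -
      have "norm (response D \<theta> s) \<le> b * norm \<theta> * exp (- a * s)"
        using norm_response_le[of s D \<theta>] that xy by (simp add: b_def)
      also have "\<dots> \<le> b * norm \<theta> * exp (- a * x)"
        using that a pos by (intro mult_left_mono) auto
      finally show ?thesis .
    qed
    have "(norm (response D \<theta> y))\<^sup>2 - (norm (response D \<theta> x))\<^sup>2
        = (norm (response D \<theta> y) + norm (response D \<theta> x)) * (norm (response D \<theta> y) - norm (response D \<theta> x))"
      by (simp add: power2_eq_square algebra_simps)
    also have "\<bar>\<dots>\<bar> \<le> (b * norm \<theta> * exp (- a * x) + b * norm \<theta> * exp (- a * x)) * (c * norm \<theta> * exp (- a * x) * norm (y - x))"
      unfolding abs_mult
    proof (intro mult_mono)
      show "\<bar>norm (response D \<theta> y) - norm (response D \<theta> x)\<bar> \<le> c * norm \<theta> * exp (- a * x) * norm (y - x)"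
        by (rule order.trans[OF norm_triangle_ineq3 nd])
      show "\<bar>norm (response D \<theta> y) + norm (response D \<theta> x)\<bar> \<le> b * norm \<theta> * exp (- a * x) + b * norm \<theta> * exp (- a * x)"
        using nr[of y] nr[of x] xy by simp
    qed (use pos in auto)
    also have "\<dots> = 2 * b * c * (y - x) * (exp (- a * x) * exp (- a * x)) * (norm \<theta>)\<^sup>2"
      using xy by (simp add: power2_eq_square algebra_simps)
    also have "exp (- a * x) * exp (- a * x) = exp (- 2 * a * x)" by (simp flip: exp_add)
    finally show ?thesis .
  qed
  then show ?thesis using pos by (intro exI[of _ "2 * b * c"]) auto
qed

text \<open>A geometric sum, bounded by \<open>1/(r\<delta>)\<close> up to the factor \<open>1 + r\<delta>\<close>; after multiplication by
  \<open>\<delta>\<close> this stays bounded as \<open>\<delta>\<close> tends to zero.\<close>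

lemma sum_exp_le:
  assumes "0 < \<delta>" "0 < r"
  shows "(\<Sum>j<(k::nat). exp (- r * (real j * \<delta>))) \<le> (1 + r * \<delta>) / (r * \<delta>)"
proof -
  let ?x = "exp (- r * \<delta>)"
  have p: "r * \<delta> > 0" using assms by simp
  have x: "?x \<le> 1 / (1 + r * \<delta>)"
    using exp_ge_add_one_self[of "r * \<delta>"] p by (simp add: exp_minus field_simps)
  have lt: "?x < 1" using p by simp
  have "(\<Sum>j<k. exp (- r * (real j * \<delta>))) = (\<Sum>j<k. ?x ^ j)"
    by (intro sum.cong) (auto simp: mult_ac simp flip: exp_of_nat_mult)
  also have "\<dots> = (1 - ?x ^ k) / (1 - ?x)" using lt assms by (simp add: sum_gp_strict)
  also have "\<dots> \<le> 1 / (1 - ?x)" using lt by (intro divide_right_mono) auto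
  also have "\<dots> \<le> 1 / (1 - 1 / (1 + r * \<delta>))"
    using x p lt by (intro divide_left_mono mult_pos_pos) (auto simp: field_simps)
  also have "\<dots> = (1 + r * \<delta>) / (r * \<delta>)" using p by (simp add: field_simps)
  finally show ?thesis .
qed

lemma integrable_response_square: "(\<lambda>s. (norm (response D \<theta> s))\<^sup>2) integrable_on {x..y}"
  by (intro integrable_continuous_real continuous_intros continuous_on_response)

text \<open>The Riemann sums approximate the integral of the squared response with an error of order \<open>\<delta>\<close>,
  uniformly in the length of the time interval.\<close>

lemma riemann_response:
  "\<exists>C\<ge>0. \<forall>\<delta> \<theta> (k::nat). 0 < \<delta> \<longrightarrow> \<delta> \<le> 1 \<longrightarrow>
     \<bar>\<delta> * (\<Sum>j<k. (norm (response D \<theta> (real j * \<delta>)))\<^sup>2) - integral {0..real k * \<delta>} (\<lambda>s. (norm (response D \<theta> s))\<^sup>2)\<bar>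
       \<le> C * \<delta> * (norm \<theta>)\<^sup>2"
proof -
  from norm_response_square_diff_le[of D] obtain C where C: "C \<ge> 0"
    "\<And>\<theta> x y. 0 \<le> x \<Longrightarrow> x \<le> y \<Longrightarrow>
     \<bar>(norm (response D \<theta> y))\<^sup>2 - (norm (response D \<theta> x))\<^sup>2\<bar> \<le> C * (y - x) * exp (- 2 * a * x) * (norm \<theta>)\<^sup>2"
    by blast
  have "\<bar>\<delta> * (\<Sum>j<k. (norm (response D \<theta> (real j * \<delta>)))\<^sup>2) - integral {0..real k * \<delta>} (\<lambda>s. (norm (response D \<theta> s))\<^sup>2)\<bar>
       \<le> C * (1 + 2 * a) / (2 * a) * \<delta> * (norm \<theta>)\<^sup>2" if d: "0 < \<delta>" "\<delta> \<le> 1" for \<delta> \<theta> and k :: nat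
  proof -
    let ?f = "\<lambda>s. (norm (response D \<theta> s))\<^sup>2"
    have "\<bar>\<delta> * (\<Sum>j<k. ?f (real j * \<delta>)) - integral {0..real k * \<delta>} ?f\<bar>
      \<le> (\<Sum>j<k. C * \<delta> * exp (- (2 * a) * (real j * \<delta>)) * (norm \<theta>)\<^sup>2 * \<delta>)"
    proof (induction k)
      case (Suc k)
      let ?x = "real k * \<delta>" and ?y = "real (Suc k) * \<delta>"
      have xy: "0 \<le> ?x" "?x \<le> ?y" "?y - ?x = \<delta>" using d by (auto simp: algebra_simps)
      have split: "integral {0..?y} ?f = integral {0..?x} ?f + integral {?x..?y} ?f"
        using Henstock_Kurzweil_Integration.integral_combine[OF xy(1,2) integrable_response_square[of D \<theta>]] by simp
      have hi: "((\<lambda>s. ?f s - ?f ?x) has_integral (integral {?x..?y} ?f - \<delta> * ?f ?x)) {?x..?y}"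
        using has_integral_diff[OF integrable_integral[OF integrable_response_square] has_integral_const_real[of "?f ?x" ?x ?y]]
        using xy by simp
      have "norm (integral {?x..?y} ?f - \<delta> * ?f ?x) \<le> (C * \<delta> * exp (- (2 * a) * ?x) * (norm \<theta>)\<^sup>2) * measure lborel (cbox ?x ?y)"
      proof (rule has_integral_bound)
        show "0 \<le> C * \<delta> * exp (- (2 * a) * ?x) * (norm \<theta>)\<^sup>2" using C d by simp
        show "((\<lambda>s. ?f s - ?f ?x) has_integral (integral {?x..?y} ?f - \<delta> * ?f ?x)) (cbox ?x ?y)" using hi by simp
        fix s assume s: "s \<in> cbox ?x ?y"
        have "norm (?f s - ?f ?x) \<le> C * (s - ?x) * exp (- 2 * a * ?x) * (norm \<theta>)\<^sup>2"
          using C(2)[of ?x s \<theta>] s xy by simp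
        also have "\<dots> \<le> C * \<delta> * exp (- (2 * a) * ?x) * (norm \<theta>)\<^sup>2"
        proof -
          have "s - ?x \<le> \<delta>" using s xy by auto
          then have "C * (s - ?x) \<le> C * \<delta>" using C by (intro mult_left_mono)
          then have "C * (s - ?x) * exp (- 2 * a * ?x) \<le> C * \<delta> * exp (- 2 * a * ?x)" by (intro mult_right_mono) auto
          then show ?thesis by (intro mult_right_mono) auto
        qed
        finally show "norm (?f s - ?f ?x) \<le> C * \<delta> * exp (- (2 * a) * ?x) * (norm \<theta>)\<^sup>2" .
      qed
      then have "\<bar>integral {?x..?y} ?f - \<delta> * ?f ?x\<bar> \<le> C * \<delta> * exp (- (2 * a) * ?x) * (norm \<theta>)\<^sup>2 * \<delta>"
        using xy by simp
      with Suc.IH show ?case unfolding split by (simp add: algebra_simps del: of_nat_Suc)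
    qed simp
    also have "\<dots> = C * \<delta> * (norm \<theta>)\<^sup>2 * \<delta> * (\<Sum>j<k. exp (- (2 * a) * (real j * \<delta>)))"
      by (simp add: sum_distrib_left mult_ac)
    also have "\<dots> \<le> C * \<delta> * (norm \<theta>)\<^sup>2 * \<delta> * ((1 + 2 * a * \<delta>) / (2 * a * \<delta>))"
      using sum_exp_le[OF d(1), of "2 * a" k] C d a by (intro mult_left_mono) auto
    also have "\<dots> = C * \<delta> * (norm \<theta>)\<^sup>2 * (1 + 2 * a * \<delta>) / (2 * a)" using d a by simp
    also have "\<dots> \<le> C * \<delta> * (norm \<theta>)\<^sup>2 * (1 + 2 * a) / (2 * a)"
      using C d a by (intro divide_right_mono mult_left_mono) auto
    finally show ?thesis by (simp add: mult_ac)
  qed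
  then show ?thesis using C a by (intro exI[of _ "C * (1 + 2 * a) / (2 * a)"]) auto
qed

lemma stationary_covariance_form:
  defines "\<Sigma> \<equiv> \<lambda>D. stationary_covariance A D"
  shows "(\<lambda>s. (norm (response D \<theta> s))\<^sup>2) integrable_on {0..}"
    and "\<theta> \<bullet> (\<Sigma> D *v \<theta>) = integral {0..} (\<lambda>s. (norm (response D \<theta> s))\<^sup>2)"
    and "transpose (\<Sigma> D) = \<Sigma> D"
proof -
  define m where "m s = flow A s ** (D ** transpose D) ** flow (transpose A) s" for s
  have Sm: "\<Sigma> D = integral {0..} m"
    by (simp add: \<Sigma>_def stationary_covariance_def m_def[abs_def] flow_def transpose_flow)
  have cm: "continuous_on S m" for S
    unfolding m_def by (intro bounded_bilinear.continuous_on[OF bounded_bilinear_matrix_matrix_mult] continuous_intros)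
  define c where "c = DIM(real^'n^'n) * (K * (onorm ((*v) (D ** transpose D)) * K))"
  have on: "onorm ((*v) M) \<ge> 0" for M :: "real^'n^'n" by (intro onorm_pos_le matrix_vector_mul_bounded_linear)
  have nm: "norm (m s) \<le> c * exp (- (2 * a) * s)" if s: "0 \<le> s" for s
  proof -
    have "norm (m s *v v) \<le> (K * (onorm ((*v) (D ** transpose D)) * K)) * exp (- (2 * a) * s) * norm v" for v
    proof -
      have "norm (m s *v v) = norm (flow A s *v ((D ** transpose D) *v (flow (transpose A) s *v v)))"
        by (simp add: m_def matrix_vector_mul_assoc matrix_mul_assoc)
      also have "\<dots> \<le> K * exp (- a * s) * norm ((D ** transpose D) *v (flow (transpose A) s *v v))"
        by (rule decay[OF s])
      also have "\<dots> \<le> K * exp (- a * s) * (onorm ((*v) (D ** transpose D)) * norm (flow (transpose A) s *v v))"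
        using K by (intro mult_left_mono onorm matrix_vector_mul_bounded_linear) auto
      also have "\<dots> \<le> K * exp (- a * s) * (onorm ((*v) (D ** transpose D)) * (K * exp (- a * s) * norm v))"
        using K by (intro mult_left_mono decay_transpose s on) auto
      also have "\<dots> = K * (onorm ((*v) (D ** transpose D)) * K) * (exp (- a * s) * exp (- a * s)) * norm v"
        by (simp add: mult_ac)
      also have "exp (- a * s) * exp (- a * s) = exp (- (2 * a) * s)" by (simp flip: exp_add)
      finally show ?thesis .
    qed
    from norm_matrix_le[OF this] show ?thesis by (simp add: c_def mult_ac)
  qed
  have im: "m integrable_on {0..}"
  proof (rule measurable_bounded_by_integrable_imp_integrable)
    show "m \<in> borel_measurable (lebesgue_on {0..})"
      by (rule continuous_imp_measurable_on_sets_lebesgue[OF cm]) simp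
    show "(\<lambda>s. c * exp (- (2 * a) * s)) integrable_on {0..}"
      using integrable_on_exp_minus_to_infinity[of "2 * a" 0] a
      by (intro integrable_on_mult_right) simp
    show "norm (m s) \<le> c * exp (- (2 * a) * s)" if "s \<in> {0..}" for s using nm that by simp
  qed simp
  have form: "\<theta> \<bullet> (m s *v \<theta>) = (norm (response D \<theta> s))\<^sup>2" for s
  proof -
    have "\<theta> \<bullet> (m s *v \<theta>) = \<theta> \<bullet> (flow A s *v (D *v response D \<theta> s))"
      by (simp add: m_def response_eq matrix_vector_mul_assoc matrix_mul_assoc)
    also have "\<dots> = response D \<theta> s \<bullet> response D \<theta> s"
      by (simp add: inner_transpose_mult response_def)
    finally show ?thesis by (simp add: power2_norm_eq_inner)
  qed
  have bl: "bounded_linear (\<lambda>M::real^'n^'n. \<theta> \<bullet> (M *v \<theta>))"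
    by (intro bounded_linear_inner_right_comp bounded_bilinear.bounded_linear_left[OF bounded_bilinear_matrix_vector_mult])
  from integrable_linear[OF im bl] show "(\<lambda>s. (norm (response D \<theta> s))\<^sup>2) integrable_on {0..}"
    by (simp add: o_def form)
  from integral_linear[OF im bl] show "\<theta> \<bullet> (\<Sigma> D *v \<theta>) = integral {0..} (\<lambda>s. (norm (response D \<theta> s))\<^sup>2)"
    by (simp add: o_def form Sm)
  have "bounded_linear (transpose :: real^'n^'n \<Rightarrow> _)"
    unfolding linear_conv_bounded_linear[symmetric]
    by (auto simp: transpose_def vec_eq_iff intro!: linearI)
  from integral_linear[OF im this] have "transpose (\<Sigma> D) = integral {0..} (\<lambda>s. transpose (m s))"
    by (simp add: o_def Sm)
  moreover have "transpose (m s) = m s" for s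
    by (simp add: m_def matrix_transpose_mul matrix_mul_assoc transpose_flow)
  ultimately show "transpose (\<Sigma> D) = \<Sigma> D" by (simp add: Sm)
qed

lemma discrete_variance_upper:
  fixes D :: "real^'n^'n"
  defines "\<mu> \<equiv> Max (eigenvalues (stationary_covariance A D))"
  obtains C where "C \<ge> 0" "\<And>\<delta> \<theta> k. 0 < \<delta> \<Longrightarrow> \<delta> \<le> 1 \<Longrightarrow>
    \<delta> * (\<Sum>j<(k::nat). (norm (response D \<theta> (real j * \<delta>)))\<^sup>2) \<le> (\<mu> + C * \<delta>) * (norm \<theta>)\<^sup>2"
proof -
  from riemann_response[of D] obtain C where C: "C \<ge> 0"
    "\<And>\<delta> \<theta> (k::nat). 0 < \<delta> \<Longrightarrow> \<delta> \<le> 1 \<Longrightarrow>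
     \<bar>\<delta> * (\<Sum>j<k. (norm (response D \<theta> (real j * \<delta>)))\<^sup>2) - integral {0..real k * \<delta>} (\<lambda>s. (norm (response D \<theta> s))\<^sup>2)\<bar>
       \<le> C * \<delta> * (norm \<theta>)\<^sup>2" by blast
  have x: "x \<bullet> (stationary_covariance A D *v x) \<le> \<mu> * (norm x)\<^sup>2" for x
    unfolding \<mu>_def using symmetric_rayleigh[OF stationary_covariance_form(3)] by metis
  show ?thesis
  proof (rule that[OF C(1)])
    fix \<delta> :: real and \<theta> :: "real^'n" and k :: nat assume d: "0 < \<delta>" "\<delta> \<le> 1"
    let ?f = "\<lambda>s. (norm (response D \<theta> s))\<^sup>2"
    have "integral {0..real k * \<delta>} ?f \<le> integral {0..} ?f"
      by (intro integral_subset_le integrable_response_square stationary_covariance_form) auto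
    also have "\<dots> \<le> \<mu> * (norm \<theta>)\<^sup>2" using x[of \<theta>] by (simp add: stationary_covariance_form)
    finally show "\<delta> * (\<Sum>j<k. ?f (real j * \<delta>)) \<le> (\<mu> + C * \<delta>) * (norm \<theta>)\<^sup>2"
      using C(2)[OF d, of \<theta> k] by (simp add: algebra_simps)
  qed
qed

lemma discrete_variance_lower:
  fixes D :: "real^'n^'n"
  defines "\<mu> \<equiv> Max (eigenvalues (stationary_covariance A D))"
  obtains \<theta> C where "norm \<theta> = 1" "C \<ge> 0" "\<mu> \<ge> 0"
    "\<And>\<delta> \<epsilon>. 0 < \<delta> \<Longrightarrow> \<delta> \<le> 1 \<Longrightarrow> 0 < \<epsilon> \<Longrightarrow>
      \<exists>L0. \<forall>k\<ge>L0. \<mu> - C * \<delta> - \<epsilon> \<le> \<delta> * (\<Sum>j<(k::nat). (norm (response D \<theta> (real j * \<delta>)))\<^sup>2)"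
proof -
  from riemann_response[of D] obtain C where C: "C \<ge> 0"
    "\<And>\<delta> \<theta> (k::nat). 0 < \<delta> \<Longrightarrow> \<delta> \<le> 1 \<Longrightarrow>
     \<bar>\<delta> * (\<Sum>j<k. (norm (response D \<theta> (real j * \<delta>)))\<^sup>2) - integral {0..real k * \<delta>} (\<lambda>s. (norm (response D \<theta> s))\<^sup>2)\<bar>
       \<le> C * \<delta> * (norm \<theta>)\<^sup>2" by blast
  obtain \<theta> where th: "norm \<theta> = 1" "\<theta> \<bullet> (stationary_covariance A D *v \<theta>) = \<mu>"
    unfolding \<mu>_def using symmetric_rayleigh[OF stationary_covariance_form(3)] by metis
  let ?f = "\<lambda>s. (norm (response D \<theta> s))\<^sup>2"
  have int: "integral {0..} ?f = \<mu>" using th stationary_covariance_form(2)[of \<theta> D] by simp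
  have l0: "\<mu> \<ge> 0" unfolding int[symmetric] by (intro integral_nonneg stationary_covariance_form) auto
  define b where "b = (onorm ((*v) (transpose D)) * K)\<^sup>2"
  have fb: "?f s \<le> b * exp (- (2 * a) * s)" if "0 \<le> s" for s
  proof -
    have "?f s \<le> (onorm ((*v) (transpose D)) * K * exp (- a * s))\<^sup>2"
      using norm_response_le[OF that, of D \<theta>] th by (intro power_mono) auto
    also have "\<dots> = b * (exp (- a * s) * exp (- a * s))" by (simp add: b_def power2_eq_square mult_ac)
    also have "exp (- a * s) * exp (- a * s) = exp (- (2 * a) * s)" by (simp flip: exp_add)
    finally show ?thesis .
  qed
  have tail: "\<mu> \<le> integral {0..t} ?f + b * (exp (- (2 * a) * t) / (2 * a))" if t: "0 \<le> t" for t
  proof -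
    have it: "?f integrable_on {t..}"
    proof (rule measurable_bounded_by_integrable_imp_integrable)
      show "?f \<in> borel_measurable (lebesgue_on {t..})"
        by (rule continuous_imp_measurable_on_sets_lebesgue)
           (auto intro!: continuous_intros continuous_on_response)
      show "(\<lambda>s. b * exp (- (2 * a) * s)) integrable_on {t..}"
        using integrable_on_exp_minus_to_infinity[of "2 * a" t] a
        by (intro integrable_on_mult_right) simp
      show "norm (?f s) \<le> b * exp (- (2 * a) * s)" if "s \<in> {t..}" for s using fb that t by simp
    qed simp
    have "integral {0..} ?f = integral ({0..t} \<union> {t..}) ?f" 
    proof -
      have "{0..} = {0..t} \<union> {t..}" using t by auto
      then show ?thesis by simp
    qed
    also have "\<dots> = integral {0..t} ?f + integral {t..} ?f"
    proof (rule integral_Un[OF integrable_response_square it])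
      have "{0..t} \<inter> {t..} = {t}" using t by auto
      then show "negligible ({0..t} \<inter> {t..})" by simp
    qed
    also have "integral {t..} ?f \<le> integral {t..} (\<lambda>s. b * exp (- (2 * a) * s))"
      using fb t a integrable_on_exp_minus_to_infinity[of "2 * a" t]
      by (intro integral_le it integrable_on_mult_right) auto
    also have "\<dots> = b * (exp (- (2 * a) * t) / (2 * a))"
      using has_integral_exp_minus_to_infinity[of "2 * a" t] a
      by (simp add: integral_unique)
    finally show ?thesis by (simp add: int)
  qed
  show ?thesis
  proof (rule that[OF th(1) C(1) l0])
    fix \<delta> \<epsilon> :: real assume d: "0 < \<delta>" "\<delta> \<le> 1" and e: "0 < \<epsilon>"
    have "(\<lambda>k. b * (exp (- (2 * a) * (real k * \<delta>)) / (2 * a))) \<longlonglongrightarrow> 0"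
      using a d by real_asymp
    then have "\<forall>\<^sub>F k in sequentially. b * (exp (- (2 * a) * (real k * \<delta>)) / (2 * a)) < \<epsilon>"
      using e by (rule order_tendstoD)
    then obtain L0 where L0: "\<And>k. k \<ge> L0 \<Longrightarrow> b * (exp (- (2 * a) * (real k * \<delta>)) / (2 * a)) < \<epsilon>"
      by (auto simp: eventually_sequentially)
    have "\<mu> - C * \<delta> - \<epsilon> \<le> \<delta> * (\<Sum>j<k. ?f (real j * \<delta>))" if "k \<ge> L0" for k
      using C(2)[OF d, of \<theta> k] tail[of "real k * \<delta>"] L0[OF that] d th by simp
    then show "\<exists>L0. \<forall>k\<ge>L0. \<mu> - C * \<delta> - \<epsilon> \<le> \<delta> * (\<Sum>j<k. ?f (real j * \<delta>))" by blast
  qed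
qed

end

section \<open>Gaussian sums of Brownian increments\<close>

context prob_space begin

lemma emeasure_cartesian_box_density:
  fixes X :: "'a \<Rightarrow> real^'n"
  assumes X: "distributed M lborel X (\<lambda>x. ennreal (\<Prod>i\<in>UNIV. f i (x $ i)))"
    and f: "\<And>i. f i \<in> borel_measurable borel" "\<And>i x. 0 \<le> f i x"
    and B: "\<And>i. B i \<in> sets borel"
  shows "emeasure M {\<omega>\<in>space M. \<forall>i. X \<omega> $ i \<in> B i} = (\<Prod>i\<in>UNIV. \<integral>\<^sup>+x. ennreal (f i x) * indicator (B i) x \<partial>lborel)"
proof -
  let ?e = "\<lambda>i. axis i (1::real) :: real^'n"
  have inj: "inj ?e" by (auto simp: inj_on_def axis_eq_axis)
  have Basis: "(Basis :: (real^'n) set) = ?e ` UNIV" by (auto simp: Basis_vec_def)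
  define S where "S = {x::real^'n. \<forall>i. x $ i \<in> B i}"
  have S: "S \<in> sets borel"
  proof -
    have "S = (\<Inter>i. (\<lambda>x. x $ i) -` B i)" by (auto simp: S_def)
    also have "\<dots> \<in> sets borel"
      using B by (intro sets.finite_INT measurable_sets_borel[OF borel_measurable_continuous_onI] continuous_intros) auto
    finally show ?thesis .
  qed
  define g where "g b x = ennreal (f (inv ?e b) x) * indicator (B (inv ?e b)) x" for b x
  have g: "g b \<in> borel_measurable borel" for b
    unfolding g_def using f B by (intro borel_measurable_times_ennreal measurable_compose[OF _ measurable_ennreal] borel_measurable_indicator) auto
  have "{\<omega>\<in>space M. \<forall>i. X \<omega> $ i \<in> B i} = X -` S \<inter> space M" by (auto simp: S_def)
  also have "emeasure M \<dots> = (\<integral>\<^sup>+x. ennreal (\<Prod>i\<in>UNIV. f i (x $ i)) * indicator S x \<partial>lborel)"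
    using distributed_emeasure[OF X] S by simp
  also have "\<dots> = (\<integral>\<^sup>+x. (\<Prod>b\<in>Basis. g b (x \<bullet> b)) \<partial>lborel)"
  proof (rule nn_integral_cong)
    fix x :: "real^'n"
    have "(indicator S x :: ennreal) = (\<Prod>i\<in>UNIV. indicator (B i) (x $ i))"
    proof (cases "x \<in> S")
      case False
      then obtain i where "x $ i \<notin> B i" by (auto simp: S_def)
      then have "(\<Prod>i\<in>UNIV. indicator (B i) (x $ i) :: ennreal) = 0" by (intro prod_zero bexI[of _ i]) auto
      with False show ?thesis by simp
    qed (auto simp: S_def)
    then show "ennreal (\<Prod>i\<in>UNIV. f i (x $ i)) * indicator S x = (\<Prod>b\<in>Basis. g b (x \<bullet> b))"
      unfolding Basis using f(2)
      by (subst prod.reindex[OF inj]) (simp add: g_def inv_f_f[OF inj] inner_axis prod.distrib prod_ennreal)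
  qed
  also have "\<dots> = (\<Prod>b\<in>Basis. \<integral>\<^sup>+x. g b x \<partial>lborel)"
    by (rule nn_integral_lborel_prod) (use g in auto)
  also have "\<dots> = (\<Prod>i\<in>UNIV. \<integral>\<^sup>+x. ennreal (f i x) * indicator (B i) x \<partial>lborel)"
    unfolding Basis by (subst prod.reindex[OF inj]) (simp add: g_def[abs_def] inv_f_f[OF inj])
  finally show ?thesis .
qed

lemma product_density_coordinates:
  fixes X :: "'a \<Rightarrow> real^'n"
  assumes X: "distributed M lborel X (\<lambda>x. ennreal (\<Prod>i\<in>UNIV. f i (x $ i)))"
    and f: "\<And>i. f i \<in> borel_measurable borel" "\<And>i x. 0 \<le> f i x" "\<And>i. (\<integral>\<^sup>+x. ennreal (f i x) \<partial>lborel) = 1"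
  shows "distributed M lborel (\<lambda>\<omega>. X \<omega> $ i) (\<lambda>x. ennreal (f i x))"
    and "indep_vars (\<lambda>_. borel) (\<lambda>i \<omega>. X \<omega> $ i) UNIV"
proof -
  note box = emeasure_cartesian_box_density[OF X f(1,2)]
  have Xm: "X \<in> borel_measurable M" using X by (auto dest: distributed_measurable)
  then have Xi: "(\<lambda>\<omega>. X \<omega> $ i) \<in> borel_measurable M" for i
    by (rule measurable_compose) (intro borel_measurable_continuous_onI continuous_intros)
  have J: "emeasure M (\<Inter>j\<in>J. (\<lambda>\<omega>. X \<omega> $ j) -` B j \<inter> space M)
      = (\<Prod>j\<in>J. \<integral>\<^sup>+x. ennreal (f j x) * indicator (B j) x \<partial>lborel)"
    if "J \<noteq> {}" "\<And>j. j \<in> J \<Longrightarrow> B j \<in> sets borel" for J :: "'n set" and B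
  proof -
    let ?B = "\<lambda>i. if i \<in> J then B i else UNIV"
    have "(\<Inter>j\<in>J. (\<lambda>\<omega>. X \<omega> $ j) -` B j \<inter> space M) = {\<omega>\<in>space M. \<forall>i. X \<omega> $ i \<in> ?B i}"
      using that(1) by (auto split: if_splits)
    also have "emeasure M \<dots> = (\<Prod>i\<in>UNIV. \<integral>\<^sup>+x. ennreal (f i x) * indicator (?B i) x \<partial>lborel)"
      by (rule box) (use that in auto)
    also have "\<dots> = (\<Prod>i\<in>J. \<integral>\<^sup>+x. ennreal (f i x) * indicator (?B i) x \<partial>lborel)"
      using f(3) by (intro prod.mono_neutral_right) auto
    also have "\<dots> = (\<Prod>j\<in>J. \<integral>\<^sup>+x. ennreal (f j x) * indicator (B j) x \<partial>lborel)"
      by (intro prod.cong) auto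
    finally show ?thesis .
  qed
  show "distributed M lborel (\<lambda>\<omega>. X \<omega> $ i) (\<lambda>x. ennreal (f i x))"
    unfolding distributed_def
  proof (intro conjI measure_eqI)
    fix A assume A: "A \<in> sets (distr M lborel (\<lambda>\<omega>. X \<omega> $ i))"
    then have "emeasure (distr M lborel (\<lambda>\<omega>. X \<omega> $ i)) A = emeasure M ((\<lambda>\<omega>. X \<omega> $ i) -` A \<inter> space M)"
      using Xi by (intro emeasure_distr) auto
    also have "\<dots> = (\<integral>\<^sup>+x. ennreal (f i x) * indicator A x \<partial>lborel)"
      using J[of "{i}" "\<lambda>_. A"] A by simp
    also have "\<dots> = emeasure (density lborel (\<lambda>x. ennreal (f i x))) A"
      using A f(1)[of i] by (subst emeasure_density) auto
    finally show "emeasure (distr M lborel (\<lambda>\<omega>. X \<omega> $ i)) A = emeasure (density lborel (\<lambda>x. ennreal (f i x))) A" .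
  qed (use Xi f(1)[of i] in auto)
  show "indep_vars (\<lambda>_. borel) (\<lambda>i \<omega>. X \<omega> $ i) UNIV"
    unfolding indep_vars_def2
  proof (intro conjI indep_setsI ballI)
    fix A and J :: "'n set"
    assume JA: "J \<noteq> {}" "J \<subseteq> UNIV" "finite J" "\<forall>j\<in>J. A j \<in> {(\<lambda>\<omega>. X \<omega> $ j) -` A \<inter> space M |A. A \<in> sets borel}"
    then obtain B where B: "\<And>j. j \<in> J \<Longrightarrow> B j \<in> sets borel" "\<And>j. j \<in> J \<Longrightarrow> A j = (\<lambda>\<omega>. X \<omega> $ j) -` B j \<inter> space M"
      by simp metis
    have "emeasure M (\<Inter>j\<in>J. A j) = emeasure M (\<Inter>j\<in>J. (\<lambda>\<omega>. X \<omega> $ j) -` B j \<inter> space M)"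
      using B(2) by (intro arg_cong[where f = "emeasure M"]) auto
    also have "\<dots> = (\<Prod>j\<in>J. \<integral>\<^sup>+x. ennreal (f j x) * indicator (B j) x \<partial>lborel)"
      by (rule J[OF JA(1) B(1)])
    also have "\<dots> = (\<Prod>j\<in>J. emeasure M (A j))"
    proof (rule prod.cong)
      fix j assume "j \<in> J"
      then show "(\<integral>\<^sup>+x. ennreal (f j x) * indicator (B j) x \<partial>lborel) = emeasure M (A j)"
        using J[of "{j}" B] B by simp
    qed simp
    finally have "ennreal (prob (\<Inter>j\<in>J. A j)) = ennreal (\<Prod>j\<in>J. prob (A j))"
      by (simp add: emeasure_eq_measure prod_ennreal)
    then show "prob (\<Inter>j\<in>J. A j) = (\<Prod>j\<in>J. prob (A j))"
      by (subst (asm) ennreal_inj) (auto intro: prod_nonneg)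
  next
    fix i show "{(\<lambda>\<omega>. X \<omega> $ i) -` A \<inter> space M |A. A \<in> sets borel} \<subseteq> events"
      using Xi[of i] by (auto intro: measurable_sets)
  qed (use Xi in auto)
qed

lemma normal_linear_functional:
  fixes X :: "'a \<Rightarrow> real^'n"
  assumes X: "distributed M lborel X (\<lambda>x. ennreal (\<Prod>i\<in>UNIV. normal_density 0 \<sigma> (x $ i)))"
    and \<sigma>: "\<sigma> > 0" and u: "u \<noteq> 0"
  shows "distributed M lborel (\<lambda>\<omega>. u \<bullet> X \<omega>) (normal_density 0 (\<sigma> * norm u))"
proof -
  define I where "I = {i. u $ i \<noteq> 0}"
  have I: "I \<noteq> {}" using u by (auto simp: I_def vec_eq_iff)
  have one: "(\<integral>\<^sup>+x. ennreal (normal_density 0 \<sigma> x) \<partial>lborel) = 1"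
    using prob_space.emeasure_space_1[OF prob_space_normal_density[OF \<sigma>, of 0]]
    by (simp add: emeasure_density)
  note c = product_density_coordinates[OF X _ _ one]
  have "distributed M lborel (\<lambda>\<omega>. \<Sum>i\<in>I. u $ i * X \<omega> $ i) (normal_density (\<Sum>i\<in>I. 0) (sqrt (\<Sum>i\<in>I. (\<bar>u $ i\<bar> * \<sigma>)\<^sup>2)))"
  proof (rule sum_indep_normal)
    have "indep_vars (\<lambda>_. borel) (\<lambda>i \<omega>. X \<omega> $ i) UNIV" by (rule c) auto
    then have "indep_vars (\<lambda>_. borel) (\<lambda>i \<omega>. u $ i * X \<omega> $ i) UNIV"
      by (rule indep_vars_compose2) auto
    then show "indep_vars (\<lambda>_. borel) (\<lambda>i \<omega>. u $ i * X \<omega> $ i) I" by (rule indep_vars_subset) auto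
    fix i assume i: "i \<in> I"
    have "distributed M lborel (\<lambda>\<omega>. X \<omega> $ i) (normal_density 0 \<sigma>)" by (rule c) auto
    from normal_density_affine[OF this \<sigma>, of "u $ i" 0] i
    show "distributed M lborel (\<lambda>\<omega>. u $ i * X \<omega> $ i) (normal_density 0 (\<bar>u $ i\<bar> * \<sigma>))"
      by (simp add: I_def)
    show "0 < \<bar>u $ i\<bar> * \<sigma>" using i \<sigma> by (simp add: I_def)
  qed (use I in auto)
  moreover have "(\<Sum>i\<in>I. u $ i * X \<omega> $ i) = u \<bullet> X \<omega>" for \<omega>
    unfolding inner_vec_def I_def by (intro sum.mono_neutral_cong_left) auto
  moreover have "sqrt (\<Sum>i\<in>I. (\<bar>u $ i\<bar> * \<sigma>)\<^sup>2) = \<sigma> * norm u"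
  proof -
    have "(\<Sum>i\<in>I. (\<bar>u $ i\<bar> * \<sigma>)\<^sup>2) = \<sigma>\<^sup>2 * (\<Sum>i\<in>UNIV. (norm (u $ i))\<^sup>2)"
      unfolding sum_distrib_left by (intro sum.mono_neutral_cong_left) (auto simp: I_def power_mult_distrib)
    with \<sigma> show ?thesis by (simp add: norm_vec_def L2_set_def real_sqrt_mult)
  qed
  ultimately show ?thesis by simp
qed

text \<open>For \<open>x \<ge> r \<ge> 0\<close> the centred density at \<open>x\<close> is at most \<open>exp(-r^2/(2\<sigma>^2))\<close> times the density centred
  at \<open>r\<close>.\<close>

lemma normal_tail_upper:
  assumes G: "distributed M lborel G (normal_density 0 \<sigma>)" and \<sigma>: "\<sigma> > 0" and r: "r \<ge> 0"
  shows "prob {\<omega>\<in>space M. r \<le> G \<omega>} \<le> exp (- r\<^sup>2 / (2 * \<sigma>\<^sup>2))"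
proof -
  have nn: "(\<integral>\<^sup>+x. ennreal (normal_density r \<sigma> x) \<partial>lborel) = 1"
    using prob_space.emeasure_space_1[OF prob_space_normal_density[OF \<sigma>, of r]] by (simp add: emeasure_density)
  have le: "ennreal (normal_density 0 \<sigma> x) * indicator {r..} x \<le> ennreal (exp (- r\<^sup>2 / (2 * \<sigma>\<^sup>2))) * ennreal (normal_density r \<sigma> x)" for x
  proof (cases "r \<le> x")
    case True
    have "0 \<le> 2 * r * (x - r)" using True r by simp
    then have "- x\<^sup>2 \<le> - r\<^sup>2 - (x - r)\<^sup>2" by (simp add: power2_eq_square algebra_simps)
    then have "- x\<^sup>2 / (2 * \<sigma>\<^sup>2) \<le> (- r\<^sup>2 - (x - r)\<^sup>2) / (2 * \<sigma>\<^sup>2)" by (intro divide_right_mono) auto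
    then have "exp (- x\<^sup>2 / (2 * \<sigma>\<^sup>2)) \<le> exp (- r\<^sup>2 / (2 * \<sigma>\<^sup>2)) * exp (- (x - r)\<^sup>2 / (2 * \<sigma>\<^sup>2))"
      by (simp flip: exp_add add: diff_divide_distrib add_divide_distrib)
    then have "1 / sqrt (2 * pi * \<sigma>\<^sup>2) * exp (- x\<^sup>2 / (2 * \<sigma>\<^sup>2)) \<le> 1 / sqrt (2 * pi * \<sigma>\<^sup>2) * (exp (- r\<^sup>2 / (2 * \<sigma>\<^sup>2)) * exp (- (x - r)\<^sup>2 / (2 * \<sigma>\<^sup>2)))"
      by (intro mult_left_mono) auto
    then have "normal_density 0 \<sigma> x \<le> exp (- r\<^sup>2 / (2 * \<sigma>\<^sup>2)) * normal_density r \<sigma> x"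
      unfolding normal_density_def by (simp add: mult_ac)
    then show ?thesis using True by (simp flip: ennreal_mult')
  qed simp
  have "emeasure M (G -` {r..} \<inter> space M) = (\<integral>\<^sup>+x. ennreal (normal_density 0 \<sigma> x) * indicator {r..} x \<partial>lborel)"
    by (rule distributed_emeasure[OF G]) simp
  also have "\<dots> \<le> (\<integral>\<^sup>+x. ennreal (exp (- r\<^sup>2 / (2 * \<sigma>\<^sup>2))) * ennreal (normal_density r \<sigma> x) \<partial>lborel)"
    by (intro nn_integral_mono le)
  also have "\<dots> = ennreal (exp (- r\<^sup>2 / (2 * \<sigma>\<^sup>2)))"
    by (subst nn_integral_cmult) (simp_all add: nn)
  also have "G -` {r..} \<inter> space M = {\<omega>\<in>space M. r \<le> G \<omega>}" by auto
  finally show ?thesis by (simp add: emeasure_eq_measure)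
qed

text \<open>The density on \<open>[r, r + \<sigma>]\<close> is at least its value at the right endpoint.\<close>

lemma normal_tail_lower:
  assumes G: "distributed M lborel G (normal_density 0 \<sigma>)" and \<sigma>: "\<sigma> > 0" and r: "r \<ge> 0"
  shows "exp (- (r / \<sigma> + 1)\<^sup>2 / 2) / sqrt (2 * pi) \<le> prob {\<omega>\<in>space M. r \<le> G \<omega>}"
proof -
  let ?c = "exp (- (r / \<sigma> + 1)\<^sup>2 / 2) / sqrt (2 * pi)"
  have le: "ennreal (?c / \<sigma>) * indicator {r..r+\<sigma>} x \<le> ennreal (normal_density 0 \<sigma> x) * indicator {r..} x" for x
  proof (cases "r \<le> x \<and> x \<le> r + \<sigma>")
    case True
    have "x\<^sup>2 \<le> (r + \<sigma>)\<^sup>2" using True r by (intro power_mono) auto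
    then have "x\<^sup>2 / (2 * \<sigma>\<^sup>2) \<le> (r + \<sigma>)\<^sup>2 / (2 * \<sigma>\<^sup>2)" by (intro divide_right_mono) auto
    also have "(r + \<sigma>)\<^sup>2 / (2 * \<sigma>\<^sup>2) = (r / \<sigma> + 1)\<^sup>2 / 2" using \<sigma> by (simp add: field_simps power2_eq_square)
    finally have "exp (- (r / \<sigma> + 1)\<^sup>2 / 2) \<le> exp (- x\<^sup>2 / (2 * \<sigma>\<^sup>2))" by simp
    then have "?c / \<sigma> \<le> normal_density 0 \<sigma> x"
      using \<sigma> unfolding normal_density_def by (simp add: real_sqrt_mult divide_simps)
    with True show ?thesis by (simp add: ennreal_leI)
  qed (auto simp: indicator_def)
  have "ennreal ?c = ennreal (?c / \<sigma>) * emeasure lborel {r..r+\<sigma>}"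
    using \<sigma> by (simp flip: ennreal_mult')
  also have "\<dots> = (\<integral>\<^sup>+x. ennreal (?c / \<sigma>) * indicator {r..r+\<sigma>} x \<partial>lborel)"
    by (rule nn_integral_cmult_indicator[symmetric]) simp
  also have "\<dots> \<le> (\<integral>\<^sup>+x. ennreal (normal_density 0 \<sigma> x) * indicator {r..} x \<partial>lborel)"
    by (intro nn_integral_mono le)
  also have "\<dots> = emeasure M (G -` {r..} \<inter> space M)"
    by (rule distributed_emeasure[OF G, symmetric]) simp
  also have "G -` {r..} \<inter> space M = {\<omega>\<in>space M. r \<le> G \<omega>}" by auto
  finally show ?thesis by (simp add: emeasure_eq_measure)
qed

end

text \<open>A standard Brownian motion on a probability space.\<close>

locale brownian_motion = prob_space M for M :: "'w measure" +
  fixes W :: "real \<Rightarrow> 'w \<Rightarrow> real^'n"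
  assumes standard: "standard_brownian_motion M W"
begin

lemma W_measurable: "t \<ge> 0 \<Longrightarrow> W t \<in> borel_measurable M"
  and W_0: "\<omega> \<in> space M \<Longrightarrow> W 0 \<omega> = 0"
  and W_continuous: "\<omega> \<in> space M \<Longrightarrow> continuous_on {0..} (\<lambda>t. W t \<omega>)"
  and W_increment: "0 \<le> s \<Longrightarrow> s < t \<Longrightarrow> distributed M lborel (\<lambda>\<omega>. W t \<omega> - W s \<omega>)
          (\<lambda>x. ennreal (\<Prod>i\<in>UNIV. normal_density 0 (sqrt (t - s)) (x $ i)))"
  and W_indep: "0 \<le> \<tau> 0 \<Longrightarrow> (\<And>i. i < n \<Longrightarrow> \<tau> i \<le> \<tau> (Suc i)) \<Longrightarrow>
     indep_vars (\<lambda>_. borel) (\<lambda>i \<omega>. W (\<tau> (Suc i)) \<omega> - W (\<tau> i) \<omega>) {..<n}"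
  using standard unfolding standard_brownian_motion_def by blast+

text \<open>The increment over the cell \<open>[j\<delta>, (j+1)\<delta>]\<close>.\<close>

definition incr :: "real \<Rightarrow> nat \<Rightarrow> 'w \<Rightarrow> real^'n" where
  "incr \<delta> j \<omega> = W (real (Suc j) * \<delta>) \<omega> - W (real j * \<delta>) \<omega>"

lemma incr_measurable: "\<delta> \<ge> 0 \<Longrightarrow> incr \<delta> j \<in> borel_measurable M"
  unfolding incr_def by (intro borel_measurable_diff W_measurable) auto

lemma incr_indep: "\<delta> \<ge> 0 \<Longrightarrow> indep_vars (\<lambda>_. borel) (incr \<delta>) {..<n}"
  using W_indep[of "\<lambda>j. real j * \<delta>" n] unfolding incr_def[abs_def]
  by (simp add: mult_right_mono)

lemma incr_functional_normal:
  assumes "\<delta> > 0" "u \<noteq> 0"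
  shows "distributed M lborel (\<lambda>\<omega>. u \<bullet> incr \<delta> j \<omega>) (normal_density 0 (sqrt \<delta> * norm u))"
proof -
  have "real (Suc j) * \<delta> - real j * \<delta> = \<delta>" by (simp add: algebra_simps)
  with W_increment[of "real j * \<delta>" "real (Suc j) * \<delta>"] assms(1)
  have "distributed M lborel (incr \<delta> j) (\<lambda>x. ennreal (\<Prod>i\<in>UNIV. normal_density 0 (sqrt \<delta>) (x $ i)))"
    by (simp add: incr_def[abs_def])
  from normal_linear_functional[OF this] assms show ?thesis by simp
qed

text \<open>Coefficients equal to zero are dropped before the convolution of normal laws, which needs
  positive variances.\<close>

lemma incr_sum_normal:
  assumes \<delta>: "\<delta> > 0" and J: "finite J" and v: "(\<Sum>j\<in>J. (norm (u j))\<^sup>2) > 0"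
  shows "distributed M lborel (\<lambda>\<omega>. \<Sum>j\<in>J. u j \<bullet> incr \<delta> j \<omega>)
           (normal_density 0 (sqrt (\<delta> * (\<Sum>j\<in>J. (norm (u j))\<^sup>2))))"
proof -
  define I where "I = {j\<in>J. u j \<noteq> 0}"
  have I: "I \<noteq> {}"
  proof
    assume "I = {}"
    then have "(\<Sum>j\<in>J. (norm (u j))\<^sup>2) = 0" by (intro sum.neutral) (auto simp: I_def)
    with v show False by simp
  qed
  have "distributed M lborel (\<lambda>\<omega>. \<Sum>j\<in>I. u j \<bullet> incr \<delta> j \<omega>)
     (normal_density (\<Sum>j\<in>I. 0) (sqrt (\<Sum>j\<in>I. (sqrt \<delta> * norm (u j))\<^sup>2)))"
  proof (rule sum_indep_normal)
    obtain n where n: "J \<subseteq> {..<n}" using J finite_nat_bounded by blast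
    have "indep_vars (\<lambda>_. borel) (\<lambda>j \<omega>. u j \<bullet> incr \<delta> j \<omega>) {..<n}"
      using \<delta> by (intro indep_vars_compose2[OF incr_indep] borel_measurable_inner) auto
    then show "indep_vars (\<lambda>_. borel) (\<lambda>j \<omega>. u j \<bullet> incr \<delta> j \<omega>) I"
      by (rule indep_vars_subset) (use n in \<open>auto simp: I_def\<close>)
    fix j assume "j \<in> I"
    then show "distributed M lborel (\<lambda>\<omega>. u j \<bullet> incr \<delta> j \<omega>) (normal_density 0 (sqrt \<delta> * norm (u j)))" "0 < sqrt \<delta> * norm (u j)"
      using \<delta> incr_functional_normal by (auto simp: I_def)
  qed (use I J in \<open>auto simp: I_def\<close>)
  moreover have "(\<Sum>j\<in>I. u j \<bullet> incr \<delta> j \<omega>) = (\<Sum>j\<in>J. u j \<bullet> incr \<delta> j \<omega>)" for \<omega>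
    using J by (intro sum.mono_neutral_left) (auto simp: I_def)
  moreover have "(\<Sum>j\<in>I. (sqrt \<delta> * norm (u j))\<^sup>2) = \<delta> * (\<Sum>j\<in>J. (norm (u j))\<^sup>2)"
    unfolding sum_distrib_left using J \<delta>
    by (intro sum.mono_neutral_cong_left) (auto simp: I_def power_mult_distrib)
  ultimately show ?thesis by simp
qed

lemma incr_sum_tail_upper:
  assumes \<delta>: "\<delta> > 0" and J: "finite J" and V: "\<delta> * (\<Sum>j\<in>J. (norm (u j))\<^sup>2) \<le> V" "V > 0" and r: "r > 0"
  shows "prob {\<omega>\<in>space M. r \<le> (\<Sum>j\<in>J. u j \<bullet> incr \<delta> j \<omega>)} \<le> exp (- r\<^sup>2 / (2 * V))"
proof (cases "(\<Sum>j\<in>J. (norm (u j))\<^sup>2) > 0")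
  case True
  let ?v = "\<delta> * (\<Sum>j\<in>J. (norm (u j))\<^sup>2)"
  have v: "?v > 0" using True \<delta> by simp
  have "prob {\<omega>\<in>space M. r \<le> (\<Sum>j\<in>J. u j \<bullet> incr \<delta> j \<omega>)} \<le> exp (- r\<^sup>2 / (2 * (sqrt ?v)\<^sup>2))"
    using v r by (intro normal_tail_upper incr_sum_normal \<delta> J True) auto
  also have "\<dots> \<le> exp (- r\<^sup>2 / (2 * V))"
    using v V by (simp add: frac_le)
  finally show ?thesis .
next
  case False
  then have "(\<Sum>j\<in>J. (norm (u j))\<^sup>2) = 0" by (simp add: sum_nonneg order_antisym not_less)
  then have "u j = 0" if "j \<in> J" for j using J that by (simp add: sum_nonneg_eq_0_iff)
  then have "(\<Sum>j\<in>J. u j \<bullet> incr \<delta> j \<omega>) = 0" for \<omega> by (simp add: sum.neutral)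
  with r show ?thesis by simp
qed

lemma norm_incr_tail:
  assumes "\<delta> > 0" "r > 0"
  shows "prob {\<omega>\<in>space M. r \<le> norm (incr \<delta> j \<omega>)} \<le> 2 * CARD('n) * exp (- r\<^sup>2 / (2 * (real CARD('n))\<^sup>2 * \<delta>))"
proof -
  let ?n = "real CARD('n)" and ?T = "{1, -1 :: real} \<times> (UNIV :: 'n set)"
  let ?E = "\<lambda>(c, i). {\<omega>\<in>space M. r / ?n \<le> (\<Sum>l\<in>{j}. (axis i c :: real^'n) \<bullet> incr \<delta> l \<omega>)}"
  have E: "?E ci \<in> events" for ci
    using incr_measurable[of \<delta>] assms by (cases ci) simp
  have "{\<omega>\<in>space M. r \<le> norm (incr \<delta> j \<omega>)} \<subseteq> (\<Union>ci\<in>?T. ?E ci)"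
  proof safe
    fix \<omega> assume \<omega>: "\<omega> \<in> space M" and rl: "r \<le> norm (incr \<delta> j \<omega>)"
    have "\<exists>i. r / ?n \<le> \<bar>incr \<delta> j \<omega> $ i\<bar>"
    proof (rule ccontr)
      assume "\<not> ?thesis"
      then have "(\<Sum>i\<in>UNIV. \<bar>incr \<delta> j \<omega> $ i\<bar>) < (\<Sum>i\<in>(UNIV :: 'n set). r / ?n)"
        by (intro sum_strict_mono) (auto simp: not_le)
      with norm_le_l1_cart[of "incr \<delta> j \<omega>"] rl show False by simp
    qed
    then obtain i where "r / ?n \<le> \<bar>incr \<delta> j \<omega> $ i\<bar>" ..
    then have "r / ?n \<le> axis i 1 \<bullet> incr \<delta> j \<omega> \<or> r / ?n \<le> axis i (-1) \<bullet> incr \<delta> j \<omega>"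
      by (auto simp: inner_axis' abs_if split: if_splits)
    then show "\<omega> \<in> (\<Union>ci\<in>?T. ?E ci)" using \<omega> by auto
  qed
  then have "prob {\<omega>\<in>space M. r \<le> norm (incr \<delta> j \<omega>)} \<le> prob (\<Union>ci\<in>?T. ?E ci)"
    using E by (intro finite_measure_mono sets.finite_UN) auto
  also have "\<dots> \<le> (\<Sum>ci\<in>?T. prob (?E ci))"
    using E by (intro finite_measure_subadditive_finite) auto
  also have "\<dots> \<le> (\<Sum>ci\<in>?T. exp (- (r / ?n)\<^sup>2 / (2 * \<delta>)))"
  proof (intro sum_mono)
    fix ci assume "ci \<in> ?T"
    moreover have "prob {\<omega>\<in>space M. r / ?n \<le> (\<Sum>l\<in>{j}. (axis i c :: real^'n) \<bullet> incr \<delta> l \<omega>)} \<le> exp (- (r / ?n)\<^sup>2 / (2 * \<delta>))"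
      if "c \<in> {1, -1}" for i c
    proof (rule incr_sum_tail_upper)
      have "(norm (axis i c :: real^'n))\<^sup>2 = c\<^sup>2"
        by (simp only: power2_norm_eq_inner) (simp add: inner_axis power2_eq_square)
      then show "\<delta> * (\<Sum>l\<in>{j}. (norm (axis i c :: real^'n))\<^sup>2) \<le> \<delta>" using that assms by auto
    qed (use assms in auto)
    ultimately show "prob (?E ci) \<le> exp (- (r / ?n)\<^sup>2 / (2 * \<delta>))" by auto
  qed
  also have "\<dots> = 2 * CARD('n) * exp (- r\<^sup>2 / (2 * ?n\<^sup>2 * \<delta>))"
    by (simp add: card_cartesian_product power_divide mult_ac)
  finally show ?thesis .
qed

end

section \<open>Oscillation of Brownian paths\<close>

text \<open>The growth scale. The shift by 3 keeps it at least 1 on the whole half-line.\<close>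

definition ell :: "real \<Rightarrow> real" where "ell t = sqrt (ln (t + 3))"

lemma ell_mono: "0 \<le> s \<Longrightarrow> s \<le> t \<Longrightarrow> ell s \<le> ell t"
  by (simp add: ell_def)

lemma ell_ge_1: "0 \<le> t \<Longrightarrow> 1 \<le> ell t"
proof -
  assume t: "0 \<le> t"
  have "exp 1 \<le> t + 3" using exp_le t by linarith
  then have "1 \<le> ln (t + 3)" using t by (simp add: ln_ge_iff)
  then show ?thesis by (simp add: ell_def)
qed

lemma ell_nonneg: "0 \<le> t \<Longrightarrow> 0 \<le> ell t"
  using ell_ge_1[of t] by linarith

lemma ell_square: "0 \<le> t \<Longrightarrow> (ell t)\<^sup>2 = ln (t + 3)"
  by (simp add: ell_def)

text \<open>If the dyadic increments of level \<open>m\<close> are bounded by \<open>c (3/4)^m (ell + C)\<close>, then so are all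
  increments over time at most \<open>2^(-M)\<close>, up to a factor: approximate both endpoints by dyadic points
  of increasing level and sum the geometric series.\<close>

lemma dyadic_chaining:
  fixes f :: "real \<Rightarrow> 'a::real_normed_vector" and c C :: real
  assumes cont: "continuous_on {0..} f" and c: "c \<ge> 0" and C: "C \<ge> 0"
    and incr: "\<And>m j. norm (f (real (Suc j) / 2 ^ m) - f (real j / 2 ^ m)) \<le> c * (3/4) ^ m * (ell (real j / 2 ^ m) + C)"
    and st: "0 \<le> s" "s \<le> t" "t \<le> s + 1 / 2 ^ M"
  shows "norm (f t - f s) \<le> 7 * c * (3/4) ^ M * (ell t + C)"
proof -
  \<comment> \<open>The dyadic point of level \<open>m\<close> just below \<open>x\<close> is \<open>k m x / 2^m\<close>.\<close>
  define k where "k m x = nat \<lfloor>2 ^ m * x\<rfloor>" for m and x :: real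
  define g where "g m x = f (real (k m x) / 2 ^ m)" for m x
  have kb: "real (k m x) \<le> 2 ^ m * x" "2 ^ m * x < real (k m x) + 1" if "0 \<le> x" for m x
    using that unfolding k_def by (auto simp: of_nat_floor)
  have kle: "real (k m x) / 2 ^ m \<le> x" if "0 \<le> x" for m x
    using kb(1)[OF that, of m] by (simp add: field_simps)
  have inc: "norm (f (real (Suc j) / 2 ^ m) - f (real j / 2 ^ m)) \<le> c * (3/4) ^ m * (ell y + C)"
    if "real j / 2 ^ m \<le> y" for j m y
  proof -
    have "c * (3/4) ^ m * (ell (real j / 2 ^ m) + C) \<le> c * (3/4) ^ m * (ell y + C)"
      using ell_mono[of "real j / 2 ^ m" y] that c by (intro mult_left_mono) auto
    with incr[of j m] show ?thesis by linarith
  qed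
  have step: "norm (g (Suc m) x - g m x) \<le> c * (3/4) ^ Suc m * (ell x + C)" if x: "0 \<le> x" for m x
  proof -
    have "real (k (Suc m) x) < real (2 * k m x + 2)" "real (2 * k m x) < real (k (Suc m) x + 1)"
      using kb[OF x, of m] kb[OF x, of "Suc m"] by auto
    then have "k (Suc m) x = 2 * k m x \<or> k (Suc m) x = Suc (2 * k m x)"
      unfolding of_nat_less_iff by linarith
    moreover have half: "real (2 * k m x) / 2 ^ Suc m = real (k m x) / 2 ^ m" by simp
    moreover have "norm (f (real (Suc (2 * k m x)) / 2 ^ Suc m) - f (real (2 * k m x) / 2 ^ Suc m)) \<le> c * (3/4) ^ Suc m * (ell x + C)"
      using kle[OF x, of m] half by (intro inc) linarith
    moreover have "0 \<le> c * (3/4) ^ Suc m * (ell x + C)" using c C ell_nonneg[OF x] by simp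
    ultimately show ?thesis unfolding g_def by (metis diff_self norm_zero)
  qed
  have sum: "norm (g (M + p) x - g M x) \<le> 3 * c * (3/4) ^ M * (1 - (3/4) ^ p) * (ell x + C)" if x: "0 \<le> x" for p x
  proof (induction p)
    case (Suc p)
    have "norm (g (M + Suc p) x - g M x) \<le> norm (g (Suc (M + p)) x - g (M + p) x) + norm (g (M + p) x - g M x)"
      using norm_triangle_ineq[of "g (Suc (M + p)) x - g (M + p) x" "g (M + p) x - g M x"] by simp
    also have "\<dots> \<le> c * (3/4) ^ Suc (M + p) * (ell x + C) + 3 * c * (3/4) ^ M * (1 - (3/4) ^ p) * (ell x + C)"
      by (intro add_mono step x Suc)
    also have "\<dots> = 3 * c * (3/4) ^ M * (1 - (3/4) ^ Suc p) * (ell x + C)"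
      by (simp add: power_add field_simps)
    finally show ?case .
  qed simp
  have lim: "norm (f x - g M x) \<le> 3 * c * (3/4) ^ M * (ell x + C)" if x: "0 \<le> x" for x
  proof (rule Lim_bounded)
    have "(\<lambda>p. real (k (M + p) x) / 2 ^ (M + p)) \<longlonglongrightarrow> x"
    proof (rule tendsto_sandwich)
      show "\<forall>\<^sub>F p in sequentially. x - 1 / 2 ^ (M + p) \<le> real (k (M + p) x) / 2 ^ (M + p)"
      proof (intro always_eventually allI)
        fix p
        have "x \<le> (real (k (M + p) x) + 1) / 2 ^ (M + p)"
          using kb(2)[OF x, of "M + p"] by (simp add: pos_le_divide_eq mult.commute less_imp_le)
        then show "x - 1 / 2 ^ (M + p) \<le> real (k (M + p) x) / 2 ^ (M + p)"
          by (simp add: add_divide_distrib)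
      qed
      show "\<forall>\<^sub>F p in sequentially. real (k (M + p) x) / 2 ^ (M + p) \<le> x"
        using kle[OF x] by simp
      have "(\<lambda>p. x - (1 / 2 ^ M) * (1/2) ^ p) \<longlonglongrightarrow> x - (1 / 2 ^ M) * 0"
        by (intro tendsto_intros LIMSEQ_power_zero) auto
      then show "(\<lambda>p. x - 1 / 2 ^ (M + p)) \<longlonglongrightarrow> x" by (simp add: power_add power_one_over)
    qed simp
    then have "(\<lambda>p. g (M + p) x) \<longlonglongrightarrow> f x"
      unfolding g_def using x by (intro continuous_on_tendsto_compose[OF cont]) auto
    then show "(\<lambda>p. norm (g (M + p) x - g M x)) \<longlonglongrightarrow> norm (f x - g M x)" by (intro tendsto_intros)
    have "norm (g (M + p) x - g M x) \<le> 3 * c * (3/4) ^ M * (ell x + C)" for p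
    proof -
      have "3 * c * (3/4) ^ M * (1 - (3/4) ^ p) * (ell x + C) \<le> 3 * c * (3/4) ^ M * 1 * (ell x + C)"
        using c C ell_nonneg[OF x] by (intro mult_right_mono mult_left_mono) auto
      with sum[OF x, of p] show ?thesis by simp
    qed
    then show "\<forall>p\<ge>0. norm (g (M + p) x - g M x) \<le> 3 * c * (3/4) ^ M * (ell x + C)" by blast
  qed
  have t0: "0 \<le> t" using st by simp
  have mid: "norm (g M t - g M s) \<le> c * (3/4) ^ M * (ell t + C)"
  proof -
    have "2 ^ M * t \<le> 2 ^ M * s + 1" using st(3) by (simp add: field_simps)
    then have "real (k M t) < real (k M s + 2)" using kb[OF st(1), of M] kb[OF t0, of M] by simp
    moreover have "k M s \<le> k M t" unfolding k_def using st by (intro nat_mono floor_mono mult_left_mono) auto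
    ultimately have "k M t = k M s \<or> k M t = Suc (k M s)" unfolding of_nat_less_iff by linarith
    moreover have "norm (f (real (Suc (k M s)) / 2 ^ M) - f (real (k M s) / 2 ^ M)) \<le> c * (3/4) ^ M * (ell t + C)"
      using kle[OF st(1), of M] st by (intro inc) linarith
    moreover have "0 \<le> c * (3/4) ^ M * (ell t + C)" using c C ell_nonneg[OF t0] by simp
    ultimately show ?thesis unfolding g_def by (metis diff_self norm_zero)
  qed
  have "norm (f t - f s) \<le> norm (f t - g M t) + norm (g M t - g M s) + norm (f s - g M s)"
    using norm_triangle_ineq[of "f t - g M t" "g M t - g M s"] norm_triangle_ineq4[of "f t - g M s" "f s - g M s"] by simp
  also have "\<dots> \<le> 3 * c * (3/4) ^ M * (ell t + C) + c * (3/4) ^ M * (ell t + C) + 3 * c * (3/4) ^ M * (ell t + C)"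
  proof (intro add_mono lim mid t0)
    have "3 * c * (3/4) ^ M * (ell s + C) \<le> 3 * c * (3/4) ^ M * (ell t + C)"
      using ell_mono[OF st(1,2)] c by (intro mult_left_mono) auto
    with lim[OF st(1)] show "norm (f s - g M s) \<le> 3 * c * (3/4) ^ M * (ell t + C)" by linarith
  qed
  also have "\<dots> = 7 * c * (3/4) ^ M * (ell t + C)" by (simp add: algebra_simps)
  finally show ?thesis .
qed

lemma summable_prod_decode:
  fixes f :: "nat \<Rightarrow> nat \<Rightarrow> real"
  assumes "summable a" "summable b" "\<And>m j. 0 \<le> f m j" "\<And>m j. f m j \<le> a m * b j" "\<And>m. 0 \<le> a m" "\<And>m. 0 \<le> b m"
  shows "summable (\<lambda>n. case prod_decode n of (m, j) \<Rightarrow> f m j)"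
proof (rule summableI_nonneg_bounded)
  show "0 \<le> (case prod_decode n of (m, j) \<Rightarrow> f m j)" for n using assms by (simp split: prod.split)
  fix N :: nat
  have "(\<Sum>n<N. case prod_decode n of (m, j) \<Rightarrow> f m j) = (\<Sum>(m, j)\<in>prod_decode ` {..<N}. f m j)"
    by (subst sum.reindex) (auto intro: inj_on_subset[OF inj_prod_decode])
  also have "\<dots> \<le> (\<Sum>(m, j)\<in>{..<N} \<times> {..<N}. f m j)"
  proof (rule sum_mono2)
    show "prod_decode ` {..<N} \<subseteq> {..<N} \<times> {..<N}"
    proof
      fix p assume "p \<in> prod_decode ` {..<N}"
      then obtain n where n: "n < N" "p = prod_decode n" by auto
      obtain m j where mj: "p = (m, j)" by fastforce
      have "prod_encode (m, j) = n" using n mj by (metis prod_decode_inverse)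
      with n(1) le_prod_encode_1[of m j] le_prod_encode_2[of j m] show "p \<in> {..<N} \<times> {..<N}"
        by (simp add: mj)
    qed
  qed (use assms in auto)
  also have "\<dots> \<le> (\<Sum>(m, j)\<in>{..<N} \<times> {..<N}. a m * b j)"
    using assms(4) by (intro sum_mono) auto
  also have "\<dots> = (\<Sum>m<N. a m) * (\<Sum>j<N. b j)"
    by (simp add: sum_product sum.cartesian_product)
  also have "\<dots> \<le> suminf a * suminf b"
    using assms by (intro mult_mono sum_le_suminf suminf_nonneg sum_nonneg) auto
  finally show "(\<Sum>n<N. case prod_decode n of (m, j) \<Rightarrow> f m j) \<le> suminf a * suminf b" .
qed

context brownian_motion begin

text \<open>The threshold \<open>7n (3/4)^m ell\<close> exceeds the standard deviation \<open>2^(-m/2)\<close> of a coordinate by a factor growing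
  like \<open>(9/8)^(m/2)\<close>, which beats the number of dyadic points of level \<open>m\<close>. The constant 7 is chosen
  such that \<open>49/2 (9/8)^m \<ge> 3m + 2\<close>, as given by Bernoulli's inequality.\<close>

lemma dyadic_increment_tail:
  defines "n \<equiv> real CARD('n)"
  shows "prob {\<omega>\<in>space M. 7 * n * (3/4) ^ m * ell (real j / 2 ^ m) \<le> norm (incr (1 / 2 ^ m) j \<omega>)}
     \<le> (2 * n * (1/2) ^ m) * (1 / (real (Suc j))\<^sup>2)"
proof -
  let ?x = "real j / 2 ^ m" and ?\<delta> = "1 / 2 ^ m :: real"
  let ?r = "7 * n * (3/4) ^ m * ell ?x"
  have n: "n > 0" by (simp add: n_def)
  have x0: "0 \<le> ?x" by simp
  have e0: "ell ?x > 0" using ell_ge_1[OF x0] by linarith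
  have l0: "ln (?x + 3) \<ge> 0" by simp
  have "?r\<^sup>2 / (2 * n\<^sup>2 * ?\<delta>) = 49 / 2 * (9/8) ^ m * ln (?x + 3)"
  proof -
    have "?r\<^sup>2 = 49 * n\<^sup>2 * ((3/4) ^ m)\<^sup>2 * ln (?x + 3)"
      by (simp add: power_mult_distrib ell_square[OF x0])
    moreover have "((3/4::real) ^ m)\<^sup>2 * 2 ^ m = (9/8) ^ m"
      by (simp add: power2_eq_square flip: power_mult_distrib)
    ultimately show ?thesis using n by (simp add: field_simps)
  qed
  then have "exp (- ?r\<^sup>2 / (2 * n\<^sup>2 * ?\<delta>)) = exp (- (49 / 2 * (9/8) ^ m * ln (?x + 3)))" by simp
  also have "\<dots> \<le> exp (- (real (3 * m + 2) * ln (?x + 3)))"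
  proof -
    have "1 + real m * (1/8) \<le> (1 + 1/8 :: real) ^ m" by (rule Bernoulli_inequality) simp
    then have "real (3 * m + 2) \<le> 49 / 2 * (9/8) ^ m" by simp
    with l0 show ?thesis by (simp only: exp_le_cancel_iff neg_le_iff_le) (intro mult_right_mono)
  qed
  also have "\<dots> = 1 / (?x + 3) ^ (3 * m + 2)"
  proof -
    have "exp (real (3 * m + 2) * ln (?x + 3)) = exp (ln (?x + 3)) ^ (3 * m + 2)"
      by (rule exp_of_nat_mult)
    also have "exp (ln (?x + 3)) = ?x + 3" by (rule exp_ln) (use x0 in linarith)
    finally show ?thesis by (simp only: exp_minus inverse_eq_divide)
  qed
  also have "\<dots> \<le> 1 / (2 ^ m * (real (Suc j))\<^sup>2)"
  proof (rule divide_left_mono)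
    have p: "(8::real) ^ m \<le> (?x + 3) ^ (3 * m)"
    proof -
      have "(8::real) ^ m = 2 ^ (3 * m)" by (simp add: power_mult)
      also have "\<dots> \<le> (?x + 3) ^ (3 * m)" using x0 by (intro power_mono) linarith+
      finally show ?thesis .
    qed
    have "real (Suc j) \<le> 2 ^ m * (?x + 3)"
    proof -
      have "(1::real) \<le> 2 ^ m * 3" using one_le_power[of "2::real" m] by linarith
      then show ?thesis by (simp add: algebra_simps)
    qed
    then have "(real (Suc j))\<^sup>2 \<le> (2 ^ m * (?x + 3))\<^sup>2" by (intro power_mono) auto
    then have "2 ^ m * (real (Suc j))\<^sup>2 \<le> 2 ^ m * (2 ^ m * (?x + 3))\<^sup>2" by (intro mult_left_mono) auto
    also have "\<dots> = 8 ^ m * (?x + 3)\<^sup>2"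
    proof -
      have "(2::real) ^ m * (2 ^ m)\<^sup>2 = 8 ^ m" by (simp add: power2_eq_square flip: power_mult_distrib)
      then show ?thesis by (simp add: power_mult_distrib mult.assoc[symmetric])
    qed
    also have "\<dots> \<le> (?x + 3) ^ (3 * m) * (?x + 3)\<^sup>2" by (intro mult_right_mono p) auto
    finally show "2 ^ m * (real (Suc j))\<^sup>2 \<le> (?x + 3) ^ (3 * m + 2)" by (simp only: power_add)
    have "0 < (?x + 3) ^ (3 * m + 2)" using x0 by (intro zero_less_power) linarith
    then show "0 < (?x + 3) ^ (3 * m + 2) * (2 ^ m * (real (Suc j))\<^sup>2)" by (intro mult_pos_pos) auto
  qed simp
  finally have e: "exp (- ?r\<^sup>2 / (2 * n\<^sup>2 * ?\<delta>)) \<le> 1 / (2 ^ m * (real (Suc j))\<^sup>2)" .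
  have "prob {\<omega>\<in>space M. ?r \<le> norm (incr ?\<delta> j \<omega>)} \<le> 2 * n * exp (- ?r\<^sup>2 / (2 * n\<^sup>2 * ?\<delta>))"
    using norm_incr_tail[of ?\<delta> ?r j] n e0 by (simp add: n_def)
  also have "\<dots> \<le> 2 * n * (1 / (2 ^ m * (real (Suc j))\<^sup>2))"
    using n by (intro mult_left_mono e) auto
  finally show ?thesis by (simp add: power_one_over del: of_nat_Suc)
qed

text \<open>On the scale \<open>ell\<close> the oscillation of a Brownian path over short intervals is arbitrarily small.
  By Borel-Cantelli only finitely many pairs of level and position violate the hypothesis of
  the chaining lemma with \<open>C = 0\<close>; these are absorbed into \<open>C\<close>.\<close>

lemma brownian_modulus:
  assumes \<eta>: "\<eta> > 0"
  shows "\<exists>\<delta>0>0. AE \<omega> in M. \<exists>B\<ge>0. \<forall>s t. 0 \<le> s \<longrightarrow> s \<le> t \<longrightarrow> t \<le> s + \<delta>0 \<longrightarrow>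
     norm (W t \<omega> - W s \<omega>) \<le> \<eta> * ell t + B"
proof -
  define n where "n = real CARD('n)"
  have n: "n > 0" by (simp add: n_def)
  define bad where "bad m j = {\<omega>\<in>space M. 7 * n * (3/4) ^ m * ell (real j / 2 ^ m) \<le> norm (incr (1 / 2 ^ m) j \<omega>)}" for m j
  have bad_ev: "bad m j \<in> events" for m j
    unfolding bad_def using incr_measurable[of "1 / 2 ^ m" j] by measurable
  have "(\<lambda>m. 49 * n * (3/4) ^ m) \<longlonglongrightarrow> 49 * n * 0"
    by (intro tendsto_intros LIMSEQ_power_zero) auto
  then have "\<forall>\<^sub>F m in sequentially. 49 * n * (3/4) ^ m < \<eta>" using \<eta> by (intro order_tendstoD) auto
  then obtain M0 where M0: "49 * n * (3/4) ^ M0 < \<eta>" by (auto simp: eventually_sequentially)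
  have "AE \<omega> in M. \<forall>\<^sub>F i in sequentially. \<omega> \<in> space M - (case prod_decode i of (m, j) \<Rightarrow> bad m j)"
  proof (rule borel_cantelli_AE1)
    have "summable (\<lambda>i. case prod_decode i of (m, j) \<Rightarrow> prob (bad m j))"
    proof (rule summable_prod_decode)
      show "summable (\<lambda>m. 2 * n * (1/2) ^ m)" by (intro summable_mult summable_geometric) simp
      show "summable (\<lambda>j. 1 / (real (Suc j))\<^sup>2)"
        using inverse_power_summable[of 2, where 'a=real] summable_Suc_iff[of "\<lambda>j. 1 / (real j)\<^sup>2"]
        by (simp add: inverse_eq_divide del: of_nat_Suc)
      show "prob (bad m j) \<le> 2 * n * (1/2) ^ m * (1 / (real (Suc j))\<^sup>2)" for m j
        unfolding bad_def n_def by (rule dyadic_increment_tail)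
    qed (use n in auto)
    then show "summable (\<lambda>i. prob (case prod_decode i of (m, j) \<Rightarrow> bad m j))"
      by (rule summable_cong[THEN iffD1, rotated]) (auto split: prod.split)
  qed (auto split: prod.split simp: bad_ev emeasure_eq_measure)
  then have "AE \<omega> in M. \<exists>B\<ge>0. \<forall>s t. 0 \<le> s \<longrightarrow> s \<le> t \<longrightarrow> t \<le> s + 1 / 2 ^ M0 \<longrightarrow>
     norm (W t \<omega> - W s \<omega>) \<le> \<eta> * ell t + B"
  proof (rule AE_mp, intro AE_I2 impI)
    fix \<omega> assume \<omega>: "\<omega> \<in> space M"
      and "\<forall>\<^sub>F i in sequentially. \<omega> \<in> space M - (case prod_decode i of (m, j) \<Rightarrow> bad m j)"
    then obtain N where N: "\<And>i. i \<ge> N \<Longrightarrow> \<omega> \<notin> (case prod_decode i of (m, j) \<Rightarrow> bad m j)"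
      by (auto simp: eventually_sequentially)
    define b where "b m = 7 * n * (3/4) ^ m" for m
    have b: "b m > 0" for m using n by (simp add: b_def)
    define q where "q = (\<lambda>(m, j). norm (incr (1 / 2 ^ m) j \<omega>) / b m)"
    define C where "C = (\<Sum>i<N. q (prod_decode i))"
    have q0: "q p \<ge> 0" for p using b by (auto simp: q_def less_imp_le split: prod.split)
    have C0: "C \<ge> 0" unfolding C_def by (intro sum_nonneg q0)
    have bound: "norm (W (real (Suc j) / 2 ^ m) \<omega> - W (real j / 2 ^ m) \<omega>) \<le> 7 * n * (3/4) ^ m * (ell (real j / 2 ^ m) + C)" for m j
    proof -
      have e0: "ell (real j / 2 ^ m) \<ge> 0" by (rule ell_nonneg) simp
      have "norm (incr (1 / 2 ^ m) j \<omega>) \<le> b m * (ell (real j / 2 ^ m) + C)"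
      proof (cases "\<omega> \<in> bad m j")
        case True
        then have "prod_encode (m, j) < N" using N[of "prod_encode (m, j)"] by (cases "prod_encode (m, j) < N") auto
        then have "q (prod_decode (prod_encode (m, j))) \<le> C"
          unfolding C_def by (intro member_le_sum q0) auto
        then have "norm (incr (1 / 2 ^ m) j \<omega>) \<le> b m * C" using b[of m] by (simp add: q_def field_simps)
        also have "\<dots> \<le> b m * (ell (real j / 2 ^ m) + C)" using b[of m] e0 by (intro mult_left_mono) auto
        finally show ?thesis .
      next
        case False
        then have "norm (incr (1 / 2 ^ m) j \<omega>) \<le> b m * ell (real j / 2 ^ m)"
          using \<omega> by (auto simp: bad_def b_def)
        also have "\<dots> \<le> b m * (ell (real j / 2 ^ m) + C)" using b[of m] C0 by (intro mult_left_mono) auto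
        finally show ?thesis .
      qed
      then show ?thesis by (simp add: incr_def b_def)
    qed
    have "norm (W t \<omega> - W s \<omega>) \<le> \<eta> * ell t + \<eta> * C" if st: "0 \<le> s" "s \<le> t" "t \<le> s + 1 / 2 ^ M0" for s t
    proof -
      have "norm (W t \<omega> - W s \<omega>) \<le> 7 * (7 * n) * (3/4) ^ M0 * (ell t + C)"
        by (rule dyadic_chaining[OF W_continuous[OF \<omega>] _ C0 bound st]) (use n in auto)
      also have "\<dots> \<le> \<eta> * (ell t + C)"
        using M0 st C0 ell_nonneg[of t] by (intro mult_right_mono) auto
      finally show ?thesis by (simp add: algebra_simps)
    qed
    then show "\<exists>B\<ge>0. \<forall>s t. 0 \<le> s \<longrightarrow> s \<le> t \<longrightarrow> t \<le> s + 1 / 2 ^ M0 \<longrightarrow> norm (W t \<omega> - W s \<omega>) \<le> \<eta> * ell t + B"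
      using C0 \<eta> by (intro exI[of _ "\<eta> * C"]) auto
  qed
  then show ?thesis by (intro exI[of _ "1 / 2 ^ M0"]) auto
qed

end

section \<open>Solutions and the discretised stochastic convolution\<close>

text \<open>The discretised stochastic convolution: the increment over cell \<open>j\<close> is transported by the
  propagator from the end of that cell to time \<open>k\<delta>\<close>. The truncated subtraction \<open>k - Suc j\<close> is harmless
  since \<open>j < k\<close>.\<close>

definition noise_sum :: "real^'n^'n \<Rightarrow> real^'n^'n \<Rightarrow> real \<Rightarrow> (real \<Rightarrow> real^'n) \<Rightarrow> nat \<Rightarrow> real^'n" where
  "noise_sum A D \<delta> w k = (\<Sum>j<k. flow A (real (k - Suc j) * \<delta>) *v (D *v (w (real (Suc j) * \<delta>) - w (real j * \<delta>))))"

lemma discrete_duhamel: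
  fixes A :: "real^'n^'n"
  shows "(\<Sum>j<Suc k. flow A (real (Suc k - Suc j) * \<delta>) *v r j)
    = flow A \<delta> *v (\<Sum>j<k. flow A (real (k - Suc j) * \<delta>) *v r j) + r k"
proof -
  have "flow A (real (Suc k - Suc j) * \<delta>) *v r j = flow A \<delta> *v (flow A (real (k - Suc j) * \<delta>) *v r j)" if "j < k" for j
  proof -
    have "real (Suc k - Suc j) * \<delta> = \<delta> + real (k - Suc j) * \<delta>"
      using that by (simp add: of_nat_diff Suc_diff_Suc algebra_simps)
    then show ?thesis by (simp add: flow_add matrix_vector_mul_assoc)
  qed
  then show ?thesis
    by (simp add: bounded_bilinear.sum_right[OF bounded_bilinear_matrix_vector_mult] del: diff_Suc_Suc)
qed

lemma noise_sum_Suc: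
  "noise_sum A D \<delta> w (Suc k) = flow A \<delta> *v noise_sum A D \<delta> w k + D *v (w (real (Suc k) * \<delta>) - w (real k * \<delta>))"
  unfolding noise_sum_def by (rule discrete_duhamel)

text \<open>Subtracting the noise makes the path differentiable: \<open>Y_r = X_r - D(w_r - w_s)\<close> satisfies
  \<open>Y' = F(X) - AY - AD(w_r - w_s)\<close>, so no stochastic integral is needed.\<close>

lemma variation_of_constants:
  fixes A D :: "real^'n^'n"
  assumes sol: "pathwise_solution F A D w x X" and F: "continuous_on UNIV F" and st: "0 \<le> s" "s \<le> t"
  shows "((\<lambda>r. flow A (t - r) *v (F (X r) - A *v (D *v (w r - w s))))
    has_integral (X t - D *v (w t - w s) - flow A (t - s) *v X s)) {s..t}"
proof -
  define G where "G r = F (X r) - A *v X r" for r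
  define Y where "Y r = X r - D *v (w r - w s)" for r
  have Xc: "continuous_on {0..} X" and X: "\<And>r. 0 \<le> r \<Longrightarrow> X r = x + integral {0..r} G + D *v w r"
    using sol by (auto simp: pathwise_solution_def G_def[abs_def])
  have Gc: "continuous_on {0..t} G"
    unfolding G_def
    by (intro continuous_intros continuous_on_compose2[OF F] continuous_on_subset[OF Xc]
        linear_continuous_on_compose[OF _ matrix_vector_mul_linear]) auto
  have dY: "(Y has_vector_derivative G r) (at r within {s..t})" if r: "r \<in> {s..t}" for r
  proof -
    have "((\<lambda>u. integral {0..u} G) has_vector_derivative G r) (at r within {s..t})"
      using integral_has_vector_derivative[OF Gc, of r] r st
      by (auto intro: has_vector_derivative_within_subset)
    then have "((\<lambda>u. x + integral {0..u} G + D *v w s) has_vector_derivative G r) (at r within {s..t})"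
      by (auto intro!: derivative_eq_intros)
    then show ?thesis
    proof (rule has_vector_derivative_transform[OF r, rotated])
      fix u assume "u \<in> {s..t}"
      then show "Y u = x + integral {0..u} G + D *v w s"
        using X[of u] st by (simp add: Y_def matrix_vector_mult_diff_distrib)
    qed
  qed
  have dE: "((\<lambda>r. flow A (t - r)) has_vector_derivative A ** flow A (t - r)) (at r within S)" for r S
  proof -
    have "((\<lambda>r. flow A (t - r)) has_vector_derivative (-1) *\<^sub>R (- (A ** flow A (t - r)))) (at r)"
      by (rule vector_diff_chain_at[OF _ has_vector_derivative_flow, unfolded o_def])
         (auto intro!: derivative_eq_intros)
    then show ?thesis by (auto intro: has_vector_derivative_at_within)
  qed
  have "((\<lambda>r. flow A (t - r) *v Y r) has_vector_derivative
      flow A (t - r) *v (F (X r) - A *v (D *v (w r - w s)))) (at r within {s..t})" if r: "r \<in> {s..t}" for r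
  proof (rule has_vector_derivative_eq_rhs[OF bounded_bilinear.has_vector_derivative[OF bounded_bilinear_matrix_vector_mult dE dY[OF r]]])
    show "flow A (t - r) *v G r + (A ** flow A (t - r)) *v Y r = flow A (t - r) *v (F (X r) - A *v (D *v (w r - w s)))"
      by (simp add: flow_commute G_def Y_def matrix_vector_mult_diff_distrib flip: matrix_vector_mul_assoc)
  qed
  from fundamental_theorem_of_calculus[OF st(2) this]
  show ?thesis by (simp add: Y_def)
qed

lemma sublinear_bound:
  fixes F :: "real^'n \<Rightarrow> real^'n"
  assumes F: "continuous_on UNIV F" and o: "(\<lambda>x. norm (F x)) \<in> o[at_infinity](\<lambda>x. norm x)" and e: "\<epsilon> > 0"
  obtains C where "C \<ge> 0" "\<And>y. norm (F y) \<le> \<epsilon> * norm y + C"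
proof -
  from landau_o.smallD[OF o e] obtain b where b: "\<And>y. b \<le> norm y \<Longrightarrow> norm (F y) \<le> \<epsilon> * norm y"
    by (auto simp: eventually_at_infinity)
  have "compact (F ` cball 0 b)"
    by (intro compact_continuous_image continuous_on_subset[OF F]) auto
  then have "bounded (F ` cball 0 b)" by (rule compact_imp_bounded)
  then obtain C where C: "\<And>y. y \<in> cball 0 b \<Longrightarrow> norm (F y) \<le> C"
    unfolding bounded_iff by blast
  show ?thesis
  proof (rule that[of "max C 0"])
    fix y show "norm (F y) \<le> \<epsilon> * norm y + max C 0"
    proof (cases "b \<le> norm y")
      case False
      then have "norm (F y) \<le> C" by (intro C) auto
      moreover have "0 \<le> \<epsilon> * norm y" using e by simp
      ultimately show ?thesis by linarith
    qed (use b[of y] in linarith)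
  qed simp
qed

context exponentially_stable begin

lemma flow_bound: "0 \<le> t \<Longrightarrow> norm (flow A t *v v) \<le> K * norm v"
proof -
  assume t: "0 \<le> t"
  have "K * exp (- a * t) * norm v \<le> K * 1 * norm v"
    using K a t by (intro mult_right_mono mult_left_mono) auto
  with decay[OF t, of v] show ?thesis by simp
qed

lemma flow_near_identity:
  assumes t: "0 \<le> t"
  shows "norm (flow A t *v v) \<le> (1 + onorm ((*v) A) * K * t) * norm v"
proof -
  have "norm (flow A t *v v - flow A 0 *v v) \<le> onorm ((*v) A) * (K * norm v) * norm (t - 0)"
  proof (rule differentiable_bound[of "{0..t}"])
    fix s assume s: "s \<in> {0..t}"
    have "((\<lambda>t. flow A t *v v) has_vector_derivative - (A ** flow A s) *v v) (at s within {0..t})"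
      by (rule bounded_linear.has_vector_derivative[OF bounded_bilinear.bounded_linear_left[OF bounded_bilinear_matrix_vector_mult] has_vector_derivative_flow])
    then show "((\<lambda>t. flow A t *v v) has_derivative (\<lambda>h. h *\<^sub>R (- (A ** flow A s) *v v))) (at s within {0..t})"
      by (simp add: has_vector_derivative_def)
    have "norm (- (A ** flow A s) *v v) = norm (A *v (flow A s *v v))"
      by (simp add: matrix_vector_mul_assoc bounded_bilinear.minus_left[OF bounded_bilinear_matrix_vector_mult])
    also have "\<dots> \<le> onorm ((*v) A) * norm (flow A s *v v)" by (intro onorm matrix_vector_mul_bounded_linear)
    also have "\<dots> \<le> onorm ((*v) A) * (K * norm v)"
      using s by (intro mult_left_mono flow_bound onorm_pos_le matrix_vector_mul_bounded_linear) auto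
    finally show "onorm (\<lambda>h. h *\<^sub>R (- (A ** flow A s) *v v)) \<le> onorm ((*v) A) * (K * norm v)"
      by (intro onorm_le) (simp add: mult.commute mult_left_mono)
  qed (use t in auto)
  then have "norm (flow A t *v v) \<le> norm v + onorm ((*v) A) * (K * norm v) * t"
    using norm_triangle_sub[of "flow A t *v v" v] t by simp
  then show ?thesis by (simp add: algebra_simps)
qed

text \<open>Over a short step a solution follows the propagator and the noise increment, up to an error
  proportional to the length of the step.\<close>

lemma one_step_error:
  assumes sol: "pathwise_solution F A D w x X" and F: "continuous_on UNIV F"
    and Fb: "\<And>y. norm (F y) \<le> \<epsilon> * norm y + C" and e: "0 \<le> \<epsilon>"
    and st: "0 \<le> s" "s \<le> t" and X: "\<And>r. r \<in> {s..t} \<Longrightarrow> norm (X r) \<le> \<Lambda>"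
    and w: "\<And>r. r \<in> {s..t} \<Longrightarrow> norm (w r - w s) \<le> \<beta>"
  shows "norm (X t - flow A (t - s) *v X s - D *v (w t - w s))
    \<le> K * (\<epsilon> * \<Lambda> + C + onorm ((*v) A) * onorm ((*v) D) * \<beta>) * (t - s)"
proof -
  let ?R = "K * (\<epsilon> * \<Lambda> + C + onorm ((*v) A) * onorm ((*v) D) * \<beta>)"
  have on: "onorm ((*v) M) \<ge> 0" for M :: "real^'n^'n" by (intro onorm_pos_le matrix_vector_mul_bounded_linear)
  have b: "norm (flow A (t - r) *v (F (X r) - A *v (D *v (w r - w s)))) \<le> ?R" if r: "r \<in> {s..t}" for r
  proof -
    have "norm (A *v (D *v (w r - w s))) \<le> onorm ((*v) A) * norm (D *v (w r - w s))"
      by (intro onorm matrix_vector_mul_bounded_linear)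
    also have "\<dots> \<le> onorm ((*v) A) * (onorm ((*v) D) * norm (w r - w s))"
      by (intro mult_left_mono onorm matrix_vector_mul_bounded_linear on)
    also have "\<dots> \<le> onorm ((*v) A) * (onorm ((*v) D) * \<beta>)"
      by (intro mult_left_mono on w r)
    finally have 1: "norm (A *v (D *v (w r - w s))) \<le> onorm ((*v) A) * onorm ((*v) D) * \<beta>" by (simp add: mult.assoc)
    have "\<epsilon> * norm (X r) \<le> \<epsilon> * \<Lambda>" using X[OF r] e by (intro mult_left_mono)
    with Fb[of "X r"] have 2: "norm (F (X r)) \<le> \<epsilon> * \<Lambda> + C" by linarith
    have "norm (flow A (t - r) *v (F (X r) - A *v (D *v (w r - w s)))) \<le> K * norm (F (X r) - A *v (D *v (w r - w s)))"
      using r by (intro flow_bound) auto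
    also have "\<dots> \<le> ?R"
      using K 1 2 norm_triangle_ineq4[of "F (X r)" "A *v (D *v (w r - w s))"] by (intro mult_left_mono) linarith+
    finally show ?thesis .
  qed
  have "0 \<le> ?R" using b[of s] st by (meson atLeastAtMost_iff norm_ge_zero order.refl order.trans)
  from has_integral_bound_real[OF this finite.emptyI variation_of_constants[OF sol F st]] b
  have "norm (X t - D *v (w t - w s) - flow A (t - s) *v X s) \<le> ?R * (t - s)"
    using st by auto
  moreover have "X t - D *v (w t - w s) - flow A (t - s) *v X s = X t - flow A (t - s) *v X s - D *v (w t - w s)"
    by simp
  ultimately show ?thesis by simp
qed

text \<open>The distance between a solution and the discretised stochastic convolution. None of the
  factors in front of \<open>\<epsilon>\<Lambda>\<close> and \<open>\<beta>\<close> depends on the mesh \<open>\<delta>\<close>.\<close>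

lemma discretisation_error:
  assumes sol: "pathwise_solution F A D w x X" and F: "continuous_on UNIV F" and w0: "w 0 = 0"
    and Fb: "\<And>y. norm (F y) \<le> \<epsilon> * norm y + C" and e: "0 \<le> \<epsilon>" and C: "0 \<le> C"
    and \<delta>: "0 < \<delta>" "\<delta> \<le> 1" and t: "real k * \<delta> \<le> t" "t \<le> real (Suc k) * \<delta>"
    and X: "\<And>r. r \<in> {0..t} \<Longrightarrow> norm (X r) \<le> \<Lambda>"
    and w: "\<And>r s. 0 \<le> r \<Longrightarrow> r \<le> s \<Longrightarrow> s \<le> t \<Longrightarrow> s \<le> r + \<delta> \<Longrightarrow> norm (w s - w r) \<le> \<beta>"
  shows "norm (X t - flow A (t - real k * \<delta>) *v noise_sum A D \<delta> w k)
    \<le> K\<^sup>2 * norm x + (K\<^sup>2 * (1 + a) / a + 1) * (K * (\<epsilon> * \<Lambda> + C + onorm ((*v) A) * onorm ((*v) D) * \<beta>)) + onorm ((*v) D) * \<beta>"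
proof -
  define \<rho> where "\<rho> = K * (\<epsilon> * \<Lambda> + C + onorm ((*v) A) * onorm ((*v) D) * \<beta>)"
  define R where "R s u = X u - flow A (u - s) *v X s - D *v (w u - w s)" for s u
  have k0: "0 \<le> real k * \<delta>" using \<delta> by simp
  have t0: "0 \<le> t" using t(1) k0 by linarith
  have on: "onorm ((*v) M) \<ge> 0" for M :: "real^'n^'n" by (intro onorm_pos_le matrix_vector_mul_bounded_linear)
  have \<beta>0: "0 \<le> \<beta>" using w[of 0 0] t0 \<delta> by simp
  have \<Lambda>0: "0 \<le> \<Lambda>" using X[of 0] t0 by (meson atLeastAtMost_iff norm_ge_zero order.refl order.trans)
  have \<rho>0: "0 \<le> \<rho>" unfolding \<rho>_def using K e C \<beta>0 \<Lambda>0 on by simp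
  have R: "norm (R s u) \<le> \<rho> * (u - s)" if "0 \<le> s" "s \<le> u" "u \<le> s + \<delta>" "u \<le> t" for s u
    unfolding R_def \<rho>_def
    by (rule one_step_error[OF sol F Fb e that(1,2)]) (use that in \<open>auto intro!: X w\<close>)
  have X0: "X 0 = x" using sol w0 by (simp add: pathwise_solution_def)
  have expand: "X (real i * \<delta>) = flow A (real i * \<delta>) *v x + noise_sum A D \<delta> w i
      + (\<Sum>j<i. flow A (real (i - Suc j) * \<delta>) *v R (real j * \<delta>) (real (Suc j) * \<delta>))" for i
  proof (induction i)
    case 0 show ?case by (simp add: X0 noise_sum_def)
  next
    case (Suc i)
    have d: "real (Suc i) * \<delta> - real i * \<delta> = \<delta>" by (simp add: algebra_simps)
    have s: "real (Suc i) * \<delta> = \<delta> + real i * \<delta>" by (simp add: algebra_simps)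
    have "X (real (Suc i) * \<delta>) = flow A \<delta> *v X (real i * \<delta>) + D *v (w (real (Suc i) * \<delta>) - w (real i * \<delta>))
        + R (real i * \<delta>) (real (Suc i) * \<delta>)"
      unfolding R_def d by simp
    also have "flow A \<delta> *v X (real i * \<delta>) = flow A (real (Suc i) * \<delta>) *v x + flow A \<delta> *v noise_sum A D \<delta> w i
       + flow A \<delta> *v (\<Sum>j<i. flow A (real (i - Suc j) * \<delta>) *v R (real j * \<delta>) (real (Suc j) * \<delta>))"
      unfolding s flow_add Suc.IH by (simp add: matrix_vector_right_distrib matrix_vector_mul_assoc)
    finally show ?case unfolding noise_sum_Suc discrete_duhamel by (simp add: add_ac)
  qed
  have grid: "norm (X (real k * \<delta>) - noise_sum A D \<delta> w k) \<le> K * norm x + K * \<rho> * (1 + a) / a"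
  proof -
    have "norm (\<Sum>j<k. flow A (real (k - Suc j) * \<delta>) *v R (real j * \<delta>) (real (Suc j) * \<delta>))
        \<le> (\<Sum>j<k. K * exp (- a * (real (k - Suc j) * \<delta>)) * (\<rho> * \<delta>))"
    proof (rule sum_norm_le)
      fix j assume j: "j \<in> {..<k}"
      have "real (Suc j) * \<delta> \<le> real k * \<delta>" using j \<delta> by (intro mult_right_mono) auto
      then have "norm (R (real j * \<delta>) (real (Suc j) * \<delta>)) \<le> \<rho> * (real (Suc j) * \<delta> - real j * \<delta>)"
        using \<delta> t(1) by (intro R) (auto simp: algebra_simps)
      then have "norm (R (real j * \<delta>) (real (Suc j) * \<delta>)) \<le> \<rho> * \<delta>" by (simp add: algebra_simps)
      then have "K * exp (- a * (real (k - Suc j) * \<delta>)) * norm (R (real j * \<delta>) (real (Suc j) * \<delta>))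
        \<le> K * exp (- a * (real (k - Suc j) * \<delta>)) * (\<rho> * \<delta>)" using K by (intro mult_left_mono) auto
      with decay[of "real (k - Suc j) * \<delta>"] \<delta>
      show "norm (flow A (real (k - Suc j) * \<delta>) *v R (real j * \<delta>) (real (Suc j) * \<delta>))
        \<le> K * exp (- a * (real (k - Suc j) * \<delta>)) * (\<rho> * \<delta>)" by (meson less_imp_le mult_nonneg_nonneg of_nat_0_le_iff order.trans)
    qed
    also have "\<dots> = (\<Sum>j<k. K * exp (- a * (real j * \<delta>)) * (\<rho> * \<delta>))"
      by (rule sum.nat_diff_reindex)
    also have "\<dots> = K * \<rho> * \<delta> * (\<Sum>j<k. exp (- a * (real j * \<delta>)))"
      by (simp add: sum_distrib_left mult_ac)
    also have "\<dots> \<le> K * \<rho> * \<delta> * ((1 + a * \<delta>) / (a * \<delta>))"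
      using sum_exp_le[OF \<delta>(1) a] K \<rho>0 \<delta> by (intro mult_left_mono) auto
    also have "\<dots> = K * \<rho> * (1 + a * \<delta>) / a" using \<delta> a by simp
    also have "\<dots> \<le> K * \<rho> * (1 + a) / a" using \<delta> a K \<rho>0 by (intro divide_right_mono mult_left_mono) auto
    finally have 1: "norm (\<Sum>j<k. flow A (real (k - Suc j) * \<delta>) *v R (real j * \<delta>) (real (Suc j) * \<delta>)) \<le> K * \<rho> * (1 + a) / a" .
    have 2: "norm (flow A (real k * \<delta>) *v x) \<le> K * norm x" by (rule flow_bound[OF k0])
    have "X (real k * \<delta>) - noise_sum A D \<delta> w k = flow A (real k * \<delta>) *v x
      + (\<Sum>j<k. flow A (real (k - Suc j) * \<delta>) *v R (real j * \<delta>) (real (Suc j) * \<delta>))"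
      using expand[of k] by (simp only: add_diff_cancel_left' add.assoc add.left_commute[of _ "noise_sum A D \<delta> w k"])
    then show ?thesis using norm_triangle_mono[OF 2 1] by (simp only:)
  qed
  have u: "0 \<le> t - real k * \<delta>" "t - real k * \<delta> \<le> \<delta>" using t by (auto simp: algebra_simps)
  have "X t - flow A (t - real k * \<delta>) *v noise_sum A D \<delta> w k
    = flow A (t - real k * \<delta>) *v (X (real k * \<delta>) - noise_sum A D \<delta> w k) + R (real k * \<delta>) t + D *v (w t - w (real k * \<delta>))"
    by (simp add: R_def matrix_vector_mult_diff_distrib)
  also have "norm \<dots> \<le> K * (K * norm x + K * \<rho> * (1 + a) / a) + \<rho> * 1 + onorm ((*v) D) * \<beta>"
  proof (rule norm_triangle_mono[OF norm_triangle_mono])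
    have "K * norm (X (real k * \<delta>) - noise_sum A D \<delta> w k) \<le> K * (K * norm x + K * \<rho> * (1 + a) / a)"
      using K grid by (intro mult_left_mono) auto
    with flow_bound[OF u(1)]
    show "norm (flow A (t - real k * \<delta>) *v (X (real k * \<delta>) - noise_sum A D \<delta> w k)) \<le> K * (K * norm x + K * \<rho> * (1 + a) / a)"
      by (rule order.trans)
    have "norm (R (real k * \<delta>) t) \<le> \<rho> * (t - real k * \<delta>)" using u k0 by (intro R) auto
    also have "\<dots> \<le> \<rho> * 1" using u \<delta> \<rho>0 by (intro mult_left_mono) auto
    finally show "norm (R (real k * \<delta>) t) \<le> \<rho> * 1" .
    have "norm (D *v (w t - w (real k * \<delta>))) \<le> onorm ((*v) D) * norm (w t - w (real k * \<delta>))"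
      by (intro onorm matrix_vector_mul_bounded_linear)
    also have "\<dots> \<le> onorm ((*v) D) * \<beta>" using u k0 by (intro mult_left_mono on w) auto
    finally show "norm (D *v (w t - w (real k * \<delta>))) \<le> onorm ((*v) D) * \<beta>" .
  qed
  also have "\<dots> = K\<^sup>2 * norm x + (K\<^sup>2 * (1 + a) / a + 1) * \<rho> + onorm ((*v) D) * \<beta>"
    by (simp add: power2_eq_square algebra_simps)
  finally show ?thesis by (simp add: \<rho>_def)
qed

text \<open>Twice a bound for the factor by which the path oscillation over one cell is amplified in the
  distance between the solution and the discretised stochastic convolution; the factor 2 reserves
  half of the permitted error for the contribution of \<open>F\<close>.\<close>

definition noise_gain :: "real^'n^'n \<Rightarrow> real" where
  "noise_gain D = 2 * ((K\<^sup>2 * (1 + a) / a + 1) * K * (onorm ((*v) A) * onorm ((*v) D)) + onorm ((*v) D) + 1)"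

lemma noise_gain_pos: "noise_gain D > 0"
proof -
  have on: "onorm ((*v) M) \<ge> 0" for M :: "real^'n^'n" by (intro onorm_pos_le matrix_vector_mul_bounded_linear)
  have "K\<^sup>2 * (1 + a) / a + 1 > 0" using K a by (auto intro!: add_nonneg_pos divide_nonneg_pos)
  then show ?thesis unfolding noise_gain_def using K on[of A] on[of D] by (intro mult_pos_pos add_nonneg_pos) auto
qed

text \<open>The bound holds for every solution along the path \<open>w\<close>, whatever its initial value; only the
  additive constant depends on the solution.\<close>

lemma solution_near_noise_sum:
  assumes \<kappa>: "0 < \<kappa>" and \<delta>: "0 < \<delta>" "\<delta> \<le> 1" and \<eta>: "0 < \<eta>" "noise_gain D * \<eta> \<le> \<kappa>"
    and sol: "pathwise_solution F A D w x X"
    and F: "continuous_on UNIV F" "(\<lambda>x. norm (F x)) \<in> o[at_infinity](\<lambda>x. norm x)" and w0: "w 0 = 0"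
    and w: "\<And>s t. 0 \<le> s \<Longrightarrow> s \<le> t \<Longrightarrow> t \<le> s + \<delta> \<Longrightarrow> norm (w t - w s) \<le> \<eta> * ell t + B"
    and Z: "\<And>k. norm (noise_sum A D \<delta> w k) \<le> \<gamma> * ell (real k * \<delta>) + B'"
  shows "\<exists>B2\<ge>0. \<forall>t k. real k * \<delta> \<le> t \<longrightarrow> t \<le> real (Suc k) * \<delta> \<longrightarrow>
        norm (X t - flow A (t - real k * \<delta>) *v noise_sum A D \<delta> w k) \<le> \<kappa> * ell t + B2"
proof -
  define c1 where "c1 = K\<^sup>2 * (1 + a) / a + 1"
  define d where "d = onorm ((*v) A) * onorm ((*v) D)"
  define c2 where "c2 = c1 * K"
  define c3 where "c3 = c1 * K * d + onorm ((*v) D) + 1"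
  have c1: "c1 > 0" using K a by (auto simp: c1_def intro!: add_nonneg_pos divide_nonneg_pos)
  have c2: "c2 > 0" using c1 K by (simp add: c2_def)
  have gain: "noise_gain D = 2 * c3" by (simp add: noise_gain_def c3_def c1_def d_def)
  have c3: "c3 > 0" using noise_gain_pos[of D] unfolding gain by simp
  have c3\<eta>: "2 * c3 * \<eta> \<le> \<kappa>" using \<eta>(2) unfolding gain .
  have err: "norm (X t - flow A (t - real k * \<delta>) *v noise_sum A D \<delta> w k)
      \<le> K\<^sup>2 * norm x + c2 * (\<epsilon> * \<Lambda> + C) + c3 * (\<eta> * ell t + \<bar>B\<bar>)"
    if "\<And>y. norm (F y) \<le> \<epsilon> * norm y + C" "0 \<le> \<epsilon>" "0 \<le> C" "real k * \<delta> \<le> t" "t \<le> real (Suc k) * \<delta>"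
      "\<And>r. r \<in> {0..t} \<Longrightarrow> norm (X r) \<le> \<Lambda>" for \<epsilon> C t k \<Lambda>
  proof -
    have t0: "0 \<le> t" using that(4) \<delta> by (meson less_imp_le mult_nonneg_nonneg of_nat_0_le_iff order.trans)
    have \<beta>: "0 \<le> \<eta> * ell t + \<bar>B\<bar>" using \<eta> ell_nonneg[OF t0] by simp
    have "norm (X t - flow A (t - real k * \<delta>) *v noise_sum A D \<delta> w k)
      \<le> K\<^sup>2 * norm x + (K\<^sup>2 * (1 + a) / a + 1) * (K * (\<epsilon> * \<Lambda> + C + onorm ((*v) A) * onorm ((*v) D) * (\<eta> * ell t + \<bar>B\<bar>))) + onorm ((*v) D) * (\<eta> * ell t + \<bar>B\<bar>)"
    proof (rule discretisation_error[OF sol F(1) w0 that(1-3) \<delta> that(4-6)])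
      fix r s assume rs: "0 \<le> r" "r \<le> s" "s \<le> t" "s \<le> r + \<delta>"
      have "\<eta> * ell s \<le> \<eta> * ell t" using rs \<eta> by (intro mult_left_mono ell_mono) auto
      with w[OF rs(1,2,4)] show "norm (w s - w r) \<le> \<eta> * ell t + \<bar>B\<bar>" by linarith
    qed
    also have "\<dots> = K\<^sup>2 * norm x + c2 * (\<epsilon> * \<Lambda> + C) + (c3 - 1) * (\<eta> * ell t + \<bar>B\<bar>)"
      unfolding c1_def[symmetric] d_def[symmetric] c2_def c3_def by (simp add: algebra_simps)
    also have "\<dots> \<le> K\<^sup>2 * norm x + c2 * (\<epsilon> * \<Lambda> + C) + c3 * (\<eta> * ell t + \<bar>B\<bar>)"
      using \<beta> by (intro add_left_mono mult_right_mono) auto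
    finally show ?thesis .
  qed
  \<comment> \<open>A priori growth of \<open>X\<close>: with \<open>\<epsilon> = 1/(2 c2)\<close> half of the running maximum of \<open>|X|\<close>
    appears on the right-hand side and can be absorbed.\<close>
  obtain C where C: "C \<ge> 0" "\<And>y. norm (F y) \<le> 1 / (2 * c2) * norm y + C"
    using sublinear_bound[OF F, of "1 / (2 * c2)"] c2 by auto
  define g1 where "g1 = 2 * (K * \<bar>\<gamma>\<bar> + c3 * \<eta>)"
  define b1 where "b1 = 2 * (K * \<bar>B'\<bar> + K\<^sup>2 * norm x + c2 * C + c3 * \<bar>B\<bar>)"
  have g1: "g1 \<ge> 0" using K c3 \<eta> by (simp add: g1_def)
  have b1: "b1 \<ge> 0" using K c3 c2 C by (simp add: b1_def)
  have grow: "norm (X T) \<le> g1 * ell T + b1" if T: "0 \<le> T" for T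
  proof -
    have Xc: "continuous_on {0..T} (\<lambda>r. norm (X r))"
      using sol by (auto simp: pathwise_solution_def intro!: continuous_intros elim: continuous_on_subset)
    obtain u where u: "u \<in> {0..T}" "\<And>r. r \<in> {0..T} \<Longrightarrow> norm (X r) \<le> norm (X u)"
      using continuous_attains_sup[OF _ _ Xc] T by auto
    define k where "k = nat \<lfloor>u / \<delta>\<rfloor>"
    have k: "real k * \<delta> \<le> u" "u \<le> real (Suc k) * \<delta>"
    proof -
      have "0 \<le> u / \<delta>" using u \<delta> by simp
      then have "real k \<le> u / \<delta>" "u / \<delta> \<le> real k + 1" unfolding k_def by (auto simp: of_nat_floor)
      then show "real k * \<delta> \<le> u" "u \<le> real (Suc k) * \<delta>" using \<delta> by (auto simp: field_simps)
    qed
    have "norm (X u - flow A (u - real k * \<delta>) *v noise_sum A D \<delta> w k)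
       \<le> K\<^sup>2 * norm x + c2 * (1 / (2 * c2) * norm (X u) + C) + c3 * (\<eta> * ell u + \<bar>B\<bar>)"
      using C c2 u k by (intro err) auto
    moreover have "c2 * (1 / (2 * c2) * norm (X u) + C) = norm (X u) / 2 + c2 * C" using c2 by (simp add: field_simps)
    moreover have "norm (flow A (u - real k * \<delta>) *v noise_sum A D \<delta> w k) \<le> K * (\<bar>\<gamma>\<bar> * ell u + \<bar>B'\<bar>)"
    proof -
      have e: "0 \<le> ell (real k * \<delta>)" "ell (real k * \<delta>) \<le> ell u" using \<delta> k by (auto intro!: ell_nonneg ell_mono)
      have "norm (noise_sum A D \<delta> w k) \<le> \<bar>\<gamma>\<bar> * ell (real k * \<delta>) + \<bar>B'\<bar>"
        using Z[of k] e mult_right_mono[OF abs_ge_self[of \<gamma>] e(1)] by linarith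
      also have "\<dots> \<le> \<bar>\<gamma>\<bar> * ell u + \<bar>B'\<bar>" using e by (intro add_mono mult_left_mono) auto
      finally have "K * norm (noise_sum A D \<delta> w k) \<le> K * (\<bar>\<gamma>\<bar> * ell u + \<bar>B'\<bar>)"
        using K by (intro mult_left_mono) auto
      moreover have "norm (flow A (u - real k * \<delta>) *v noise_sum A D \<delta> w k) \<le> K * norm (noise_sum A D \<delta> w k)"
        using k by (intro flow_bound) simp
      ultimately show ?thesis by linarith
    qed
    moreover have "norm (X u) \<le> norm (X u - flow A (u - real k * \<delta>) *v noise_sum A D \<delta> w k) + norm (flow A (u - real k * \<delta>) *v noise_sum A D \<delta> w k)"
      by (metis add.commute norm_triangle_sub)
    ultimately have "norm (X u) \<le> K * (\<bar>\<gamma>\<bar> * ell u + \<bar>B'\<bar>) + (K\<^sup>2 * norm x + (norm (X u) / 2 + c2 * C) + c3 * (\<eta> * ell u + \<bar>B\<bar>))"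
      by linarith
    then have "norm (X u) \<le> g1 * ell u + b1" by (simp add: g1_def b1_def algebra_simps)
    also have "\<dots> \<le> g1 * ell T + b1" using u g1 by (intro add_mono mult_left_mono ell_mono) auto
    finally show ?thesis using u(2)[of T] T by simp
  qed
  \<comment> \<open>Now that the growth of \<open>X\<close> is known, a second pass with small \<open>\<epsilon>\<close> makes the contribution of
    \<open>F\<close> small.\<close>
  define \<epsilon> where "\<epsilon> = \<kappa> / (2 * c2 * (g1 + 1))"
  have \<epsilon>: "\<epsilon> > 0" using \<kappa> c2 g1 by (simp add: \<epsilon>_def)
  obtain C' where C': "C' \<ge> 0" "\<And>y. norm (F y) \<le> \<epsilon> * norm y + C'"
    using sublinear_bound[OF F \<epsilon>] by auto
  define B2 where "B2 = K\<^sup>2 * norm x + c2 * (\<epsilon> * b1 + C') + c3 * \<bar>B\<bar>"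
  have "norm (X t - flow A (t - real k * \<delta>) *v noise_sum A D \<delta> w k) \<le> \<kappa> * ell t + B2"
    if t: "real k * \<delta> \<le> t" "t \<le> real (Suc k) * \<delta>" for t k
  proof -
    have t0: "0 \<le> t" using t(1) \<delta> by (meson less_imp_le mult_nonneg_nonneg of_nat_0_le_iff order.trans)
    have "norm (X r) \<le> g1 * ell t + b1" if "r \<in> {0..t}" for r
    proof -
      have "g1 * ell r \<le> g1 * ell t" using that g1 by (intro mult_left_mono ell_mono) auto
      with grow[of r] that show ?thesis by auto
    qed
    then have "norm (X t - flow A (t - real k * \<delta>) *v noise_sum A D \<delta> w k)
       \<le> K\<^sup>2 * norm x + c2 * (\<epsilon> * (g1 * ell t + b1) + C') + c3 * (\<eta> * ell t + \<bar>B\<bar>)"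
      using C' \<epsilon> t by (intro err) auto
    also have "\<dots> = (c2 * \<epsilon> * g1 + c3 * \<eta>) * ell t + B2" by (simp add: B2_def algebra_simps)
    also have "\<dots> \<le> \<kappa> * ell t + B2"
    proof -
      have "c2 * \<epsilon> = \<kappa> / 2 / (g1 + 1)" using c2 by (simp add: \<epsilon>_def)
      then have "c2 * \<epsilon> * g1 = \<kappa> / 2 * (g1 / (g1 + 1))" by simp
      also have "\<dots> \<le> \<kappa> / 2 * 1" using \<kappa> g1 by (intro mult_left_mono) auto
      finally have "c2 * \<epsilon> * g1 + c3 * \<eta> \<le> \<kappa>" using c3\<eta> by simp
      then show ?thesis using ell_nonneg[OF t0] by (intro add_mono mult_right_mono) auto
    qed
    finally show ?thesis .
  qed
  moreover have "B2 \<ge> 0" using K c2 c3 \<epsilon> b1 C' by (simp add: B2_def)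
  ultimately show ?thesis by blast
qed

end

section \<open>Growth of the discretised stochastic convolution\<close>

text \<open>Finitely many unit vectors detect the norm up to the factor \<open>q < 1\<close>.\<close>

lemma finite_direction_net:
  assumes q: "q < 1"
  obtains T :: "(real^'n) set" where "finite T" "\<And>\<theta>. \<theta> \<in> T \<Longrightarrow> norm \<theta> = 1" "\<And>x. \<exists>\<theta>\<in>T. q * norm x \<le> \<theta> \<bullet> x"
proof -
  have "compact (sphere (0::real^'n) 1)" by simp
  moreover have "sphere (0::real^'n) 1 \<subseteq> (\<Union>\<theta>\<in>sphere 0 1. ball \<theta> (1 - q))" using q by force
  ultimately obtain T where T: "T \<subseteq> sphere 0 1" "finite T" "sphere (0::real^'n) 1 \<subseteq> (\<Union>\<theta>\<in>T. ball \<theta> (1 - q))"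
    using compactE_image[of "sphere (0::real^'n) 1" "sphere 0 1" "\<lambda>\<theta>. ball \<theta> (1 - q)"] by (metis open_ball)
  have "\<exists>\<theta>\<in>T. q * norm x \<le> \<theta> \<bullet> x" for x
  proof (cases "x = 0")
    case True
    have "sphere (0::real^'n) 1 \<noteq> {}" using sphere_eq_empty[of "0::real^'n" 1] by auto
    with T(3) have "T \<noteq> {}" by auto
    with True show ?thesis by auto
  next
    case False
    define y where "y = inverse (norm x) *\<^sub>R x"
    have y: "norm y = 1" "x = norm x *\<^sub>R y" using False by (auto simp: y_def)
    then have "y \<in> sphere 0 1" by simp
    with T(3) obtain \<theta> where th: "\<theta> \<in> T" "dist \<theta> y < 1 - q" by auto
    have "(y - \<theta>) \<bullet> y \<le> norm (y - \<theta>) * norm y" by (rule norm_cauchy_schwarz)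
    also have "\<dots> \<le> 1 - q" using th y by (simp add: dist_norm norm_minus_commute)
    finally have "q \<le> \<theta> \<bullet> y" using y by (simp add: inner_diff_left norm_eq_1)
    then have "norm x * q \<le> norm x * (\<theta> \<bullet> y)" by (intro mult_left_mono) auto
    also have "\<dots> = \<theta> \<bullet> x" by (subst (2) y(2)) simp
    finally show ?thesis using th by (auto simp: mult.commute)
  qed
  with T show ?thesis by (intro that[of T]) auto
qed

lemma noise_sum_add:
  "noise_sum A D \<delta> w (m + L) = flow A (real L * \<delta>) *v noise_sum A D \<delta> w m
    + (\<Sum>j\<in>{m..<m+L}. flow A (real (m + L - Suc j) * \<delta>) *v (D *v (w (real (Suc j) * \<delta>) - w (real j * \<delta>))))"
proof -
  let ?f = "\<lambda>j. flow A (real (m + L - Suc j) * \<delta>) *v (D *v (w (real (Suc j) * \<delta>) - w (real j * \<delta>)))"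
  have "noise_sum A D \<delta> w (m + L) = (\<Sum>j<m. ?f j) + (\<Sum>j\<in>{m..<m+L}. ?f j)"
    unfolding noise_sum_def
    by (subst sum.union_disjoint[symmetric]) (auto intro!: sum.cong)
  also have "(\<Sum>j<m. ?f j) = flow A (real L * \<delta>) *v noise_sum A D \<delta> w m"
    unfolding noise_sum_def bounded_bilinear.sum_right[OF bounded_bilinear_matrix_vector_mult]
  proof (rule sum.cong)
    fix j assume "j \<in> {..<m}"
    then have "real (m + L - Suc j) * \<delta> = real L * \<delta> + real (m - Suc j) * \<delta>"
      by (simp add: of_nat_diff algebra_simps)
    then show "?f j = flow A (real L * \<delta>) *v (flow A (real (m - Suc j) * \<delta>) *v (D *v (w (real (Suc j) * \<delta>) - w (real j * \<delta>))))"
      by (simp add: flow_add matrix_vector_mul_assoc matrix_mul_assoc)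
  qed simp
  finally show ?thesis .
qed

text \<open>A stable drift together with Brownian noise that enters through the matrix \<open>D\<close>.\<close>

locale stable_noise = exponentially_stable A K a + brownian_motion M W
  for A :: "real^'n^'n" and K a :: real and M :: "'w measure" and W :: "real \<Rightarrow> 'w \<Rightarrow> real^'n" +
  fixes D :: "real^'n^'n"
begin

text \<open>The discretised stochastic convolution along the Brownian path.\<close>

abbreviation Z :: "real \<Rightarrow> 'w \<Rightarrow> nat \<Rightarrow> real^'n" where
  "Z \<delta> \<omega> \<equiv> noise_sum A D \<delta> (\<lambda>t. W t \<omega>)"

lemma response_inner: "response D \<theta> s \<bullet> y = \<theta> \<bullet> (flow A s *v (D *v y))"
  by (simp add: response_def inner_transpose_mult)

lemma Z_inner: "\<theta> \<bullet> Z \<delta> \<omega> k = (\<Sum>j<k. response D \<theta> (real (k - Suc j) * \<delta>) \<bullet> incr \<delta> j \<omega>)"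
  by (simp add: noise_sum_def inner_sum_right response_inner incr_def)

lemma Z_tail:
  assumes \<delta>: "0 < \<delta>" and V: "V > 0" "\<delta> * (\<Sum>j<k. (norm (response D \<theta> (real j * \<delta>)))\<^sup>2) \<le> V" and r: "r > 0"
  shows "prob {\<omega>\<in>space M. r \<le> \<theta> \<bullet> Z \<delta> \<omega> k} \<le> exp (- r\<^sup>2 / (2 * V))"
  unfolding Z_inner
proof (rule incr_sum_tail_upper[OF \<delta> _ _ V(1) r])
  have "(\<Sum>j<k. (norm (response D \<theta> (real (k - Suc j) * \<delta>)))\<^sup>2) = (\<Sum>j<k. (norm (response D \<theta> (real j * \<delta>)))\<^sup>2)"
    by (rule sum.nat_diff_reindex)
  with V show "\<delta> * (\<Sum>j<k. (norm (response D \<theta> (real (k - Suc j) * \<delta>)))\<^sup>2) \<le> V" by simp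
qed simp

lemma Z_measurable: "\<delta> \<ge> 0 \<Longrightarrow> (\<lambda>\<omega>. \<theta> \<bullet> Z \<delta> \<omega> k) \<in> borel_measurable M"
  unfolding Z_inner by (intro borel_measurable_sum borel_measurable_inner incr_measurable) auto

text \<open>A bound \<open>V\<close> on the variance in every unit direction gives every growth rate above
  \<open>sqrt(2V)\<close>.\<close>

lemma Z_growth_upper:
  assumes \<delta>: "0 < \<delta>" "\<delta> \<le> 1" and V: "V > 0"
    and var: "\<And>k \<theta>. \<delta> * (\<Sum>j<(k::nat). (norm (response D \<theta> (real j * \<delta>)))\<^sup>2) \<le> V * (norm \<theta>)\<^sup>2"
    and \<gamma>: "\<gamma> > sqrt (2 * V)"
  shows "AE \<omega> in M. \<exists>B\<ge>0. \<forall>k. norm (Z \<delta> \<omega> k) \<le> \<gamma> * ell (real k * \<delta>) + B"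
proof -
  obtain g where g: "sqrt (2 * V) < g" "g < \<gamma>" using \<gamma> dense by blast
  have sV: "sqrt (2 * V) > 0" using V by simp
  have g0: "g > 0" using g sV by linarith
  have p: "g\<^sup>2 / (2 * V) > 1"
  proof -
    have "(sqrt (2 * V))\<^sup>2 < g\<^sup>2" using g sV by (intro power_strict_mono) auto
    with V show ?thesis by simp
  qed
  define p where "p = g\<^sup>2 / (2 * V)"
  have q: "g / \<gamma> < 1" using g g0 by simp
  obtain T :: "(real^'n) set" where T: "finite T" "\<And>\<theta>. \<theta> \<in> T \<Longrightarrow> norm \<theta> = 1" "\<And>x. \<exists>\<theta>\<in>T. g / \<gamma> * norm x \<le> \<theta> \<bullet> x"
    using finite_direction_net[OF q] by blast
  have e0: "ell (real k * \<delta>) > 0" for k using ell_ge_1[of "real k * \<delta>"] \<delta> by simp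
  have "AE \<omega> in M. \<forall>\<^sub>F k in sequentially. \<theta> \<bullet> Z \<delta> \<omega> k < g * ell (real k * \<delta>)" if th: "\<theta> \<in> T" for \<theta>
  proof -
    have "AE \<omega> in M. \<forall>\<^sub>F k in sequentially. \<omega> \<in> space M - {\<omega>\<in>space M. g * ell (real k * \<delta>) \<le> \<theta> \<bullet> Z \<delta> \<omega> k}"
    proof (rule borel_cantelli_AE1)
      show "{\<omega>\<in>space M. g * ell (real k * \<delta>) \<le> \<theta> \<bullet> Z \<delta> \<omega> k} \<in> events" for k
        using Z_measurable[OF less_imp_le[OF \<delta>(1)], of \<theta> k] by measurable
      show "summable (\<lambda>k. prob {\<omega>\<in>space M. g * ell (real k * \<delta>) \<le> \<theta> \<bullet> Z \<delta> \<omega> k})"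
      proof (rule summable_comparison_test)
        have "summable (\<lambda>k. real k powr (- p))"
          using p by (simp add: summable_real_powr_iff p_def)
        then show "summable (\<lambda>k. \<delta> powr (- p) * real (Suc k) powr (- p))"
          by (intro summable_mult) (subst summable_Suc_iff)
        have "norm (prob {\<omega>\<in>space M. g * ell (real k * \<delta>) \<le> \<theta> \<bullet> Z \<delta> \<omega> k}) \<le> \<delta> powr (- p) * real (Suc k) powr (- p)" for k
        proof -
          have x0: "0 \<le> real k * \<delta>" using \<delta> by simp
          have "prob {\<omega>\<in>space M. g * ell (real k * \<delta>) \<le> \<theta> \<bullet> Z \<delta> \<omega> k} \<le> exp (- (g * ell (real k * \<delta>))\<^sup>2 / (2 * V))"
            using var[of \<theta> k] T(2)[OF th] g0 e0[of k] by (intro Z_tail \<delta> V) auto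
          also have "- (g * ell (real k * \<delta>))\<^sup>2 / (2 * V) = - p * ln (real k * \<delta> + 3)"
            using ell_square[OF x0] by (simp add: p_def power_mult_distrib)
          also have "exp (- p * ln (real k * \<delta> + 3)) = (real k * \<delta> + 3) powr (- p)"
            using x0 by (simp add: powr_def)
          also have "\<dots> \<le> (\<delta> * real (Suc k)) powr (- p)"
          proof (rule powr_mono2')
            show "\<delta> * real (Suc k) \<le> real k * \<delta> + 3" using \<delta> by (simp add: algebra_simps)
          qed (use p \<delta> in \<open>auto simp: p_def\<close>)
          also have "\<dots> = \<delta> powr (- p) * real (Suc k) powr (- p)" using \<delta> by (simp add: powr_mult)
          finally show ?thesis by simp
        qed
        then show "\<exists>N. \<forall>k\<ge>N. norm (prob {\<omega>\<in>space M. g * ell (real k * \<delta>) \<le> \<theta> \<bullet> Z \<delta> \<omega> k}) \<le> \<delta> powr (- p) * real (Suc k) powr (- p)" by blast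
      qed
    qed (simp add: emeasure_eq_measure)
    then show ?thesis by (rule AE_mp) (auto intro!: AE_I2 elim!: eventually_mono simp: not_le)
  qed
  then have "AE \<omega> in M. \<forall>\<theta>\<in>T. \<forall>\<^sub>F k in sequentially. \<theta> \<bullet> Z \<delta> \<omega> k < g * ell (real k * \<delta>)"
    using T(1) by (subst AE_ball_countable) (auto intro: countable_finite)
  then show ?thesis
  proof (rule AE_mp, intro AE_I2 impI)
    fix \<omega> assume "\<forall>\<theta>\<in>T. \<forall>\<^sub>F k in sequentially. \<theta> \<bullet> Z \<delta> \<omega> k < g * ell (real k * \<delta>)"
    then have "\<forall>\<^sub>F k in sequentially. \<forall>\<theta>\<in>T. \<theta> \<bullet> Z \<delta> \<omega> k < g * ell (real k * \<delta>)"
      using T(1) by (subst eventually_ball_finite_distrib) auto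
    then obtain N where N: "\<And>k \<theta>. k \<ge> N \<Longrightarrow> \<theta> \<in> T \<Longrightarrow> \<theta> \<bullet> Z \<delta> \<omega> k < g * ell (real k * \<delta>)"
      by (auto simp: eventually_sequentially)
    define B where "B = (\<Sum>k<N. norm (Z \<delta> \<omega> k))"
    have "norm (Z \<delta> \<omega> k) \<le> \<gamma> * ell (real k * \<delta>) + B" for k
    proof (cases "k < N")
      case True
      then have "norm (Z \<delta> \<omega> k) \<le> B" unfolding B_def by (intro member_le_sum) auto
      moreover have "0 \<le> \<gamma> * ell (real k * \<delta>)" using g g0 e0[of k] by simp
      ultimately show ?thesis by linarith
    next
      case False
      obtain \<theta> where th: "\<theta> \<in> T" "g / \<gamma> * norm (Z \<delta> \<omega> k) \<le> \<theta> \<bullet> Z \<delta> \<omega> k" using T(3) by blast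
      then have "g / \<gamma> * norm (Z \<delta> \<omega> k) \<le> g * ell (real k * \<delta>)" using N[of k \<theta>] False by simp
      then have "g * norm (Z \<delta> \<omega> k) \<le> g * (\<gamma> * ell (real k * \<delta>))" using g g0 by (simp add: field_simps)
      then have "norm (Z \<delta> \<omega> k) \<le> \<gamma> * ell (real k * \<delta>)" using g0 by simp
      moreover have "B \<ge> 0" unfolding B_def by (intro sum_nonneg) auto
      ultimately show ?thesis by linarith
    qed
    then show "\<exists>B\<ge>0. \<forall>k. norm (Z \<delta> \<omega> k) \<le> \<gamma> * ell (real k * \<delta>) + B"
      by (intro exI[of _ B]) (auto simp: B_def intro: sum_nonneg)
  qed
qed

text \<open>The part of \<open>\<theta> \<bullet> Z\<close> at time \<open>(n+1)L\<delta>\<close> that is due to the increments in block \<open>n\<close> of \<open>L\<close>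
  consecutive cells.\<close>

definition block :: "real \<Rightarrow> real^'n \<Rightarrow> nat \<Rightarrow> nat \<Rightarrow> 'w \<Rightarrow> real" where
  "block \<delta> \<theta> L n \<omega> = (\<Sum>j\<in>{n*L..<n*L+L}. response D \<theta> (real (n*L + L - Suc j) * \<delta>) \<bullet> incr \<delta> j \<omega>)"

lemma block_measurable: "\<delta> \<ge> 0 \<Longrightarrow> block \<delta> \<theta> L n \<in> borel_measurable M"
  unfolding block_def[abs_def] by (intro borel_measurable_sum borel_measurable_inner incr_measurable) auto

lemma Z_block: "\<theta> \<bullet> Z \<delta> \<omega> (n*L + L) = \<theta> \<bullet> (flow A (real L * \<delta>) *v Z \<delta> \<omega> (n*L)) + block \<delta> \<theta> L n \<omega>"
  by (simp add: noise_sum_add block_def inner_add_right inner_sum_right response_inner incr_def)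

lemma block_indep:
  assumes \<delta>: "\<delta> \<ge> 0"
  shows "indep_vars (\<lambda>_. borel) (block \<delta> \<theta> L) {..<N}"
proof -
  let ?K = "\<lambda>n. {n*L..<n*L+L}"
  have "indep_vars (\<lambda>n. PiM (?K n) (\<lambda>_. borel)) (\<lambda>n \<omega>. restrict (\<lambda>j. incr \<delta> j \<omega>) (?K n)) {..<N}"
  proof (rule indep_vars_restrict[OF incr_indep[OF \<delta>]])
    fix n assume "n \<in> {..<N}"
    then have "Suc n * L \<le> N * L" by (intro mult_le_mono1) auto
    then show "?K n \<subseteq> {..<N*L}" by auto
  next
    show "disjoint_family_on ?K {..<N}"
      unfolding disjoint_family_on_def
    proof (intro ballI impI)
      have disj: "?K m \<inter> ?K n = {}" if "m < n" for m n
      proof -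
        have "Suc m * L \<le> n * L" using that by (intro mult_le_mono1) auto
        then show ?thesis by auto
      qed
      fix m n :: nat assume "m \<noteq> n"
      then show "?K m \<inter> ?K n = {}" using disj[of m n] disj[of n m] by (cases "m < n") auto
    qed
  qed
  then have "indep_vars (\<lambda>_. borel) (\<lambda>n \<omega>. (\<lambda>f. \<Sum>j\<in>?K n. response D \<theta> (real (n*L + L - Suc j) * \<delta>) \<bullet> f j) (restrict (\<lambda>j. incr \<delta> j \<omega>) (?K n))) {..<N}"
    by (rule indep_vars_compose2)
       (intro borel_measurable_sum borel_measurable_inner measurable_component_singleton borel_measurable_const)
  then show ?thesis by (simp add: block_def[abs_def])
qed

lemma block_tail:
  assumes \<delta>: "0 < \<delta>" and v: "v = \<delta> * (\<Sum>j<L. (norm (response D \<theta> (real j * \<delta>)))\<^sup>2)" "v > 0" and r: "r \<ge> 0"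
  shows "exp (- (r / sqrt v + 1)\<^sup>2 / 2) / sqrt (2 * pi) \<le> prob {\<omega>\<in>space M. r \<le> block \<delta> \<theta> L n \<omega>}"
proof -
  let ?u = "\<lambda>j. response D \<theta> (real (n*L + L - Suc j) * \<delta>)"
  have s: "(\<Sum>j\<in>{n*L..<n*L+L}. (norm (?u j))\<^sup>2) = (\<Sum>j<L. (norm (response D \<theta> (real j * \<delta>)))\<^sup>2)"
    by (rule sum.reindex_bij_witness[of _ "\<lambda>i. n*L + L - Suc i" "\<lambda>j. n*L + L - Suc j"]) auto
  have "(\<Sum>j\<in>{n*L..<n*L+L}. (norm (?u j))\<^sup>2) > 0" using v \<delta> unfolding s by (simp add: zero_less_mult_iff)
  from incr_sum_normal[OF \<delta> _ this]
  have "distributed M lborel (block \<delta> \<theta> L n) (normal_density 0 (sqrt v))"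
    unfolding s v(1)[symmetric] block_def[abs_def] by simp
  from normal_tail_lower[OF this _ r] v show ?thesis by simp
qed

text \<open>The lower half of the growth law, as in the second Borel-Cantelli lemma: the
  exceedance probabilities are at least \<open>c/(n+1)\<close>, and by independence the probability that
  blocks \<open>N, ..., N+m-1\<close> all stay low is at most \<open>exp(-c \<Sum> 1/(n+1))\<close>.\<close>

lemma block_recurrent:
  assumes \<delta>: "0 < \<delta>" and v: "v = \<delta> * (\<Sum>j<L. (norm (response D \<theta> (real j * \<delta>)))\<^sup>2)" "v > 0"
    and \<gamma>: "\<gamma> \<ge> 0" "\<gamma>\<^sup>2 < 2 * v"
  shows "AE \<omega> in M. \<forall>N. \<exists>n\<ge>N. \<gamma> * ell (real (n*L + L) * \<delta>) \<le> block \<delta> \<theta> L n \<omega>"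
proof -
  define r where "r n = \<gamma> * ell (real (n*L + L) * \<delta>)" for n
  define g where "g = \<gamma> / sqrt v"
  define \<kappa> where "\<kappa> = 1 - g\<^sup>2 / 2"
  define C where "C = 1/2 + g\<^sup>2 / (4 * \<kappa>)"
  define c where "c = exp (- C) / sqrt (2 * pi) / (real L * \<delta> + 3)"
  have \<kappa>: "\<kappa> > 0" using \<gamma> v by (simp add: \<kappa>_def g_def power_divide field_simps)
  have c: "c > 0" unfolding c_def using \<delta> by (intro divide_pos_pos) (auto intro: add_nonneg_pos)
  have x0: "0 \<le> real (n*L + L) * \<delta>" for n using \<delta> by simp
  have r0: "r n \<ge> 0" for n using \<gamma> ell_nonneg[OF x0[of n]] by (simp add: r_def)
  have lower: "c / real (Suc n) \<le> prob {\<omega>\<in>space M. r n \<le> block \<delta> \<theta> L n \<omega>}" for n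
  proof -
    let ?l = "ell (real (n*L + L) * \<delta>)" and ?x = "real (n*L + L) * \<delta>"
    \<comment> \<open>Completing the square: \<open>(g l + 1)^2 / 2 \<le> l^2 + C\<close> because \<open>g^2 < 2\<close>.\<close>
    have "0 \<le> (2 * \<kappa> * ?l - g)\<^sup>2 / (4 * \<kappa>)" using \<kappa> by simp
    also have "\<dots> = \<kappa> * ?l\<^sup>2 - g * ?l + g\<^sup>2 / (4 * \<kappa>)"
      using \<kappa> by (simp add: power2_eq_square field_simps)
    also have "\<kappa> * ?l\<^sup>2 = ?l\<^sup>2 - g\<^sup>2 * ?l\<^sup>2 / 2" by (simp add: \<kappa>_def left_diff_distrib)
    finally have sq: "0 \<le> ?l\<^sup>2 - g\<^sup>2 * ?l\<^sup>2 / 2 - g * ?l + g\<^sup>2 / (4 * \<kappa>)" .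
    have "(g * ?l + 1)\<^sup>2 / 2 = g\<^sup>2 * ?l\<^sup>2 / 2 + g * ?l + 1 / 2"
      by (simp add: power2_sum power_mult_distrib add_divide_distrib)
    with sq have "(g * ?l + 1)\<^sup>2 / 2 \<le> ?l\<^sup>2 + C"
      unfolding C_def by linarith
    then have "(r n / sqrt v + 1)\<^sup>2 / 2 \<le> ln (?x + 3) + C"
      using ell_square[OF x0[of n]] by (simp add: r_def g_def)
    then have e1: "exp (- (ln (?x + 3) + C)) \<le> exp (- (r n / sqrt v + 1)\<^sup>2 / 2)" by simp
    have e2: "exp (- (ln (?x + 3) + C)) = exp (- C) / (?x + 3)"
    proof -
      have y: "0 < ?x + 3" using x0[of n] by linarith
      have "exp (- (ln (?x + 3) + C)) = inverse ((?x + 3) * exp C)"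
        by (simp only: exp_minus exp_add exp_ln[OF y])
      then show ?thesis by (simp add: exp_minus divide_inverse mult.commute)
    qed
    have "exp (- C) / (?x + 3) / sqrt (2 * pi) \<le> exp (- (r n / sqrt v + 1)\<^sup>2 / 2) / sqrt (2 * pi)"
      by (rule divide_right_mono[OF e1[unfolded e2]]) simp
    also have "\<dots> \<le> prob {\<omega>\<in>space M. r n \<le> block \<delta> \<theta> L n \<omega>}" by (rule block_tail[OF \<delta> v r0])
    finally have *: "exp (- C) / (?x + 3) / sqrt (2 * pi) \<le> prob {\<omega>\<in>space M. r n \<le> block \<delta> \<theta> L n \<omega>}" .
    have "?x + 3 \<le> (real L * \<delta> + 3) * real (Suc n)" using \<delta> by (simp add: algebra_simps)
    then have "exp (- C) / ((real L * \<delta> + 3) * real (Suc n)) \<le> exp (- C) / (?x + 3)"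
      using x0[of n] \<delta> by (intro divide_left_mono mult_pos_pos) (auto intro!: add_nonneg_pos simp del: of_nat_Suc)
    then have "exp (- C) / ((real L * \<delta> + 3) * real (Suc n)) / sqrt (2 * pi) \<le> exp (- C) / (?x + 3) / sqrt (2 * pi)"
      by (intro divide_right_mono) auto
    moreover have "exp (- C) / ((real L * \<delta> + 3) * real (Suc n)) / sqrt (2 * pi) = c / real (Suc n)"
      by (simp add: c_def)
    ultimately show ?thesis using * by simp
  qed
  have "AE \<omega> in M. \<exists>n\<ge>N. r n \<le> block \<delta> \<theta> L n \<omega>" for N
  proof -
    define S where "S = {\<omega>\<in>space M. \<forall>n\<in>{N..}. block \<delta> \<theta> L n \<omega> < r n}"
    have bm: "block \<delta> \<theta> L n \<in> borel_measurable M" for n using \<delta> by (intro block_measurable) simp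
    have S: "S \<in> events" unfolding S_def using bm by measurable
    have bound: "prob S \<le> exp (- (c * (\<Sum>n\<in>{N..<N+m}. 1 / real (Suc n))))" if m: "m > 0" for m
    proof -
      let ?A = "\<lambda>n. block \<delta> \<theta> L n -` {..<r n} \<inter> space M"
      have "S \<subseteq> (\<Inter>n\<in>{N..<N+m}. ?A n)" using m by (auto simp: S_def)
      then have "prob S \<le> prob (\<Inter>n\<in>{N..<N+m}. ?A n)"
        using bm m by (intro finite_measure_mono sets.finite_INT measurable_sets[OF bm]) auto
      also have "\<dots> = (\<Prod>n\<in>{N..<N+m}. prob (?A n))"
        using block_indep[of \<delta> \<theta> L "N + m"] \<delta> m by (intro indep_varsD) auto
      also have "\<dots> \<le> (\<Prod>n\<in>{N..<N+m}. exp (- (c * (1 / real (Suc n)))))"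
      proof (intro prod_mono conjI)
        fix n
        have "?A n = space M - {\<omega>\<in>space M. r n \<le> block \<delta> \<theta> L n \<omega>}" by auto
        moreover have "{\<omega>\<in>space M. r n \<le> block \<delta> \<theta> L n \<omega>} \<in> events" using bm[of n] by measurable
        ultimately have "prob (?A n) = 1 - prob {\<omega>\<in>space M. r n \<le> block \<delta> \<theta> L n \<omega>}"
          by (simp add: prob_compl)
        also have "\<dots> \<le> 1 + - (c * (1 / real (Suc n)))" using lower[of n] by simp
        also have "\<dots> \<le> exp (- (c * (1 / real (Suc n))))" by (rule exp_ge_add_one_self)
        finally show "prob (?A n) \<le> exp (- (c * (1 / real (Suc n))))" .
      qed simp
      also have "\<dots> = exp (- (c * (\<Sum>n\<in>{N..<N+m}. 1 / real (Suc n))))"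
        by (simp add: exp_sum[symmetric] sum_distrib_left sum_negf)
      finally show ?thesis .
    qed
    have "prob S \<le> 0"
    proof (rule ccontr)
      assume "\<not> prob S \<le> 0"
      then have pS: "prob S > 0" by simp
      have "\<not> summable (\<lambda>n. 1 / real (Suc (n + N)))"
      proof
        assume "summable (\<lambda>n. 1 / real (Suc (n + N)))"
        then have "summable (\<lambda>n. 1 / real n)"
          using summable_iff_shift[of "\<lambda>n. 1 / real n" "Suc N"] by simp
        then show False using not_summable_harmonic[where 'a=real] by (simp add: inverse_eq_divide)
      qed
      moreover have "summable (\<lambda>n. 1 / real (Suc (n + N)))"
      proof (rule bounded_imp_summable)
        fix m :: nat
        have "(\<Sum>n\<le>m. 1 / real (Suc (n + N))) = (\<Sum>n\<in>{N..<N+Suc m}. 1 / real (Suc n))"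
          by (rule sum.reindex_bij_witness[of _ "\<lambda>n. n - N" "\<lambda>n. n + N"]) auto
        moreover have "ln (prob S) \<le> ln (exp (- (c * (\<Sum>n\<in>{N..<N+Suc m}. 1 / real (Suc n)))))"
          using pS bound[of "Suc m"] by (subst ln_le_cancel_iff) (simp_all only: exp_gt_zero zero_less_Suc)
        ultimately show "(\<Sum>n\<le>m. 1 / real (Suc (n + N))) \<le> - ln (prob S) / c"
          using c by (simp only: ln_exp) (simp add: field_simps del: sum.op_ivl_Suc)
      qed simp
      ultimately show False by simp
    qed
    then have "S \<in> null_sets M" using S by (simp add: null_sets_def emeasure_eq_measure measure_le_0_iff)
    then have "AE \<omega> in M. \<omega> \<notin> S" by (rule AE_not_in)
    then show ?thesis by (rule AE_mp) (auto intro!: AE_I2 simp: S_def not_less)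
  qed
  then have "AE \<omega> in M. \<forall>N. \<exists>n\<ge>N. r n \<le> block \<delta> \<theta> L n \<omega>" by (subst AE_all_countable) blast
  then show ?thesis unfolding r_def .
qed

end

section \<open>Growth of the solutions\<close>

lemma grid_cell:
  assumes "0 < \<delta>" "0 \<le> (t::real)"
  obtains k :: nat where "real k * \<delta> \<le> t" "t \<le> real (Suc k) * \<delta>"
proof
  have "0 \<le> t / \<delta>" using assms by simp
  then have "real (nat \<lfloor>t / \<delta>\<rfloor>) \<le> t / \<delta>" "t / \<delta> \<le> real (nat \<lfloor>t / \<delta>\<rfloor>) + 1"
    by (auto simp: of_nat_floor)
  then show "real (nat \<lfloor>t / \<delta>\<rfloor>) * \<delta> \<le> t" "t \<le> real (Suc (nat \<lfloor>t / \<delta>\<rfloor>)) * \<delta>"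
    using assms(1) by (auto simp: pos_le_divide_eq pos_divide_le_eq add.commute)
qed

lemma Limsup_eq_of_growth:
  fixes X :: "real \<Rightarrow> 'a::real_normed_vector"
  assumes up: "\<And>m::nat. \<exists>B. \<forall>t\<ge>0. norm (X t) \<le> (s + 1 / real (Suc m)) * ell t + B"
    and low: "\<And>m::nat. \<exists>B. \<forall>T. \<exists>t\<ge>T. (s - 1 / real (Suc m)) * ell t - B \<le> norm (X t)"
  shows "Limsup at_top (\<lambda>t. ereal (norm (X t) / sqrt (ln t))) = ereal s"
proof -
  let ?f = "\<lambda>t. ereal (norm (X t) / sqrt (ln t))"
  have lim: "((\<lambda>t. (u * ell t + B) / sqrt (ln t)) \<longlongrightarrow> u) at_top" for u B
    unfolding ell_def by real_asymp
  have pos: "\<forall>\<^sub>F t::real in at_top. 0 < sqrt (ln t) \<and> 0 \<le> t"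
    using eventually_gt_at_top[of 1] by eventually_elim simp
  have inv0: "(\<lambda>m. 1 / real (Suc m)) \<longlonglongrightarrow> 0" using LIMSEQ_inverse_real_of_nat by (simp add: inverse_eq_divide)
  have 1: "Limsup at_top ?f \<le> ereal (s + 1 / real (Suc m))" for m
  proof -
    obtain B where B: "\<And>t. t \<ge> 0 \<Longrightarrow> norm (X t) \<le> (s + 1 / real (Suc m)) * ell t + B" using up by blast
    have "Limsup at_top ?f \<le> Limsup at_top (\<lambda>t. ereal (((s + 1 / real (Suc m)) * ell t + B) / sqrt (ln t)))"
      by (rule Limsup_mono, rule eventually_mono[OF pos]) (auto intro!: divide_right_mono B simp del: of_nat_Suc)
    also have "\<dots> = ereal (s + 1 / real (Suc m))"
      using lim by (intro lim_imp_Limsup) auto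
    finally show ?thesis .
  qed
  have "(\<lambda>m. ereal (s + 1 / real (Suc m))) \<longlonglongrightarrow> ereal (s + 0)" by (intro tendsto_intros inv0)
  then have le: "Limsup at_top ?f \<le> ereal s"
    unfolding add_0_right by (rule LIMSEQ_le_const) (use 1 in blast)
  have 2: "ereal (s - 1 / real (Suc m)) \<le> Limsup at_top ?f" for m
  proof (rule ccontr)
    assume "\<not> ?thesis"
    then have "Limsup at_top ?f < ereal (s - 1 / real (Suc m))" by simp
    then obtain y where y: "Limsup at_top ?f < ereal y" "ereal y < ereal (s - 1 / real (Suc m))"
      using ereal_dense2 by blast
    obtain B where B: "\<And>T. \<exists>t\<ge>T. (s - 1 / real (Suc m)) * ell t - B \<le> norm (X t)" using low by blast
    have "\<forall>\<^sub>F t in at_top. ?f t < ereal y" by (rule Limsup_lessD[OF y(1)])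
    moreover have "\<forall>\<^sub>F t in at_top. y < ((s - 1 / real (Suc m)) * ell t + (- B)) / sqrt (ln t)"
      by (rule order_tendstoD(1)[OF lim]) (use y(2) in simp)
    ultimately have "\<forall>\<^sub>F t in at_top. norm (X t) < (s - 1 / real (Suc m)) * ell t - B"
      using pos
    proof eventually_elim
      case (elim t)
      then have "norm (X t) / sqrt (ln t) < ((s - 1 / real (Suc m)) * ell t - B) / sqrt (ln t)" by simp
      with elim(3) show ?case by (simp only: divide_less_cancel)
    qed
    then obtain T where "\<And>t. t \<ge> T \<Longrightarrow> norm (X t) < (s - 1 / real (Suc m)) * ell t - B"
      by (auto simp: eventually_at_top_linorder)
    with B[of T] show False by (meson not_le)
  qed
  have "(\<lambda>m. ereal (s - 1 / real (Suc m))) \<longlonglongrightarrow> ereal (s - 0)" by (intro tendsto_intros inv0)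
  then have "ereal s \<le> Limsup at_top ?f"
    unfolding diff_0_right by (rule LIMSEQ_le_const2) (use 2 in blast)
  with le show ?thesis by (rule antisym)
qed

text \<open>The mesh and the block length are chosen from \<open>\<rho>\<close>, \<open>A\<close> and \<open>D\<close> before the exceptional set,
  which therefore depends neither on the solution nor on its initial value. The first half of
  the conclusion uses the upper growth bound in each cell, the second half the grid times at
  which a block is large.\<close>

lemma (in stable_noise) solution_growth:
  defines "\<mu> \<equiv> Max (eigenvalues (stationary_covariance A D))"
  assumes \<rho>: "\<rho> > 0" and F: "continuous_on UNIV F" "(\<lambda>x. norm (F x)) \<in> o[at_infinity](\<lambda>x. norm x)"
  shows "AE \<omega> in M. \<forall>x X. pathwise_solution F A D (\<lambda>t. W t \<omega>) x X \<longrightarrow>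
    (\<exists>B. \<forall>t\<ge>0. norm (X t) \<le> (sqrt (2 * \<mu>) + \<rho>) * ell t + B) \<and>
    (\<exists>B. \<forall>T. \<exists>t\<ge>T. (sqrt (2 * \<mu>) - \<rho>) * ell t - B \<le> norm (X t))"
proof -
  define s where "s = sqrt (2 * \<mu>)"
  obtain C1 where C1: "C1 \<ge> 0" "\<And>\<delta> \<theta> k. 0 < \<delta> \<Longrightarrow> \<delta> \<le> 1 \<Longrightarrow>
    \<delta> * (\<Sum>j<(k::nat). (norm (response D \<theta> (real j * \<delta>)))\<^sup>2) \<le> (\<mu> + C1 * \<delta>) * (norm \<theta>)\<^sup>2"
    unfolding \<mu>_def by (rule discrete_variance_upper[of D]) blast
  obtain \<theta> C2 where th: "norm \<theta> = 1" and C2: "C2 \<ge> 0" and \<mu>: "\<mu> \<ge> 0"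
    and lowvar: "\<And>\<delta> \<epsilon>. 0 < \<delta> \<Longrightarrow> \<delta> \<le> 1 \<Longrightarrow> 0 < \<epsilon> \<Longrightarrow>
      \<exists>L0. \<forall>k\<ge>L0. \<mu> - C2 * \<delta> - \<epsilon> \<le> \<delta> * (\<Sum>j<(k::nat). (norm (response D \<theta> (real j * \<delta>)))\<^sup>2)"
    unfolding \<mu>_def by (rule discrete_variance_lower[of D]) blast
  have s: "s \<ge> 0" "s\<^sup>2 = 2 * \<mu>" using \<mu> by (auto simp: s_def)
  define c where "c = noise_gain D"
  have c: "c > 0" unfolding c_def by (rule noise_gain_pos)
  define c4 where "c4 = onorm ((*v) A) * K"
  have c4: "c4 \<ge> 0" using K onorm_pos_le[OF matrix_vector_mul_bounded_linear[of A]] by (simp add: c4_def)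
  define \<gamma> where "\<gamma> = s + \<rho> / 2"
  \<comment> \<open>A variance bound strictly between \<open>\<mu>\<close> and \<open>\<gamma>^2 / 2\<close>, which leaves room for the discretisation
    error \<open>C1 \<delta>\<close>.\<close>
  define V where "V = (\<mu> + \<gamma>\<^sup>2 / 2) / 2"
  have \<gamma>: "\<gamma> > 0" using s \<rho> by (simp add: \<gamma>_def)
  have V: "\<mu> < V" "V > 0" "sqrt (2 * V) < \<gamma>"
  proof -
    have "s\<^sup>2 < \<gamma>\<^sup>2" using s \<rho> by (intro power_strict_mono) (auto simp: \<gamma>_def)
    then have "2 * \<mu> < \<gamma>\<^sup>2" using s by simp
    then show "\<mu> < V" "V > 0" using \<mu> by (auto simp: V_def)
    have "2 * V < \<gamma>\<^sup>2" using \<open>2 * \<mu> < \<gamma>\<^sup>2\<close> by (simp add: V_def)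
    then have "sqrt (2 * V) < sqrt (\<gamma>\<^sup>2)" by (rule real_sqrt_less_mono)
    then show "sqrt (2 * V) < \<gamma>" using \<gamma> by simp
  qed
  \<comment> \<open>The lower bound is only at stake when \<open>\<rho> < s\<close>; otherwise \<open>s - \<rho> \<le> 0\<close>. A third of \<open>\<rho>\<close> is given
    away in the rate of the blocks, a third in the damped past and a quarter in the comparison
    with the solution.\<close>
  define \<gamma>' where "\<gamma>' = s - \<rho> / 3"
  define \<epsilon> where "\<epsilon> = (if \<rho> < s then (\<mu> - \<gamma>'\<^sup>2 / 2) / 3 else 1)"
  have \<gamma>': "\<gamma>' > 0" "\<gamma>'\<^sup>2 < 2 * \<mu>" if "\<rho> < s"
  proof -
    show "\<gamma>' > 0" using that \<rho> by (simp add: \<gamma>'_def)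
    then have "\<gamma>'\<^sup>2 < s\<^sup>2" using \<rho> by (intro power_strict_mono) (auto simp: \<gamma>'_def)
    then show "\<gamma>'\<^sup>2 < 2 * \<mu>" using s by simp
  qed
  have \<epsilon>: "\<epsilon> > 0" using \<gamma>' by (auto simp: \<epsilon>_def)
  define \<eta> where "\<eta> = \<rho> / 4 / c"
  have \<eta>: "\<eta> > 0" "c * \<eta> \<le> \<rho> / 4" using c \<rho> by (auto simp: \<eta>_def)
  obtain \<delta>0 where \<delta>0: "\<delta>0 > 0" and modulus: "AE \<omega> in M. \<exists>B\<ge>0. \<forall>s t. 0 \<le> s \<longrightarrow> s \<le> t \<longrightarrow> t \<le> s + \<delta>0 \<longrightarrow>
     norm (W t \<omega> - W s \<omega>) \<le> \<eta> * ell t + B"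
    using brownian_modulus[OF \<eta>(1)] by blast
  \<comment> \<open>The five bounds control, in this order: the validity of the estimates, the path oscillation, the
    excess variance, the motion of the propagator within a cell, and the missing variance.\<close>
  define \<delta> where "\<delta> = Min {1, \<delta>0, (V - \<mu>) / (C1 + 1), \<rho> / 4 / (c4 * \<gamma> + 1), \<epsilon> / (C2 + 1)}"
  have c4\<gamma>: "c4 * \<gamma> \<ge> 0" using c4 \<gamma> by simp
  have \<delta>: "0 < \<delta>" "\<delta> \<le> 1" "\<delta> \<le> \<delta>0"
    using \<delta>0 V C1(1) \<rho> c4\<gamma> \<epsilon> C2 by (auto simp: \<delta>_def intro!: divide_pos_pos add_nonneg_pos)
  have small: "C * \<delta> \<le> y" if "\<delta> \<le> y / (C + 1)" "C \<ge> 0" "y > 0" for C y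
  proof -
    have "\<delta> * (C + 1) \<le> y" using that by (simp add: pos_le_divide_eq)
    with \<delta>(1) show ?thesis by (simp add: algebra_simps)
  qed
  have d1: "C1 * \<delta> \<le> V - \<mu>" using V C1(1) by (intro small) (auto simp: \<delta>_def)
  have d2: "c4 * \<gamma> * \<delta> \<le> \<rho> / 4" using \<rho> c4\<gamma> by (intro small) (auto simp: \<delta>_def)
  have d3: "C2 * \<delta> \<le> \<epsilon>" using \<epsilon> C2 by (intro small) (auto simp: \<delta>_def)
  have growth: "AE \<omega> in M. \<exists>B\<ge>0. \<forall>k. norm (Z \<delta> \<omega> k) \<le> \<gamma> * ell (real k * \<delta>) + B"
  proof (rule Z_growth_upper[OF \<delta>(1,2) V(2) _ V(3)])
    fix k and \<theta> :: "real^'n"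
    have "(\<mu> + C1 * \<delta>) * (norm \<theta>)\<^sup>2 \<le> V * (norm \<theta>)\<^sup>2" using d1 by (intro mult_right_mono) auto
    with C1(2)[OF \<delta>(1,2)]
    show "\<delta> * (\<Sum>j<k. (norm (response D \<theta> (real j * \<delta>)))\<^sup>2) \<le> V * (norm \<theta>)\<^sup>2"
      by (rule order.trans)
  qed
  obtain L where L: "\<rho> < s \<Longrightarrow> L > 0 \<and> K * exp (- a * (real L * \<delta>)) * \<gamma> \<le> \<rho> / 3"
    and rec: "AE \<omega> in M. \<rho> < s \<longrightarrow> (\<forall>N. \<exists>n\<ge>N. \<gamma>' * ell (real (n*L + L) * \<delta>) \<le> block \<delta> \<theta> L n \<omega>)"
  proof (cases "\<rho> < s")
    case True
    obtain L0 where L0: "\<And>k. k \<ge> L0 \<Longrightarrow> \<mu> - C2 * \<delta> - \<epsilon> \<le> \<delta> * (\<Sum>j<(k::nat). (norm (response D \<theta> (real j * \<delta>)))\<^sup>2)"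
      using lowvar[OF \<delta>(1,2) \<epsilon>] by blast
    have "(\<lambda>k. K * exp (- a * (real k * \<delta>)) * \<gamma>) \<longlonglongrightarrow> 0" using a \<delta>(1) by real_asymp
    then have "\<forall>\<^sub>F k in sequentially. K * exp (- a * (real k * \<delta>)) * \<gamma> < \<rho> / 3"
      using \<rho> by (intro order_tendstoD) auto
    then obtain L1 where L1: "\<And>k. k \<ge> L1 \<Longrightarrow> K * exp (- a * (real k * \<delta>)) * \<gamma> < \<rho> / 3"
      by (auto simp: eventually_sequentially)
    define L where "L = max (max L0 L1) 1"
    have "\<mu> - 2 * \<epsilon> \<le> \<delta> * (\<Sum>j<L. (norm (response D \<theta> (real j * \<delta>)))\<^sup>2)"
    proof -
      have "L \<ge> L0" by (simp add: L_def)
      from L0[OF this] d3 show ?thesis by linarith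
    qed
    moreover have "\<mu> - 2 * \<epsilon> > \<gamma>'\<^sup>2 / 2" using True \<gamma>'(2)[OF True] by (simp add: \<epsilon>_def field_simps)
    ultimately have v: "\<gamma>'\<^sup>2 < 2 * (\<delta> * (\<Sum>j<L. (norm (response D \<theta> (real j * \<delta>)))\<^sup>2))" by linarith
    have "\<delta> * (\<Sum>j<L. (norm (response D \<theta> (real j * \<delta>)))\<^sup>2) > 0"
      using v zero_le_power2[of \<gamma>'] by linarith
    from block_recurrent[OF \<delta>(1) refl this _ v] \<gamma>'(1)[OF True]
    have "AE \<omega> in M. \<forall>N. \<exists>n\<ge>N. \<gamma>' * ell (real (n*L + L) * \<delta>) \<le> block \<delta> \<theta> L n \<omega>" by simp
    then show ?thesis using L1[of L] by (intro that[of L]) (auto simp: L_def less_imp_le)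
  qed (auto intro: that[of 0])
  from modulus growth rec AE_space show ?thesis unfolding s_def[symmetric]
  proof eventually_elim
    case (elim \<omega>)
    obtain B1 where B1: "\<And>s t. 0 \<le> s \<Longrightarrow> s \<le> t \<Longrightarrow> t \<le> s + \<delta>0 \<Longrightarrow> norm (W t \<omega> - W s \<omega>) \<le> \<eta> * ell t + B1"
      using elim(1) by blast
    obtain B' where B': "B' \<ge> 0" "\<And>k. norm (Z \<delta> \<omega> k) \<le> \<gamma> * ell (real k * \<delta>) + B'"
      using elim(2) by blast
    show ?case
    proof (intro allI impI)
      fix x X assume sol: "pathwise_solution F A D (\<lambda>t. W t \<omega>) x X"
      have "\<exists>B2\<ge>0. \<forall>t k. real k * \<delta> \<le> t \<longrightarrow> t \<le> real (Suc k) * \<delta> \<longrightarrow>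
        norm (X t - flow A (t - real k * \<delta>) *v Z \<delta> \<omega> k) \<le> \<rho> / 4 * ell t + B2"
      proof (rule solution_near_noise_sum[OF _ \<delta>(1,2) \<eta>[unfolded c_def] sol F W_0[OF elim(4)]])
        show "norm (W t \<omega> - W s \<omega>) \<le> \<eta> * ell t + B1" if "0 \<le> s" "s \<le> t" "t \<le> s + \<delta>" for s t
          using B1[of s t] that \<delta>(3) by simp
        show "norm (Z \<delta> \<omega> k) \<le> \<gamma> * ell (real k * \<delta>) + B'" for k by (rule B'(2))
      qed (use \<rho> in simp)
      then obtain B2 where B2: "B2 \<ge> 0" "\<And>t k. real k * \<delta> \<le> t \<Longrightarrow> t \<le> real (Suc k) * \<delta> \<Longrightarrow>
        norm (X t - flow A (t - real k * \<delta>) *v Z \<delta> \<omega> k) \<le> \<rho> / 4 * ell t + B2"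
        by blast
      have "norm (X t) \<le> (s + \<rho>) * ell t + ((1 + c4) * B' + B2)" if t: "0 \<le> t" for t
      proof -
        obtain k where k: "real k * \<delta> \<le> t" "t \<le> real (Suc k) * \<delta>" using grid_cell[OF \<delta>(1) t] .
        have u: "0 \<le> t - real k * \<delta>" "t - real k * \<delta> \<le> \<delta>" using k by (auto simp: algebra_simps)
        have e: "0 \<le> ell t" by (rule ell_nonneg[OF t])
        have "\<gamma> * ell (real k * \<delta>) \<le> \<gamma> * ell t" using \<gamma> k \<delta> by (intro mult_left_mono ell_mono) auto
        with B'(2)[of k] have z: "norm (Z \<delta> \<omega> k) \<le> \<gamma> * ell t + B'" by linarith
        have "norm (flow A (t - real k * \<delta>) *v Z \<delta> \<omega> k) \<le> (1 + c4 * (t - real k * \<delta>)) * norm (Z \<delta> \<omega> k)"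
          using flow_near_identity[OF u(1)] by (simp add: c4_def)
        also have "\<dots> \<le> (1 + c4 * \<delta>) * (\<gamma> * ell t + B')"
          using u c4 z \<delta> by (intro mult_mono add_left_mono mult_left_mono) auto
        also have "\<dots> = \<gamma> * ell t + c4 * \<gamma> * \<delta> * ell t + (1 + c4 * \<delta>) * B'"
          by (simp add: algebra_simps)
        also have "\<dots> \<le> \<gamma> * ell t + \<rho> / 4 * ell t + (1 + c4) * B'"
          using d2 e c4 \<delta> B'(1) mult_left_mono[of \<delta> 1 c4] by (intro add_mono mult_right_mono) auto
        finally have "norm (flow A (t - real k * \<delta>) *v Z \<delta> \<omega> k) \<le> \<gamma> * ell t + \<rho> / 4 * ell t + (1 + c4) * B'" .
        moreover have "norm (X t) \<le> norm (X t - flow A (t - real k * \<delta>) *v Z \<delta> \<omega> k) + norm (flow A (t - real k * \<delta>) *v Z \<delta> \<omega> k)"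
          by (metis add.commute norm_triangle_sub)
        moreover have "\<gamma> * ell t = s * ell t + \<rho> / 2 * ell t" by (simp add: \<gamma>_def algebra_simps)
        moreover have "(s + \<rho>) * ell t = s * ell t + \<rho> / 2 * ell t + \<rho> / 4 * ell t + \<rho> / 4 * ell t"
          by (simp add: algebra_simps)
        ultimately show ?thesis using B2(2)[OF k] by linarith
      qed
      moreover have "\<exists>t\<ge>T. (s - \<rho>) * ell t - (B2 + K * B') \<le> norm (X t)" for T
      proof (cases "\<rho> < s")
        case False
        have "(s - \<rho>) * ell (max T 0) \<le> 0" using False by (intro mult_nonpos_nonneg ell_nonneg) auto
        moreover have "0 \<le> B2 + K * B'" using B2 B' K by simp
        ultimately show ?thesis by (intro exI[of _ "max T 0"]) (auto intro: order.trans[OF _ norm_ge_zero])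
      next
        case True
        define N where "N = nat \<lceil>T / \<delta>\<rceil>"
        obtain n where n: "n \<ge> N" "\<gamma>' * ell (real (n*L + L) * \<delta>) \<le> block \<delta> \<theta> L n \<omega>"
          using elim(3) True by blast
        define k where "k = n * L + L"
        define t where "t = real k * \<delta>"
        have L': "L \<ge> 1" using L[OF True] by simp
        have "N \<le> n * L" using n(1) L' by (metis le_trans mult.right_neutral mult_le_mono2)
        then have Nk: "real N \<le> real k" unfolding of_nat_le_iff k_def by (rule trans_le_add1)
        have "T / \<delta> \<le> real N" unfolding N_def by (rule real_nat_ceiling_ge)
        then have "T / \<delta> \<le> real k" using Nk by linarith
        then have tT: "t \<ge> T" using \<delta>(1) by (simp add: t_def pos_divide_le_eq)
        have t0: "0 \<le> t" using \<delta> by (simp add: t_def)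
        have e: "0 \<le> ell t" by (rule ell_nonneg[OF t0])
        have l0: "0 \<le> real L * \<delta>" using \<delta> by simp
        have "norm (flow A (real L * \<delta>) *v Z \<delta> \<omega> (n*L)) \<le> K * exp (- a * (real L * \<delta>)) * norm (Z \<delta> \<omega> (n*L))"
          by (rule decay[OF l0])
        also have "\<dots> \<le> K * exp (- a * (real L * \<delta>)) * (\<gamma> * ell t + B')"
        proof (intro mult_left_mono)
          have "ell (real (n*L) * \<delta>) \<le> ell t" unfolding t_def k_def using \<delta> by (intro ell_mono mult_right_mono) auto
          then have "\<gamma> * ell (real (n*L) * \<delta>) \<le> \<gamma> * ell t" using \<gamma> by (intro mult_left_mono) auto
          with B'(2)[of "n*L"] show "norm (Z \<delta> \<omega> (n*L)) \<le> \<gamma> * ell t + B'" by linarith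
        qed (use K in auto)
        also have "\<dots> = (K * exp (- a * (real L * \<delta>)) * \<gamma>) * ell t + K * exp (- a * (real L * \<delta>)) * B'"
          by (simp add: algebra_simps)
        also have "\<dots> \<le> \<rho> / 3 * ell t + K * 1 * B'"
          using L[OF True] e K B' a l0 by (intro add_mono mult_right_mono mult_left_mono) auto
        finally have f: "norm (flow A (real L * \<delta>) *v Z \<delta> \<omega> (n*L)) \<le> \<rho> / 3 * ell t + K * B'" by simp
        have "\<gamma>' * ell t \<le> block \<delta> \<theta> L n \<omega>" using n(2) by (simp add: t_def k_def)
        also have "\<dots> = \<theta> \<bullet> Z \<delta> \<omega> k - \<theta> \<bullet> (flow A (real L * \<delta>) *v Z \<delta> \<omega> (n*L))"
          unfolding k_def by (simp add: Z_block)
        also have "\<dots> \<le> norm (Z \<delta> \<omega> k) + norm (flow A (real L * \<delta>) *v Z \<delta> \<omega> (n*L))"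
          using norm_cauchy_schwarz[of \<theta> "Z \<delta> \<omega> k"] th
            Cauchy_Schwarz_ineq2[of \<theta> "flow A (real L * \<delta>) *v Z \<delta> \<omega> (n*L)"] by simp
        finally have "\<gamma>' * ell t - \<rho> / 3 * ell t - K * B' \<le> norm (Z \<delta> \<omega> k)" using f by linarith
        moreover have "norm (X t - Z \<delta> \<omega> k) \<le> \<rho> / 4 * ell t + B2"
        proof -
          have "real k * \<delta> \<le> t" "t \<le> real (Suc k) * \<delta>" using \<delta> by (auto simp: t_def)
          from B2(2)[OF this] show ?thesis by (simp add: t_def)
        qed
        moreover have "norm (Z \<delta> \<omega> k) \<le> norm (X t) + norm (X t - Z \<delta> \<omega> k)"
          by (metis norm_minus_commute norm_triangle_sub)
        moreover have "(s - \<rho>) * ell t \<le> \<gamma>' * ell t - \<rho> / 3 * ell t - \<rho> / 4 * ell t"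
        proof -
          have "(s - \<rho>) * ell t \<le> (\<gamma>' - \<rho> / 3 - \<rho> / 4) * ell t"
            using e \<rho> by (intro mult_right_mono) (auto simp: \<gamma>'_def)
          then show ?thesis by (simp add: algebra_simps)
        qed
        ultimately have "(s - \<rho>) * ell t - (B2 + K * B') \<le> norm (X t)" by linarith
        with tT show ?thesis by blast
      qed
      ultimately show "(\<exists>B. \<forall>t\<ge>0. norm (X t) \<le> (s + \<rho>) * ell t + B) \<and>
        (\<exists>B. \<forall>T. \<exists>t\<ge>T. (s - \<rho>) * ell t - B \<le> norm (X t))"
        by blast
    qed
  qed
qed

theorem theorem1:
  fixes A D :: "real ^ 'n ^ 'n"
    and F :: "real ^ 'n \<Rightarrow> real ^ 'n"
    and M :: "'w measure"
    and W :: "real \<Rightarrow> 'w \<Rightarrow> real ^ 'n"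
    and \<Sigma> :: "real ^ 'n ^ 'n"
    and lambda1 :: real
  assumes "CARD('n) \<ge> 2"
    and "\<forall>c \<in> eigenvalues (map_matrix complex_of_real A). Re c > 0"
    and "continuous_on UNIV F"
    and "(\<lambda>x. norm (F x)) \<in> o[at_infinity](\<lambda>x. norm x)"
    and "standard_brownian_motion M W"
  defines "\<Sigma> \<equiv> stationary_covariance A D"
    and "lambda1 \<equiv> Max (eigenvalues \<Sigma>)"
  shows "\<exists>N \<in> null_sets M. \<forall>\<omega> \<in> space M - N. \<forall>x X.
           pathwise_solution F A D (\<lambda>t. W t \<omega>) x X \<longrightarrow>
           Limsup at_top (\<lambda>t. ereal (norm (X t) / sqrt (ln t))) = ereal (sqrt (2 * lambda1))"
proof -
  obtain K a where Ka: "K \<ge> 1" "a > 0" "\<And>t v. t \<ge> 0 \<Longrightarrow> norm (flow A t *v v) \<le> K * exp (- a * t) * norm v"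
    using flow_decay[OF assms(2)] by blast
  have "prob_space M" using assms(5) by (simp add: standard_brownian_motion_def)
  then interpret prob_space M .
  interpret stable_noise A K a M W D
    by unfold_locales (use Ka assms(5) in auto)
  have "AE \<omega> in M. \<forall>m::nat. \<forall>x X. pathwise_solution F A D (\<lambda>t. W t \<omega>) x X \<longrightarrow>
    (\<exists>B. \<forall>t\<ge>0. norm (X t) \<le> (sqrt (2 * lambda1) + 1 / real (Suc m)) * ell t + B) \<and>
    (\<exists>B. \<forall>T. \<exists>t\<ge>T. (sqrt (2 * lambda1) - 1 / real (Suc m)) * ell t - B \<le> norm (X t))"
    unfolding AE_all_countable lambda1_def \<Sigma>_def
    by (intro allI solution_growth assms) simp
  then have "AE \<omega> in M. \<forall>x X. pathwise_solution F A D (\<lambda>t. W t \<omega>) x X \<longrightarrow>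
      Limsup at_top (\<lambda>t. ereal (norm (X t) / sqrt (ln t))) = ereal (sqrt (2 * lambda1))"
    by eventually_elim (intro allI impI Limsup_eq_of_growth, blast+)
  then obtain N where N: "{\<omega>\<in>space M. \<not> (\<forall>x X. pathwise_solution F A D (\<lambda>t. W t \<omega>) x X \<longrightarrow>
      Limsup at_top (\<lambda>t. ereal (norm (X t) / sqrt (ln t))) = ereal (sqrt (2 * lambda1)))} \<subseteq> N"
    "emeasure M N = 0" "N \<in> sets M"
    by (rule AE_E)
  then show ?thesis by (intro bexI[of _ N]) (blast, simp add: null_sets_def)
qed

end
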